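(* Let $\Bbbk$ be a field, let $m$ be even, and let $A:=\Bbbk\langle z_1,\ldots,z_m\rangle[K_m^{-1}]$ be the universal localization of the free associative algebra obtained by adjoining a two-sided inverse of the continuant $K_m$. Let $$b_m:A^m\longrightarrow A,\qquad b_m(a_1,\ldots,a_m)=\sum_{i=1}^m[a_i,z_i].$$ Then $$\operatorname{HH}_q(A)\cong\begin{cases}A/[A,A],&q=0,\\ \ker(b_m:A^m\to A),&q=1,\\ 0,&q\ge2.\end{cases}$$
   Context: The continuants $K_j$ are the elements of the free algebra $\Bbbk\langle z_1,\dots,z_m\rangle$ defined recursively by $K_{-1}:=0$, $K_0:=1$, $K_j:=z_jK_{j-1}+K_{j-2}$ for $j\ge1$. Here $[a,b]=ab-ba$, $[A,A]$ is the $\Bbbk$-linear span of all commutators, and $\operatorname{HH}_q(A)=\operatorname{Tor}_q^{A^e}(A,A)$ with $A^e=A\otimes_\Bbbk A^{\mathrm{op}}$ is the Hochschild homology of $A$ over $\Bbbk$; isomorphisms are of $\Bbbk$-vector spaces. *)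

theory Defs
  imports "HOL-Algebra.Module" "HOL-Algebra.QuotRing"
begin

text \<open>
  Everything is carried by the record \<open>('r, 'm) module\<close> of \<open>HOL-Algebra\<close>. An algebra over \<open>K\<close> uses
  all of its fields; a mere module uses \<open>carrier\<close>, \<open>zero\<close>, \<open>add\<close> and \<open>smult\<close>, and its fields
  \<open>mult\<close> and \<open>one\<close> are irrelevant. The locale \<open>module\<close> of the library requires a commutative
  ring of scalars, hence the locale \<open>left_module\<close> below. A right module is a record in which
  \<open>smult M r x\<close> stands for \<open>x r\<close>.
\<close>

section \<open>Modules over noncommutative rings\<close>

locale left_module = R?: ring R + M?: abelian_group M
  for R :: "('r, 'q) ring_scheme" (structure) and M :: "('r, 'm, 'u) module_scheme" (structure) +
  assumes smult_closed [simp, intro]: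
      "\<lbrakk>a \<in> carrier R; x \<in> carrier M\<rbrakk> \<Longrightarrow> a \<odot>\<^bsub>M\<^esub> x \<in> carrier M"
    and smult_l_distr:
      "\<lbrakk>a \<in> carrier R; b \<in> carrier R; x \<in> carrier M\<rbrakk>
        \<Longrightarrow> (a \<oplus> b) \<odot>\<^bsub>M\<^esub> x = a \<odot>\<^bsub>M\<^esub> x \<oplus>\<^bsub>M\<^esub> b \<odot>\<^bsub>M\<^esub> x"
    and smult_r_distr:
      "\<lbrakk>a \<in> carrier R; x \<in> carrier M; y \<in> carrier M\<rbrakk>
        \<Longrightarrow> a \<odot>\<^bsub>M\<^esub> (x \<oplus>\<^bsub>M\<^esub> y) = a \<odot>\<^bsub>M\<^esub> x \<oplus>\<^bsub>M\<^esub> a \<odot>\<^bsub>M\<^esub> y"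
    and smult_assoc:
      "\<lbrakk>a \<in> carrier R; b \<in> carrier R; x \<in> carrier M\<rbrakk>
        \<Longrightarrow> (a \<otimes> b) \<odot>\<^bsub>M\<^esub> x = a \<odot>\<^bsub>M\<^esub> (b \<odot>\<^bsub>M\<^esub> x)"
    and smult_one [simp]: "x \<in> carrier M \<Longrightarrow> \<one> \<odot>\<^bsub>M\<^esub> x = x"

definition lin_maps ::
    "('r, 'q) ring_scheme \<Rightarrow> ('r, 'm, 'u) module_scheme \<Rightarrow> ('r, 'n, 'v) module_scheme \<Rightarrow> ('m \<Rightarrow> 'n) set"
  where "lin_maps R M N =
    {f \<in> carrier M \<rightarrow> carrier N.
       (\<forall>x\<in>carrier M. \<forall>y\<in>carrier M. f (x \<oplus>\<^bsub>M\<^esub> y) = f x \<oplus>\<^bsub>N\<^esub> f y) \<and>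
       (\<forall>r\<in>carrier R. \<forall>x\<in>carrier M. f (r \<odot>\<^bsub>M\<^esub> x) = r \<odot>\<^bsub>N\<^esub> f x)}"

definition lin_iso ::
    "('r, 'q) ring_scheme \<Rightarrow> ('r, 'm, 'u) module_scheme \<Rightarrow> ('r, 'n, 'v) module_scheme \<Rightarrow> bool"
  where "lin_iso R M N \<longleftrightarrow> (\<exists>f\<in>lin_maps R M N. bij_betw f (carrier M) (carrier N))"

definition lin_span ::
    "('r, 'q) ring_scheme \<Rightarrow> ('r, 'm, 'u) module_scheme \<Rightarrow> 'm set \<Rightarrow> 'm set"
  where "lin_span R M S = \<Inter>{H. submodule H R M \<and> S \<subseteq> H}"

text \<open>
  The quotient by a submodule, or of an algebra by a two-sided ideal: this is the library's
  \<open>M Quot I\<close> together with the induced scalar multiplication. For a module that is not an algebra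
  the fields \<open>mult\<close> and \<open>one\<close> of the result are meaningless.
\<close>

definition quot_module :: "('r, 'm, 'u) module_scheme \<Rightarrow> 'm set \<Rightarrow> ('r, 'm set) module"
  where "quot_module M I =
    \<lparr>carrier = a_rcosets\<^bsub>M\<^esub> I, mult = rcoset_mult M I, one = I +>\<^bsub>M\<^esub> \<one>\<^bsub>M\<^esub>,
     zero = I, add = set_add M,
     smult = (\<lambda>r X. \<Union>x\<in>X. I +>\<^bsub>M\<^esub> (r \<odot>\<^bsub>M\<^esub> x))\<rparr>"

definition regular :: "('r, 'q) ring_scheme \<Rightarrow> ('r, 'r) module"
  where "regular R =
    \<lparr>carrier = carrier R, mult = mult R, one = \<one>\<^bsub>R\<^esub>, zero = \<zero>\<^bsub>R\<^esub>, add = add R, smult = mult R\<rparr>"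

text \<open>
  The direct sum of copies of \<open>M\<close> indexed by \<open>X\<close>: functions with finite support in \<open>X\<close>, which are
  \<open>\<zero>\<close> outside \<open>X\<close>.
\<close>

definition copower :: "('r, 'm, 'u) module_scheme \<Rightarrow> 'x set \<Rightarrow> ('r, 'x \<Rightarrow> 'm) module"
  where "copower M X =
    \<lparr>carrier = {f. (\<forall>x. f x \<in> carrier M) \<and> finite {x. f x \<noteq> \<zero>\<^bsub>M\<^esub>} \<and> {x. f x \<noteq> \<zero>\<^bsub>M\<^esub>} \<subseteq> X},
     mult = undefined, one = undefined,
     zero = (\<lambda>x. \<zero>\<^bsub>M\<^esub>), add = (\<lambda>f g x. f x \<oplus>\<^bsub>M\<^esub> g x),
     smult = (\<lambda>r f x. r \<odot>\<^bsub>M\<^esub> f x)\<rparr>"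

abbreviation free_module :: "('r, 'q) ring_scheme \<Rightarrow> 'x set \<Rightarrow> ('r, 'x \<Rightarrow> 'r) module"
  where "free_module R X \<equiv> copower (regular R) X"

definition basis_elt :: "('r, 'q) ring_scheme \<Rightarrow> 'x \<Rightarrow> 'x \<Rightarrow> 'r"
  where "basis_elt R x = (\<lambda>y. if y = x then \<one>\<^bsub>R\<^esub> else \<zero>\<^bsub>R\<^esub>)"

text \<open>
  Projective means direct summand of a free module. It is no restriction that the basis is taken
  in the type \<open>'p\<close>: a direct summand of any free module is one of the free module on its own carrier.
\<close>

definition projective :: "('r, 'q) ring_scheme \<Rightarrow> ('r, 'p, 'u) module_scheme \<Rightarrow> bool"
  where "projective R P \<longleftrightarrow> left_module R P \<and>
    (\<exists>X :: 'p set. \<exists>i\<in>lin_maps R P (free_module R X). \<exists>p\<in>lin_maps R (free_module R X) P.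
       \<forall>x\<in>carrier P. p (i x) = x)"

text \<open>
  \<open>\<cdots> \<longrightarrow> P 2 \<longrightarrow> P 1 \<longrightarrow> P 0 \<longrightarrow> N \<longrightarrow> 0\<close>
  with \<open>d n : P (n + 1) \<longrightarrow> P n\<close> and augmentation \<open>e\<close>.
\<close>

definition projective_resolution ::
    "('r, 'q) ring_scheme \<Rightarrow> ('r, 'n, 'u) module_scheme
      \<Rightarrow> (nat \<Rightarrow> ('r, 'p) module) \<Rightarrow> (nat \<Rightarrow> 'p \<Rightarrow> 'p) \<Rightarrow> ('p \<Rightarrow> 'n) \<Rightarrow> bool"
  where "projective_resolution R N P d e \<longleftrightarrow>
    (\<forall>n. projective R (P n)) \<and>
    (\<forall>n. d n \<in> lin_maps R (P (Suc n)) (P n)) \<and>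
    e \<in> lin_maps R (P 0) N \<and>
    e ` carrier (P 0) = carrier N \<and>
    d 0 ` carrier (P 1) = {x \<in> carrier (P 0). e x = \<zero>\<^bsub>N\<^esub>} \<and>
    (\<forall>n. d (Suc n) ` carrier (P (Suc (Suc n)))
         = {x \<in> carrier (P (Suc n)). d n x = \<zero>\<^bsub>P n\<^esub>})"

section \<open>Tensor products and Tor\<close>

text \<open>
  \<open>R\<close> is an algebra over \<open>K\<close>, \<open>M\<close> a right and \<open>N\<close> a left module over \<open>R\<close>. Their tensor product
  over \<open>R\<close>, as a module over \<open>K\<close>, is the free module over \<open>K\<close> on the pairs, modulo the span of
  the following relations; the action of \<open>k\<close> on \<open>M\<close> is that of \<open>k \<odot> \<one>\<close> in \<open>R\<close>.
\<close>

definition tensor_rels ::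
    "('k, 'q) ring_scheme \<Rightarrow> ('k, 'r, 's) module_scheme \<Rightarrow> ('r, 'm, 'u) module_scheme
      \<Rightarrow> ('r, 'n, 'v) module_scheme \<Rightarrow> ('m \<times> 'n \<Rightarrow> 'k) set"
  where "tensor_rels K R M N =
    (let F = free_module K (carrier M \<times> carrier N); t = (\<lambda>x y. basis_elt K (x, y)) in
     lin_span K F
      ({t (x \<oplus>\<^bsub>M\<^esub> x') y \<ominus>\<^bsub>F\<^esub> (t x y \<oplus>\<^bsub>F\<^esub> t x' y) | x x' y.
          x \<in> carrier M \<and> x' \<in> carrier M \<and> y \<in> carrier N} \<union>
       {t x (y \<oplus>\<^bsub>N\<^esub> y') \<ominus>\<^bsub>F\<^esub> (t x y \<oplus>\<^bsub>F\<^esub> t x y') | x y y'.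
          x \<in> carrier M \<and> y \<in> carrier N \<and> y' \<in> carrier N} \<union>
       {t (r \<odot>\<^bsub>M\<^esub> x) y \<ominus>\<^bsub>F\<^esub> t x (r \<odot>\<^bsub>N\<^esub> y) | r x y.
          r \<in> carrier R \<and> x \<in> carrier M \<and> y \<in> carrier N} \<union>
       {t ((k \<odot>\<^bsub>R\<^esub> \<one>\<^bsub>R\<^esub>) \<odot>\<^bsub>M\<^esub> x) y \<ominus>\<^bsub>F\<^esub> (k \<odot>\<^bsub>F\<^esub> t x y) | k x y.
          k \<in> carrier K \<and> x \<in> carrier M \<and> y \<in> carrier N}))"

definition tensor ::
    "('k, 'q) ring_scheme \<Rightarrow> ('k, 'r, 's) module_scheme \<Rightarrow> ('r, 'm, 'u) module_scheme
      \<Rightarrow> ('r, 'n, 'v) module_scheme \<Rightarrow> ('k, ('m \<times> 'n \<Rightarrow> 'k) set) module"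
  where "tensor K R M N =
    quot_module (free_module K (carrier M \<times> carrier N)) (tensor_rels K R M N)"

text \<open>
  The map induced on formal linear combinations by a map of the bases, and
  \<open>id \<otimes> f\<close> from \<open>M \<otimes> N\<close> to \<open>M \<otimes> N'\<close>.
\<close>

definition push_forward :: "('k, 'q) ring_scheme \<Rightarrow> ('x \<Rightarrow> 'y) \<Rightarrow> ('x \<Rightarrow> 'k) \<Rightarrow> 'y \<Rightarrow> 'k"
  where "push_forward K h s = (\<lambda>y. finsum K s {x. s x \<noteq> \<zero>\<^bsub>K\<^esub> \<and> h x = y})"

definition tensor_map ::
    "('k, 'q) ring_scheme \<Rightarrow> ('k, 'r, 's) module_scheme \<Rightarrow> ('r, 'm, 'u) module_scheme
      \<Rightarrow> ('r, 'n2, 'v) module_scheme \<Rightarrow> ('n1 \<Rightarrow> 'n2)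
      \<Rightarrow> ('m \<times> 'n1 \<Rightarrow> 'k) set \<Rightarrow> ('m \<times> 'n2 \<Rightarrow> 'k) set"
  where "tensor_map K R M N' f X =
    (\<Union>s\<in>X. tensor_rels K R M N' +>\<^bsub>free_module K (carrier M \<times> carrier N')\<^esub>
               push_forward K (map_prod id f) s)"

text \<open>Homology of \<open>\<cdots> \<longrightarrow> C 2 \<longrightarrow> C 1 \<longrightarrow> C 0 \<longrightarrow> 0\<close> with \<open>d n : C (n + 1) \<longrightarrow> C n\<close>.\<close>

definition cycles :: "(nat \<Rightarrow> ('k, 'c) module) \<Rightarrow> (nat \<Rightarrow> 'c \<Rightarrow> 'c) \<Rightarrow> nat \<Rightarrow> 'c set"
  where "cycles C d q =
    (case q of 0 \<Rightarrow> carrier (C 0) | Suc n \<Rightarrow> {x \<in> carrier (C (Suc n)). d n x = \<zero>\<^bsub>C n\<^esub>})"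

definition homology ::
    "(nat \<Rightarrow> ('k, 'c) module) \<Rightarrow> (nat \<Rightarrow> 'c \<Rightarrow> 'c) \<Rightarrow> nat \<Rightarrow> ('k, 'c set) module"
  where "homology C d q = quot_module ((C q)\<lparr>carrier := cycles C d q\<rparr>) (d q ` carrier (C (Suc q)))"

text \<open>
  Tor over \<open>R\<close> of the right module \<open>M\<close> and the left module resolved by the complex \<open>(P, d)\<close>.
\<close>

definition Tor ::
    "('k, 'q) ring_scheme \<Rightarrow> ('k, 'r, 's) module_scheme \<Rightarrow> ('r, 'm, 'u) module_scheme
      \<Rightarrow> (nat \<Rightarrow> ('r, 'p) module) \<Rightarrow> (nat \<Rightarrow> 'p \<Rightarrow> 'p) \<Rightarrow> nat \<Rightarrow> ('k, ('m \<times> 'p \<Rightarrow> 'k) set set) module"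
  where "Tor K R M P d =
    homology (\<lambda>n. tensor K R M (P n)) (\<lambda>n. tensor_map K R M (P n) (d n))"

section \<open>Algebras\<close>

definition monoid_algebra :: "('k, 'q) ring_scheme \<Rightarrow> ('g, 'h) monoid_scheme \<Rightarrow> ('k, 'g \<Rightarrow> 'k) module"
  where "monoid_algebra K G = (free_module K (carrier G))
    \<lparr>mult := (\<lambda>f g x. \<Oplus>\<^bsub>K\<^esub>p\<in>{(u, v). f u \<noteq> \<zero>\<^bsub>K\<^esub> \<and> g v \<noteq> \<zero>\<^bsub>K\<^esub> \<and> u \<otimes>\<^bsub>G\<^esub> v = x}.
                 f (fst p) \<otimes>\<^bsub>K\<^esub> g (snd p)),
     one := basis_elt K \<one>\<^bsub>G\<^esub>\<rparr>"

definition free_monoid :: "'x set \<Rightarrow> 'x list monoid"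
  where "free_monoid X = \<lparr>carrier = lists X, mult = append, one = []\<rparr>"

definition free_algebra :: "('k, 'q) ring_scheme \<Rightarrow> 'x set \<Rightarrow> ('k, 'x list \<Rightarrow> 'k) module"
  where "free_algebra K X = monoid_algebra K (free_monoid X)"

definition opposite :: "('r, 'q) ring_scheme \<Rightarrow> ('r, 'q) ring_scheme"
  where "opposite A = A\<lparr>mult := (\<lambda>x y. y \<otimes>\<^bsub>A\<^esub> x)\<rparr>"

text \<open>
  \<open>A \<otimes> B\<close> over \<open>K\<close> with \<open>(a \<otimes> b) (a' \<otimes> b') = a a' \<otimes> b b'\<close>. The underlying module is
  \<open>tensor K (regular K) A B\<close>; the span of the tensor relations is a two-sided ideal of the algebra
  of the multiplicative monoid of \<open>A \<times> B\<close>, and the product is induced from there.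
\<close>

definition tensor_algebra ::
    "('k, 'q) ring_scheme \<Rightarrow> ('k, 'a) module \<Rightarrow> ('k, 'b) module \<Rightarrow> ('k, ('a \<times> 'b \<Rightarrow> 'k) set) module"
  where "tensor_algebra K A B =
    quot_module (monoid_algebra K (A \<times>\<times> B)) (tensor_rels K (regular K) A B)"

section \<open>Hochschild homology\<close>

definition enveloping :: "('k, 'q) ring_scheme \<Rightarrow> ('k, 'a) module \<Rightarrow> ('k, ('a \<times> 'a \<Rightarrow> 'k) set) module"
  where "enveloping K A = tensor_algebra K A (opposite A)"

text \<open>
  \<open>A\<close> as a module over its enveloping algebra, on the left by \<open>(x \<otimes> y) a = x a y\<close> and on the right
  by \<open>a (x \<otimes> y) = y a x\<close>. An element of the enveloping algebra is a coset \<open>X\<close> of formal linear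
  combinations \<open>s\<close> of pairs; the value does not depend on the choice of \<open>s\<close> in \<open>X\<close>.
\<close>

definition env_left :: "('k, 'q) ring_scheme \<Rightarrow> ('k, 'a) module \<Rightarrow> (('a \<times> 'a \<Rightarrow> 'k) set, 'a) module"
  where "env_left K A =
    \<lparr>carrier = carrier A, mult = mult A, one = \<one>\<^bsub>A\<^esub>, zero = \<zero>\<^bsub>A\<^esub>, add = add A,
     smult = (\<lambda>X a. the_elem ((\<lambda>s. \<Oplus>\<^bsub>A\<^esub>p\<in>{p. s p \<noteq> \<zero>\<^bsub>K\<^esub>}.
                s p \<odot>\<^bsub>A\<^esub> (fst p \<otimes>\<^bsub>A\<^esub> a \<otimes>\<^bsub>A\<^esub> snd p)) ` X))\<rparr>"

definition env_right :: "('k, 'q) ring_scheme \<Rightarrow> ('k, 'a) module \<Rightarrow> (('a \<times> 'a \<Rightarrow> 'k) set, 'a) module"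
  where "env_right K A =
    \<lparr>carrier = carrier A, mult = mult A, one = \<one>\<^bsub>A\<^esub>, zero = \<zero>\<^bsub>A\<^esub>, add = add A,
     smult = (\<lambda>X a. the_elem ((\<lambda>s. \<Oplus>\<^bsub>A\<^esub>p\<in>{p. s p \<noteq> \<zero>\<^bsub>K\<^esub>}.
                s p \<odot>\<^bsub>A\<^esub> (snd p \<otimes>\<^bsub>A\<^esub> a \<otimes>\<^bsub>A\<^esub> fst p)) ` X))\<rparr>"

text \<open>
  Hochschild homology, computed from a projective resolution \<open>(P, d)\<close> of \<open>env_left K A\<close> over
  \<open>enveloping K A\<close>.
\<close>

definition HH ::
    "('k, 'q) ring_scheme \<Rightarrow> ('k, 'a) module \<Rightarrow> (nat \<Rightarrow> (('a \<times> 'a \<Rightarrow> 'k) set, 'p) module)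
      \<Rightarrow> (nat \<Rightarrow> 'p \<Rightarrow> 'p) \<Rightarrow> nat \<Rightarrow> ('k, ('a \<times> 'p \<Rightarrow> 'k) set set) module"
  where "HH K A P d = Tor K (enveloping K A) (env_right K A) P d"

definition commutator :: "('a, 'q) ring_scheme \<Rightarrow> 'a \<Rightarrow> 'a \<Rightarrow> 'a"
  where "commutator A a b = a \<otimes>\<^bsub>A\<^esub> b \<ominus>\<^bsub>A\<^esub> b \<otimes>\<^bsub>A\<^esub> a"

definition commutator_space :: "('k, 'q) ring_scheme \<Rightarrow> ('k, 'a) module \<Rightarrow> 'a set"
  where "commutator_space K A =
    lin_span K A {commutator A a b | a b. a \<in> carrier A \<and> b \<in> carrier A}"

section \<open>The localized free algebra\<close>

text \<open>The index is shifted by one: \<open>continuant R z (j + 1)\<close> is $K_j$, starting from $K_{-1} = 0$.\<close>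

fun continuant :: "('a, 'q) ring_scheme \<Rightarrow> (nat \<Rightarrow> 'a) \<Rightarrow> nat \<Rightarrow> 'a"
  where
    "continuant R z 0 = \<zero>\<^bsub>R\<^esub>"
  | "continuant R z (Suc 0) = \<one>\<^bsub>R\<^esub>"
  | "continuant R z (Suc (Suc j)) = z (Suc j) \<otimes>\<^bsub>R\<^esub> continuant R z (Suc j) \<oplus>\<^bsub>R\<^esub> continuant R z j"

text \<open>
  In the free algebra on the letters \<open>0, \<dots>, m\<close> the letters \<open>1, \<dots>, m\<close> are the $z_i$ and the
  letter \<open>0\<close> is the inverse to be adjoined.
\<close>

definition letter :: "('k, 'q) ring_scheme \<Rightarrow> nat \<Rightarrow> nat list \<Rightarrow> 'k"
  where "letter K i = basis_elt K [i]"

definition loc_ideal :: "('k, 'q) ring_scheme \<Rightarrow> nat \<Rightarrow> (nat list \<Rightarrow> 'k) set"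
  where "loc_ideal K m =
    (let F = free_algebra K {0..m}; y = letter K 0; c = continuant F (letter K) (Suc m) in
     Idl\<^bsub>F\<^esub> {c \<otimes>\<^bsub>F\<^esub> y \<ominus>\<^bsub>F\<^esub> \<one>\<^bsub>F\<^esub>, y \<otimes>\<^bsub>F\<^esub> c \<ominus>\<^bsub>F\<^esub> \<one>\<^bsub>F\<^esub>})"

definition loc_algebra :: "('k, 'q) ring_scheme \<Rightarrow> nat \<Rightarrow> ('k, (nat list \<Rightarrow> 'k) set) module"
  where "loc_algebra K m = quot_module (free_algebra K {0..m}) (loc_ideal K m)"

definition loc_gen :: "('k, 'q) ring_scheme \<Rightarrow> nat \<Rightarrow> nat \<Rightarrow> (nat list \<Rightarrow> 'k) set"
  where "loc_gen K m i = loc_ideal K m +>\<^bsub>free_algebra K {0..m}\<^esub> letter K i"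

definition b_map :: "('a, 'q) ring_scheme \<Rightarrow> (nat \<Rightarrow> 'a) \<Rightarrow> nat \<Rightarrow> (nat \<Rightarrow> 'a) \<Rightarrow> 'a"
  where "b_map A z m a = (\<Oplus>\<^bsub>A\<^esub>i\<in>{1..m}. commutator A (a i) (z i))"

definition b_kernel :: "('k, 'a) module \<Rightarrow> (nat \<Rightarrow> 'a) \<Rightarrow> nat \<Rightarrow> ('k, nat \<Rightarrow> 'a) module"
  where "b_kernel A z m = (copower A {1..m})
    \<lparr>carrier := {a \<in> carrier (copower A {1..m}). b_map A z m a = \<zero>\<^bsub>A\<^esub>}\<rparr>"

end

theory Submission
  imports Defs
begin

text \<open>
  Let \<open>E = A \<otimes> A\<^sup>o\<^sup>p\<close>. A derivation of \<open>A\<close> into a bimodule can be prescribed arbitrarily on the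
  \<open>z\<^sub>i\<close>: this is so for the free algebra, and passing to the localization only adds the forced value
  \<open>D (c\<^sup>-\<^sup>1) = - c\<^sup>-\<^sup>1 (D c) c\<^sup>-\<^sup>1\<close> at the inverse of the continuant \<open>c\<close>. Equivalently, the kernel
  of the multiplication \<open>A \<otimes> A \<longrightarrow> A\<close>, which represents derivations, is a free bimodule on the elements
  \<open>w\<^sub>i = z\<^sub>i \<otimes> 1 - 1 \<otimes> z\<^sub>i\<close>. So \<open>A\<close> has the free resolution \<open>0 \<longrightarrow> E\<^sup>m \<longrightarrow> E \<longrightarrow> A \<longrightarrow> 0\<close>, and tensoring
  it with \<open>A\<close> over \<open>E\<close> gives the complex \<open>A\<^sup>m \<longrightarrow> A\<close> with differential
  \<open>b a = \<Sum>\<^sub>i [a\<^sub>i, z\<^sub>i]\<close>. Its homology is \<open>A / b(A\<^sup>m)\<close> in degree 0, \<open>ker b\<close> in degree 1 and 0 in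
  higher degrees.

  That the \<open>w\<^sub>i\<close> generate the kernel is \<open>universal_derivation_in_J\<close> and \<open>kernel_\<epsilon>\<close>: the \<open>a\<close> for which
  \<open>a \<otimes> 1 - 1 \<otimes> a\<close> is a combination of the \<open>w\<^sub>i\<close> form a subalgebra closed under inverses. The same
  fact yields \<open>b(A\<^sup>m) = [A, A]\<close> (\<open>commutator_space_eq\<close>), because acting with \<open>x \<otimes> 1 - 1 \<otimes> x\<close> on \<open>a\<close>
  gives \<open>[a, x]\<close>. That the \<open>w\<^sub>i\<close> are independent is \<open>coefficient_exists\<close>: the derivation with
  \<open>D z\<^sub>j = \<delta>\<^sub>i\<^sub>j\<close> reads off the coefficient of \<open>w\<^sub>i\<close>. It exists by \<open>derivation_exists\<close>, an application of
  the universal property \<open>localization_hom\<close> to the square-zero extension of \<open>A\<close> by \<open>E\<close>.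

  Hochschild homology is computed here from an arbitrary projective resolution \<open>P\<close>. It is compared with the
  resolution of length one by chain maps in both directions. The composite on \<open>P\<close> is homotopic to the
  identity by \<open>null_homotopy\<close>; on the short complex, the composite differs from the identity by terms that
  factor through \<open>b\<close> (\<open>G0_F0\<close> and \<open>G1_F1\<close>). After tensoring, the homology groups are read off with the first
  isomorphism theorem (\<open>HH_0\<close>, \<open>HH_1\<close>, \<open>HH_ge_2\<close>).
\<close>

section \<open>Linear maps and submodules\<close>

lemma (in abelian_group) a_inv_zero: "\<ominus> \<zero> = \<zero>"
  by (rule minus_equality) simp_all

lemma (in abelian_group) a_minus_eq_zero_iff:
  assumes "x \<in> carrier G" "y \<in> carrier G"
  shows "x \<ominus> y = \<zero> \<longleftrightarrow> x = y"
  using assms r_neg[of y] minus_equality[of x "\<ominus> y"] by (auto simp: a_minus_def)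

lemma left_moduleI:
  fixes R (structure) and M (structure)
  assumes "ring R" "abelian_group M"
    and "\<And>a x. \<lbrakk>a \<in> carrier R; x \<in> carrier M\<rbrakk> \<Longrightarrow> a \<odot>\<^bsub>M\<^esub> x \<in> carrier M"
    and "\<And>a b x. \<lbrakk>a \<in> carrier R; b \<in> carrier R; x \<in> carrier M\<rbrakk>
          \<Longrightarrow> (a \<oplus> b) \<odot>\<^bsub>M\<^esub> x = a \<odot>\<^bsub>M\<^esub> x \<oplus>\<^bsub>M\<^esub> b \<odot>\<^bsub>M\<^esub> x"
    and "\<And>a x y. \<lbrakk>a \<in> carrier R; x \<in> carrier M; y \<in> carrier M\<rbrakk>
          \<Longrightarrow> a \<odot>\<^bsub>M\<^esub> (x \<oplus>\<^bsub>M\<^esub> y) = a \<odot>\<^bsub>M\<^esub> x \<oplus>\<^bsub>M\<^esub> a \<odot>\<^bsub>M\<^esub> y"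
    and "\<And>a b x. \<lbrakk>a \<in> carrier R; b \<in> carrier R; x \<in> carrier M\<rbrakk>
          \<Longrightarrow> (a \<otimes> b) \<odot>\<^bsub>M\<^esub> x = a \<odot>\<^bsub>M\<^esub> (b \<odot>\<^bsub>M\<^esub> x)"
    and "\<And>x. x \<in> carrier M \<Longrightarrow> \<one> \<odot>\<^bsub>M\<^esub> x = x"
  shows "left_module R M"
  using assms by (auto intro!: left_module.intro left_module_axioms.intro)

context left_module
begin

lemma smult_l_null [simp]: "x \<in> carrier M \<Longrightarrow> \<zero> \<odot>\<^bsub>M\<^esub> x = \<zero>\<^bsub>M\<^esub>"
  by (metis M.add.r_cancel_one' R.l_zero R.zero_closed smult_closed smult_l_distr)

lemma smult_r_null [simp]: "a \<in> carrier R \<Longrightarrow> a \<odot>\<^bsub>M\<^esub> \<zero>\<^bsub>M\<^esub> = \<zero>\<^bsub>M\<^esub>"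
  by (metis M.add.r_cancel_one' M.l_zero M.zero_closed smult_closed smult_r_distr)

lemma smult_l_minus:
  "\<lbrakk>a \<in> carrier R; x \<in> carrier M\<rbrakk> \<Longrightarrow> (\<ominus> a) \<odot>\<^bsub>M\<^esub> x = \<ominus>\<^bsub>M\<^esub> (a \<odot>\<^bsub>M\<^esub> x)"
  by (metis M.minus_equality R.add.inv_closed R.l_neg smult_closed smult_l_distr smult_l_null)

lemma smult_r_minus:
  "\<lbrakk>a \<in> carrier R; x \<in> carrier M\<rbrakk> \<Longrightarrow> a \<odot>\<^bsub>M\<^esub> (\<ominus>\<^bsub>M\<^esub> x) = \<ominus>\<^bsub>M\<^esub> (a \<odot>\<^bsub>M\<^esub> x)"
  by (metis M.add.inv_closed M.l_neg M.minus_equality smult_closed smult_r_distr smult_r_null)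

lemma smult_r_diff:
  "\<lbrakk>a \<in> carrier R; x \<in> carrier M; y \<in> carrier M\<rbrakk>
    \<Longrightarrow> a \<odot>\<^bsub>M\<^esub> (x \<ominus>\<^bsub>M\<^esub> y) = a \<odot>\<^bsub>M\<^esub> x \<ominus>\<^bsub>M\<^esub> a \<odot>\<^bsub>M\<^esub> y"
  by (simp add: a_minus_def smult_r_distr smult_r_minus)

lemma smult_finsum:
  "\<lbrakk>a \<in> carrier R; f \<in> S \<rightarrow> carrier M\<rbrakk>
    \<Longrightarrow> a \<odot>\<^bsub>M\<^esub> (\<Oplus>\<^bsub>M\<^esub>i\<in>S. f i) = (\<Oplus>\<^bsub>M\<^esub>i\<in>S. a \<odot>\<^bsub>M\<^esub> f i)"
proof (induction S rule: infinite_finite_induct)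
  case (insert x F) then show ?case
    by (simp add: Pi_def smult_r_distr)
qed simp_all

lemma finsum_smult:
  "\<lbrakk>x \<in> carrier M; f \<in> S \<rightarrow> carrier R\<rbrakk>
    \<Longrightarrow> (\<Oplus>i\<in>S. f i) \<odot>\<^bsub>M\<^esub> x = (\<Oplus>\<^bsub>M\<^esub>i\<in>S. f i \<odot>\<^bsub>M\<^esub> x)"
proof (induction S rule: infinite_finite_induct)
  case (insert x F) then show ?case
    by (simp add: Pi_def smult_l_distr)
qed simp_all

lemma submoduleI:
  assumes "H \<subseteq> carrier M" "\<zero>\<^bsub>M\<^esub> \<in> H"
    and add: "\<And>x y. \<lbrakk>x \<in> H; y \<in> H\<rbrakk> \<Longrightarrow> x \<oplus>\<^bsub>M\<^esub> y \<in> H"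
    and smult: "\<And>a x. \<lbrakk>a \<in> carrier R; x \<in> H\<rbrakk> \<Longrightarrow> a \<odot>\<^bsub>M\<^esub> x \<in> H"
  shows "submodule H R M"
proof -
  have "\<ominus>\<^bsub>M\<^esub> x \<in> H" if "x \<in> H" for x
    using smult[of "\<ominus> \<one>" x] that assms(1) by (auto simp: smult_l_minus subset_iff)
  then show ?thesis
    by (intro submodule.intro M.add.subgroupI)
      (use assms in \<open>auto simp: submodule_axioms_def a_inv_def\<close>)
qed

lemma submoduleD:
  assumes "submodule H R M"
  shows submodule_subset: "H \<subseteq> carrier M"
    and submodule_zero: "\<zero>\<^bsub>M\<^esub> \<in> H"
    and submodule_add: "\<And>x y. \<lbrakk>x \<in> H; y \<in> H\<rbrakk> \<Longrightarrow> x \<oplus>\<^bsub>M\<^esub> y \<in> H"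
    and submodule_neg: "\<And>x. x \<in> H \<Longrightarrow> \<ominus>\<^bsub>M\<^esub> x \<in> H"
    and submodule_smult: "\<And>a x. \<lbrakk>a \<in> carrier R; x \<in> H\<rbrakk> \<Longrightarrow> a \<odot>\<^bsub>M\<^esub> x \<in> H"
proof -
  interpret H: submodule H R M by fact
  show "H \<subseteq> carrier M" using H.subset by simp
  show "\<zero>\<^bsub>M\<^esub> \<in> H" using H.one_closed by simp
  show add: "\<And>x y. \<lbrakk>x \<in> H; y \<in> H\<rbrakk> \<Longrightarrow> x \<oplus>\<^bsub>M\<^esub> y \<in> H" using H.m_closed by simp
  show neg: "\<And>x. x \<in> H \<Longrightarrow> \<ominus>\<^bsub>M\<^esub> x \<in> H" using H.m_inv_closed by (simp add: a_inv_def)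
  show "\<And>a x. \<lbrakk>a \<in> carrier R; x \<in> H\<rbrakk> \<Longrightarrow> a \<odot>\<^bsub>M\<^esub> x \<in> H" by simp
qed

lemma submodule_finsum:
  assumes "submodule H R M" "f \<in> S \<rightarrow> H"
  shows "(\<Oplus>\<^bsub>M\<^esub>i\<in>S. f i) \<in> H"
  using assms(2)
proof (induction S rule: infinite_finite_induct)
  case (insert x F)
  then have "f \<in> F \<rightarrow> carrier M" "f x \<in> carrier M"
    using submodule_subset[OF assms(1)] by auto
  with insert show ?case
    by (simp add: submodule_add[OF assms(1)])
qed (use submodule_zero[OF assms(1)] in simp_all)

lemma zero_submodule: "submodule {\<zero>\<^bsub>M\<^esub>} R M"
  by (rule submoduleI) auto

lemma restrict_left_module:
  assumes "submodule H R M"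
  shows "left_module R (M\<lparr>carrier := H\<rparr>)"
proof -
  note [simp] = submodule_add[OF assms] submodule_zero[OF assms]
  have in_M: "x \<in> carrier M" if "x \<in> H" for x
    using that submodule_subset[OF assms] by blast
  have "abelian_group (M\<lparr>carrier := H\<rparr>)"
  proof (rule abelian_groupI)
    fix x assume "x \<in> carrier (M\<lparr>carrier := H\<rparr>)"
    then show "\<exists>y\<in>carrier (M\<lparr>carrier := H\<rparr>). y \<oplus>\<^bsub>M\<lparr>carrier := H\<rparr>\<^esub> x = \<zero>\<^bsub>M\<lparr>carrier := H\<rparr>\<^esub>"
      using submodule_neg[OF assms, of x] M.l_neg in_M by auto
  qed (auto simp: in_M M.a_ac)
  then show ?thesis
    by (intro left_moduleI)
      (simp_all add: R.ring_axioms submodule_smult[OF assms] smult_l_distr smult_r_distr smult_assoc in_M)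
qed

lemma carrier_submodule: "submodule (carrier M) R M"
  by (rule submoduleI) auto

lemma lin_span_submodule:
  assumes "S \<subseteq> carrier M"
  shows "submodule (lin_span R M S) R M"
proof (rule submoduleI)
  show "lin_span R M S \<subseteq> carrier M"
    unfolding lin_span_def using assms carrier_submodule by blast
qed (auto simp: lin_span_def intro: submodule_zero submodule_add submodule_smult)

lemma lin_span_superset: "S \<subseteq> lin_span R M S"
  unfolding lin_span_def by blast

lemma lin_span_least: "\<lbrakk>submodule H R M; S \<subseteq> H\<rbrakk> \<Longrightarrow> lin_span R M S \<subseteq> H"
  unfolding lin_span_def by blast

end

lemma lin_mapsI:
  assumes "\<And>x. x \<in> carrier M \<Longrightarrow> f x \<in> carrier N"
    and "\<And>x y. \<lbrakk>x \<in> carrier M; y \<in> carrier M\<rbrakk> \<Longrightarrow> f (x \<oplus>\<^bsub>M\<^esub> y) = f x \<oplus>\<^bsub>N\<^esub> f y"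
    and "\<And>r x. \<lbrakk>r \<in> carrier R; x \<in> carrier M\<rbrakk> \<Longrightarrow> f (r \<odot>\<^bsub>M\<^esub> x) = r \<odot>\<^bsub>N\<^esub> f x"
  shows "f \<in> lin_maps R M N"
  using assms unfolding lin_maps_def by auto

lemma lin_mapsD:
  assumes "f \<in> lin_maps R M N"
  shows lin_maps_closed: "x \<in> carrier M \<Longrightarrow> f x \<in> carrier N"
    and lin_maps_add:
      "\<lbrakk>x \<in> carrier M; y \<in> carrier M\<rbrakk> \<Longrightarrow> f (x \<oplus>\<^bsub>M\<^esub> y) = f x \<oplus>\<^bsub>N\<^esub> f y"
    and lin_maps_smult:
      "\<lbrakk>r \<in> carrier R; x \<in> carrier M\<rbrakk> \<Longrightarrow> f (r \<odot>\<^bsub>M\<^esub> x) = r \<odot>\<^bsub>N\<^esub> f x"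
  using assms unfolding lin_maps_def by auto

lemma lin_maps_compose:
  "\<lbrakk>f \<in> lin_maps R L M; g \<in> lin_maps R M N\<rbrakk> \<Longrightarrow> (\<lambda>x. g (f x)) \<in> lin_maps R L N"
  by (rule lin_mapsI) (simp_all add: lin_maps_def Pi_iff)

locale linear_map = M: left_module R M + N: left_module R N
  for R (structure) and M (structure) and N (structure) and f +
  assumes lin: "f \<in> lin_maps R M N"
begin

lemmas closed [simp] = lin_maps_closed[OF lin]
lemmas add = lin_maps_add[OF lin]
lemmas smult = lin_maps_smult[OF lin]

lemma zero [simp]: "f \<zero>\<^bsub>M\<^esub> = \<zero>\<^bsub>N\<^esub>"
  using smult[of \<zero> "\<zero>\<^bsub>M\<^esub>"] by simp

lemma neg: "x \<in> carrier M \<Longrightarrow> f (\<ominus>\<^bsub>M\<^esub> x) = \<ominus>\<^bsub>N\<^esub> f x"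
  by (metis M.M.add.inv_closed M.M.l_neg N.M.minus_equality add closed zero)

lemma diff: "\<lbrakk>x \<in> carrier M; y \<in> carrier M\<rbrakk> \<Longrightarrow> f (x \<ominus>\<^bsub>M\<^esub> y) = f x \<ominus>\<^bsub>N\<^esub> f y"
  by (simp add: a_minus_def add neg)

lemma finsum: "g \<in> S \<rightarrow> carrier M \<Longrightarrow> f (\<Oplus>\<^bsub>M\<^esub>i\<in>S. g i) = (\<Oplus>\<^bsub>N\<^esub>i\<in>S. f (g i))"
proof (induction S rule: infinite_finite_induct)
  case (insert x F) then show ?case
    by (simp add: Pi_def add)
qed simp_all

lemma preimage_submodule:
  assumes "submodule H R N"
  shows "submodule {x \<in> carrier M. f x \<in> H} R M"
  by (rule M.submoduleI) (auto simp: add smult assms N.submodule_zero N.submodule_add N.submodule_smult)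

lemma kernel_submodule: "submodule {x \<in> carrier M. f x = \<zero>\<^bsub>N\<^esub>} R M"
  using preimage_submodule[OF N.zero_submodule] by simp

lemma image_submodule: "submodule (f ` carrier M) R N"
proof (rule N.submoduleI)
  show "\<zero>\<^bsub>N\<^esub> \<in> f ` carrier M" by (metis M.M.zero_closed image_eqI zero)
next
  fix x y assume "x \<in> f ` carrier M" "y \<in> f ` carrier M"
  then obtain x' y' where "x' \<in> carrier M" "y' \<in> carrier M" "x = f x'" "y = f y'" by blast
  then show "x \<oplus>\<^bsub>N\<^esub> y \<in> f ` carrier M"
    by (simp flip: add)
next
  fix a x assume "a \<in> carrier R" "x \<in> f ` carrier M"
  then show "a \<odot>\<^bsub>N\<^esub> x \<in> f ` carrier M"
    by (auto simp flip: smult)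
qed auto

end

lemma linear_mapI:
  "\<lbrakk>left_module R M; left_module R N; f \<in> lin_maps R M N\<rbrakk> \<Longrightarrow> linear_map R M N f"
  by (simp add: linear_map.intro linear_map_axioms.intro)

lemma lin_maps_zero:
  "\<lbrakk>left_module R M; left_module R N; f \<in> lin_maps R M N\<rbrakk> \<Longrightarrow> f \<zero>\<^bsub>M\<^esub> = \<zero>\<^bsub>N\<^esub>"
  by (rule linear_map.zero[OF linear_mapI])

lemma (in left_module) lin_maps_sum:
  assumes "left_module R L" and f: "f \<in> lin_maps R L M" and g: "g \<in> lin_maps R L M"
  shows "(\<lambda>x. f x \<oplus>\<^bsub>M\<^esub> g x) \<in> lin_maps R L M"
proof -
  interpret f: linear_map R L M f using assms by (simp add: linear_mapI left_module_axioms)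
  interpret g: linear_map R L M g using assms by (simp add: linear_mapI left_module_axioms)
  show ?thesis
    by (rule lin_mapsI) (simp_all add: f.add g.add f.smult g.smult smult_r_distr M.a_ac)
qed

lemma (in left_module) lin_maps_diff:
  assumes "left_module R L" and f: "f \<in> lin_maps R L M" and g: "g \<in> lin_maps R L M"
  shows "(\<lambda>x. f x \<ominus>\<^bsub>M\<^esub> g x) \<in> lin_maps R L M"
proof -
  interpret f: linear_map R L M f using assms by (simp add: linear_mapI left_module_axioms)
  interpret g: linear_map R L M g using assms by (simp add: linear_mapI left_module_axioms)
  show ?thesis
    by (rule lin_mapsI)
      (simp_all add: f.add g.add f.smult g.smult a_minus_def smult_r_distr smult_r_minus
        M.minus_add M.a_ac)
qed

lemma (in left_module) lin_maps_finsum: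
  assumes "left_module R L" "\<And>i. i \<in> S \<Longrightarrow> f i \<in> lin_maps R L M"
  shows "(\<lambda>x. \<Oplus>\<^bsub>M\<^esub>i\<in>S. f i x) \<in> lin_maps R L M"
proof (rule lin_mapsI)
  interpret L: left_module R L by fact
  fix x assume x: "x \<in> carrier L"
  have fx: "f i x \<in> carrier M" if "i \<in> S" for i
    using lin_maps_closed[OF assms(2)[OF that] x] .
  then show "(\<Oplus>\<^bsub>M\<^esub>i\<in>S. f i x) \<in> carrier M" by (intro M.finsum_closed) auto
  show "(\<Oplus>\<^bsub>M\<^esub>i\<in>S. f i (r \<odot>\<^bsub>L\<^esub> x)) = r \<odot>\<^bsub>M\<^esub> (\<Oplus>\<^bsub>M\<^esub>i\<in>S. f i x)" if "r \<in> carrier R" for r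
    using that x fx lin_maps_smult[OF assms(2)]
    by (subst smult_finsum) (auto intro!: M.finsum_cong')
  fix y assume y: "y \<in> carrier L"
  have fy: "f i y \<in> carrier M" if "i \<in> S" for i
    using lin_maps_closed[OF assms(2)[OF that] y] .
  show "(\<Oplus>\<^bsub>M\<^esub>i\<in>S. f i (x \<oplus>\<^bsub>L\<^esub> y)) = (\<Oplus>\<^bsub>M\<^esub>i\<in>S. f i x) \<oplus>\<^bsub>M\<^esub> (\<Oplus>\<^bsub>M\<^esub>i\<in>S. f i y)"
  proof -
    have "(\<Oplus>\<^bsub>M\<^esub>i\<in>S. f i (x \<oplus>\<^bsub>L\<^esub> y)) = (\<Oplus>\<^bsub>M\<^esub>i\<in>S. f i x \<oplus>\<^bsub>M\<^esub> f i y)"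
      using x y fx fy lin_maps_add[OF assms(2)] by (intro M.finsum_cong') auto
    also have "\<dots> = (\<Oplus>\<^bsub>M\<^esub>i\<in>S. f i x) \<oplus>\<^bsub>M\<^esub> (\<Oplus>\<^bsub>M\<^esub>i\<in>S. f i y)"
      using fx fy by (intro M.finsum_addf) auto
    finally show ?thesis .
  qed
qed

section \<open>Quotient modules\<close>

text \<open>
  A map that is constant on cosets, evaluated at a coset. With \<open>f\<close> a linear extension this is the
  form in which the bimodule structures over the enveloping algebra are given.
\<close>

definition on_coset :: "('m \<Rightarrow> 'n) \<Rightarrow> 'm set \<Rightarrow> 'n"
  where "on_coset f X = the_elem (f ` X)"

locale quotient = left_module R M for R (structure) and M (structure) and I +
  assumes sub: "submodule I R M"
begin

lemma abelian_subgroup: "abelian_subgroup I M"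
  using sub M.abelian_group_axioms
  by (simp add: abelian_subgroupI3 additive_subgroup_def submodule.axioms(1))

sublocale I: abelian_subgroup I M
  by (rule abelian_subgroup)

abbreviation proj where "proj x \<equiv> I +>\<^bsub>M\<^esub> x"

lemma proj_eq_iff:
  assumes "x \<in> carrier M" "y \<in> carrier M"
  shows "proj x = proj y \<longleftrightarrow> x \<ominus>\<^bsub>M\<^esub> y \<in> I"
proof
  assume "proj x = proj y"
  then show "x \<ominus>\<^bsub>M\<^esub> y \<in> I"
    using I.a_rcos_module_imp[OF assms(2), of x] I.a_rcos_self[OF assms(1)] assms
    by (simp add: a_minus_def)
next
  assume *: "x \<ominus>\<^bsub>M\<^esub> y \<in> I"
  then have "x \<in> proj y"
    using I.a_rcos_module_rev[OF assms(2,1)] by (simp add: a_minus_def)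
  then show "proj x = proj y"
    using M.a_repr_independence assms I.a_subgroup by blast
qed

lemma proj_zero: "proj \<zero>\<^bsub>M\<^esub> = I"
  using I.a_subset by simp

lemma proj_eq_I_iff: "x \<in> carrier M \<Longrightarrow> proj x = I \<longleftrightarrow> x \<in> I"
  using proj_eq_iff[of x "\<zero>\<^bsub>M\<^esub>"] by (simp add: proj_zero a_minus_def M.a_inv_zero)

lemma mem_proj_iff:
  assumes "x \<in> carrier M"
  shows "y \<in> proj x \<longleftrightarrow> y \<in> carrier M \<and> proj y = proj x"
proof
  assume *: "y \<in> proj x"
  then have "y \<in> carrier M" using assms M.a_r_coset_subset_G I.a_subset by blast
  then show "y \<in> carrier M \<and> proj y = proj x"
    using * I.a_subgroup M.a_repr_independence assms by blast
qed (use I.a_rcos_self in blast)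

lemma carrier_quot: "carrier (quot_module M I) = proj ` carrier M"
  by (auto simp: quot_module_def A_RCOSETS_def')

lemma carrier_quotE:
  assumes "X \<in> carrier (quot_module M I)"
  obtains x where "x \<in> carrier M" "X = proj x"
  using assms by (auto simp: carrier_quot)

lemma UN_proj_const:
  assumes "x \<in> carrier M" "\<And>y. y \<in> carrier M \<Longrightarrow> proj y = proj x \<Longrightarrow> F y = F x"
  shows "(\<Union>y\<in>proj x. F y) = F x"
proof -
  have "F y = F x" if "y \<in> proj x" for y
    using that assms(2)[of y] mem_proj_iff[OF assms(1)] by simp
  moreover have "x \<in> proj x" using assms(1) by (rule I.a_rcos_self)
  ultimately show ?thesis by blast
qed

lemma zero_quot: "\<zero>\<^bsub>quot_module M I\<^esub> = I"
  by (simp add: quot_module_def)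

lemma add_quot:
  "\<lbrakk>x \<in> carrier M; y \<in> carrier M\<rbrakk> \<Longrightarrow> proj x \<oplus>\<^bsub>quot_module M I\<^esub> proj y = proj (x \<oplus>\<^bsub>M\<^esub> y)"
  by (simp add: quot_module_def I.a_rcos_sum)

lemma smult_quot:
  assumes "a \<in> carrier R" "x \<in> carrier M"
  shows "a \<odot>\<^bsub>quot_module M I\<^esub> proj x = proj (a \<odot>\<^bsub>M\<^esub> x)"
proof -
  have "proj (a \<odot>\<^bsub>M\<^esub> y) = proj (a \<odot>\<^bsub>M\<^esub> x)" if "y \<in> carrier M" "proj y = proj x" for y
  proof -
    have "a \<odot>\<^bsub>M\<^esub> (y \<ominus>\<^bsub>M\<^esub> x) \<in> I"
      using that assms by (intro submodule_smult[OF sub]) (simp_all add: proj_eq_iff[symmetric])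
    then show ?thesis
      using that assms by (simp add: proj_eq_iff smult_r_diff)
  qed
  then show ?thesis
    using UN_proj_const[OF assms(2), of "\<lambda>y. proj (a \<odot>\<^bsub>M\<^esub> y)"] by (simp add: quot_module_def)
qed

lemma left_module_quot: "left_module R (quot_module M I)"
proof -
  let ?Q = "quot_module M I"
  have mem: "proj x \<in> carrier ?Q" if "x \<in> carrier M" for x
    using that by (simp add: carrier_quot)
  note simps = mem add_quot smult_quot
  have "abelian_group ?Q"
  proof (rule abelian_groupI)
    fix X Y assume "X \<in> carrier ?Q" "Y \<in> carrier ?Q"
    then obtain x y where xy: "x \<in> carrier M" "X = proj x" "y \<in> carrier M" "Y = proj y"
      by (metis carrier_quotE)
    then show "X \<oplus>\<^bsub>?Q\<^esub> Y \<in> carrier ?Q" by (simp add: simps)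
    show "X \<oplus>\<^bsub>?Q\<^esub> Y = Y \<oplus>\<^bsub>?Q\<^esub> X" using xy by (simp add: simps M.a_comm)
    fix Z assume "Z \<in> carrier ?Q"
    then obtain z where "z \<in> carrier M" "Z = proj z" by (rule carrier_quotE)
    then show "X \<oplus>\<^bsub>?Q\<^esub> Y \<oplus>\<^bsub>?Q\<^esub> Z = X \<oplus>\<^bsub>?Q\<^esub> (Y \<oplus>\<^bsub>?Q\<^esub> Z)"
      using xy by (simp add: simps M.a_assoc)
  next
    fix X assume "X \<in> carrier ?Q"
    then obtain x where x: "x \<in> carrier M" "X = proj x" by (rule carrier_quotE)
    then have "proj (\<ominus>\<^bsub>M\<^esub> x) \<oplus>\<^bsub>?Q\<^esub> X = \<zero>\<^bsub>?Q\<^esub>"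
      by (simp add: simps zero_quot M.l_neg proj_zero)
    then show "\<exists>y\<in>carrier ?Q. y \<oplus>\<^bsub>?Q\<^esub> X = \<zero>\<^bsub>?Q\<^esub>"
      using x mem[of "\<ominus>\<^bsub>M\<^esub> x"] by blast
    show "\<zero>\<^bsub>?Q\<^esub> \<oplus>\<^bsub>?Q\<^esub> X = X"
      using add_quot[of "\<zero>\<^bsub>M\<^esub>" x] x by (simp add: zero_quot proj_zero)
  next
    show "\<zero>\<^bsub>?Q\<^esub> \<in> carrier ?Q"
      using mem[of "\<zero>\<^bsub>M\<^esub>"] by (simp add: zero_quot proj_zero)
  qed
  then show ?thesis
  proof (rule left_moduleI[OF R.ring_axioms])
    fix a X assume a: "a \<in> carrier R" and "X \<in> carrier ?Q"
    then obtain x where x: "x \<in> carrier M" "X = proj x" by (metis carrier_quotE)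
    then show "a \<odot>\<^bsub>?Q\<^esub> X \<in> carrier ?Q" using a by (simp add: simps)
    fix b assume b: "b \<in> carrier R"
    show "(a \<oplus> b) \<odot>\<^bsub>?Q\<^esub> X = a \<odot>\<^bsub>?Q\<^esub> X \<oplus>\<^bsub>?Q\<^esub> b \<odot>\<^bsub>?Q\<^esub> X"
      using a b x by (simp add: simps smult_l_distr)
    show "(a \<otimes> b) \<odot>\<^bsub>?Q\<^esub> X = a \<odot>\<^bsub>?Q\<^esub> (b \<odot>\<^bsub>?Q\<^esub> X)"
      using a b x by (simp add: simps smult_assoc)
  next
    fix a X Y assume a: "a \<in> carrier R" and "X \<in> carrier ?Q" "Y \<in> carrier ?Q"
    then obtain x y where "x \<in> carrier M" "X = proj x" "y \<in> carrier M" "Y = proj y"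
      by (metis carrier_quotE)
    then show "a \<odot>\<^bsub>?Q\<^esub> (X \<oplus>\<^bsub>?Q\<^esub> Y) = a \<odot>\<^bsub>?Q\<^esub> X \<oplus>\<^bsub>?Q\<^esub> a \<odot>\<^bsub>?Q\<^esub> Y"
      using a by (simp add: simps smult_r_distr)
  next
    fix X assume "X \<in> carrier ?Q"
    then show "\<one> \<odot>\<^bsub>?Q\<^esub> X = X" by (metis carrier_quotE smult_one smult_quot R.one_closed)
  qed
qed

lemma proj_lin: "(\<lambda>x. proj x) \<in> lin_maps R M (quot_module M I)"
  by (rule lin_mapsI) (simp_all add: carrier_quot add_quot smult_quot)

lemma on_coset_proj:
  assumes "left_module R N" "f \<in> lin_maps R M N" "\<And>x. x \<in> I \<Longrightarrow> f x = \<zero>\<^bsub>N\<^esub>" "x \<in> carrier M"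
  shows "on_coset f (proj x) = f x"
proof -
  interpret f: linear_map R M N f
    using assms by (simp add: linear_mapI left_module_axioms)
  have "f y = f x" if "y \<in> proj x" for y
  proof -
    have y: "y \<in> carrier M" "proj y = proj x" using that assms(4) by (auto simp: mem_proj_iff)
    then have "f (y \<ominus>\<^bsub>M\<^esub> x) = \<zero>\<^bsub>N\<^esub>"
      using assms(3,4) y by (simp add: proj_eq_iff[symmetric])
    then show ?thesis using y assms(4) by (simp add: f.diff f.N.M.a_minus_eq_zero_iff)
  qed
  moreover have "x \<in> proj x" using I.a_rcos_self assms(4) by blast
  ultimately have "f ` proj x = {f x}" by blast
  then show ?thesis by (simp add: on_coset_def)
qed

lemma on_coset_lin:
  assumes "left_module R N" "f \<in> lin_maps R M N" "\<And>x. x \<in> I \<Longrightarrow> f x = \<zero>\<^bsub>N\<^esub>"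
  shows "on_coset f \<in> lin_maps R (quot_module M I) N"
proof (rule lin_mapsI)
  interpret f: linear_map R M N f
    using assms by (simp add: linear_mapI left_module_axioms)
  note val = on_coset_proj[OF assms]
  fix X assume "X \<in> carrier (quot_module M I)"
  then obtain x where x: "x \<in> carrier M" "X = proj x" by (rule carrier_quotE)
  then show "on_coset f X \<in> carrier N" by (simp add: val)
  show "on_coset f (a \<odot>\<^bsub>quot_module M I\<^esub> X) = a \<odot>\<^bsub>N\<^esub> on_coset f X" if "a \<in> carrier R" for a
    using x that by (simp add: val smult_quot f.smult)
  fix Y assume "Y \<in> carrier (quot_module M I)"
  then obtain y where "y \<in> carrier M" "Y = proj y" by (rule carrier_quotE)
  then show "on_coset f (X \<oplus>\<^bsub>quot_module M I\<^esub> Y) = on_coset f X \<oplus>\<^bsub>N\<^esub> on_coset f Y"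
    using x by (simp add: val add_quot f.add)
qed

lemma first_isomorphism:
  assumes "left_module R N" "f \<in> lin_maps R M N" "f ` carrier M = carrier N"
    and ker: "\<And>x. x \<in> carrier M \<Longrightarrow> f x = \<zero>\<^bsub>N\<^esub> \<longleftrightarrow> x \<in> I"
  shows "lin_iso R (quot_module M I) N"
proof -
  interpret f: linear_map R M N f
    using assms by (simp add: linear_mapI left_module_axioms)
  have vanish: "\<And>x. x \<in> I \<Longrightarrow> f x = \<zero>\<^bsub>N\<^esub>" using ker submodule_subset[OF sub] by blast
  note val = on_coset_proj[OF assms(1,2) vanish]
  have "inj_on (on_coset f) (carrier (quot_module M I))"
  proof (rule inj_onI)
    fix X Y
    assume X: "X \<in> carrier (quot_module M I)" and Y: "Y \<in> carrier (quot_module M I)"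
      and eq: "on_coset f X = on_coset f Y"
    obtain x where x: "x \<in> carrier M" "X = proj x" using X by (rule carrier_quotE)
    obtain y where y: "y \<in> carrier M" "Y = proj y" using Y by (rule carrier_quotE)
    have "f (x \<ominus>\<^bsub>M\<^esub> y) = \<zero>\<^bsub>N\<^esub>" using x y eq by (simp add: val f.diff f.N.M.a_minus_eq_zero_iff)
    then show "X = Y" using x y ker by (simp add: proj_eq_iff)
  qed
  moreover have "on_coset f ` carrier (quot_module M I) = carrier N"
    unfolding carrier_quot image_image using val assms(3) by simp
  ultimately show ?thesis
    unfolding lin_iso_def bij_betw_def using on_coset_lin[OF assms(1,2) vanish] by blast
qed

end

lemma quotientI: "\<lbrakk>left_module R M; submodule I R M\<rbrakk> \<Longrightarrow> quotient R M I"
  by (simp add: quotient.intro quotient_axioms.intro)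

section \<open>Free modules\<close>

lemma regular_simps [simp]:
  "carrier (regular R) = carrier R" "zero (regular R) = zero R" "add (regular R) = add R"
  "mult (regular R) = mult R" "one (regular R) = one R" "smult (regular R) = mult R"
  by (simp_all add: regular_def)

lemma finsum_regular [simp]: "finsum (regular R) = finsum R"
  by (intro ext) (simp add: finsum_def finprod_def)

lemma (in ring) regular_left_module: "left_module R (regular R)"
  by (rule left_moduleI)
    (auto simp: ring_axioms l_distr r_distr m_assoc a_ac intro!: abelian_groupI
      intro: add.inv_closed l_neg bexI[of _ "\<ominus> x" for x])

lemma copower_simps [simp]:
  "\<zero>\<^bsub>copower M X\<^esub> = (\<lambda>x. \<zero>\<^bsub>M\<^esub>)"
  "f \<oplus>\<^bsub>copower M X\<^esub> g = (\<lambda>x. f x \<oplus>\<^bsub>M\<^esub> g x)"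
  "r \<odot>\<^bsub>copower M X\<^esub> f = (\<lambda>x. r \<odot>\<^bsub>M\<^esub> f x)"
  by (simp_all add: copower_def)

lemma mem_copower_iff:
  "f \<in> carrier (copower M X) \<longleftrightarrow>
    (\<forall>x. f x \<in> carrier M) \<and> finite {x. f x \<noteq> \<zero>\<^bsub>M\<^esub>} \<and> (\<forall>x. x \<notin> X \<longrightarrow> f x = \<zero>\<^bsub>M\<^esub>)"
  by (auto simp: copower_def)

lemma mem_copowerI:
  assumes "\<And>x. f x \<in> carrier M" "finite S" "S \<subseteq> X" "\<And>x. x \<notin> S \<Longrightarrow> f x = \<zero>\<^bsub>M\<^esub>"
  shows "f \<in> carrier (copower M X)"
proof -
  have "finite {x. f x \<noteq> \<zero>\<^bsub>M\<^esub>}"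
    using assms(2,4) by (auto intro: finite_subset[of _ S])
  then show ?thesis using assms by (auto simp: mem_copower_iff)
qed

context left_module
begin

lemma copower_add_closed:
  assumes "f \<in> carrier (copower M X)" "g \<in> carrier (copower M X)"
  shows "(\<lambda>x. f x \<oplus>\<^bsub>M\<^esub> g x) \<in> carrier (copower M X)"
  using assms
  by (intro mem_copowerI[where S = "{x. f x \<noteq> \<zero>\<^bsub>M\<^esub>} \<union> {x. g x \<noteq> \<zero>\<^bsub>M\<^esub>}"])
    (auto simp: mem_copower_iff)

lemma copower_smult_closed:
  assumes "r \<in> carrier R" "f \<in> carrier (copower M X)"
  shows "(\<lambda>x. r \<odot>\<^bsub>M\<^esub> f x) \<in> carrier (copower M X)"
  using assms
  by (intro mem_copowerI[where S = "{x. f x \<noteq> \<zero>\<^bsub>M\<^esub>}"]) (auto simp: mem_copower_iff)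

lemma copower_left_module: "left_module R (copower M X)"
proof -
  have cl: "f x \<in> carrier M" if "f \<in> carrier (copower M X)" for f x
    using that by (simp add: mem_copower_iff)
  have "abelian_group (copower M X)"
  proof (rule abelian_groupI)
    fix f assume f: "f \<in> carrier (copower M X)"
    then have "(\<lambda>x. (\<ominus> \<one>) \<odot>\<^bsub>M\<^esub> f x) \<in> carrier (copower M X)"
      by (intro copower_smult_closed) auto
    moreover have "(\<lambda>x. (\<ominus> \<one>) \<odot>\<^bsub>M\<^esub> f x \<oplus>\<^bsub>M\<^esub> f x) = (\<lambda>x. \<zero>\<^bsub>M\<^esub>)"
      using cl[OF f] by (simp add: smult_l_minus M.l_neg)
    ultimately show "\<exists>g\<in>carrier (copower M X). g \<oplus>\<^bsub>copower M X\<^esub> f = \<zero>\<^bsub>copower M X\<^esub>"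
      by (intro bexI[of _ "\<lambda>x. (\<ominus> \<one>) \<odot>\<^bsub>M\<^esub> f x"]) simp_all
    show "\<zero>\<^bsub>copower M X\<^esub> \<oplus>\<^bsub>copower M X\<^esub> f = f"
      using cl[OF f] by simp
    fix g assume g: "g \<in> carrier (copower M X)"
    show "f \<oplus>\<^bsub>copower M X\<^esub> g \<in> carrier (copower M X)"
      using f g by (simp add: copower_add_closed)
    show "f \<oplus>\<^bsub>copower M X\<^esub> g = g \<oplus>\<^bsub>copower M X\<^esub> f"
      using cl[OF f] cl[OF g] by (simp add: M.a_comm)
    fix h assume h: "h \<in> carrier (copower M X)"
    show "f \<oplus>\<^bsub>copower M X\<^esub> g \<oplus>\<^bsub>copower M X\<^esub> h = f \<oplus>\<^bsub>copower M X\<^esub> (g \<oplus>\<^bsub>copower M X\<^esub> h)"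
      using cl[OF f] cl[OF g] cl[OF h] by (simp add: M.a_assoc)
  qed (simp add: mem_copower_iff)
  then show ?thesis
    by (rule left_moduleI[OF R.ring_axioms])
      (simp_all add: copower_smult_closed cl smult_l_distr smult_r_distr smult_assoc)
qed

lemma finsum_copower_apply:
  assumes "f \<in> S \<rightarrow> carrier (copower M X)"
  shows "(\<Oplus>\<^bsub>copower M X\<^esub>i\<in>S. f i) x = (\<Oplus>\<^bsub>M\<^esub>i\<in>S. f i x)"
proof -
  interpret ev: linear_map R "copower M X" M "\<lambda>f. f x"
    using copower_left_module left_module_axioms
    by (intro linear_mapI lin_mapsI) (simp_all add: mem_copower_iff)
  show ?thesis using ev.finsum[OF assms] .
qed

end

lemma basis_elt_same [simp]: "basis_elt R x x = \<one>\<^bsub>R\<^esub>"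
  and basis_elt_other [simp]: "y \<noteq> x \<Longrightarrow> basis_elt R x y = \<zero>\<^bsub>R\<^esub>"
  by (simp_all add: basis_elt_def)

text \<open>The linear map out of a free module that is determined by its values on the basis.\<close>

definition lin_ext :: "('r, 'q) ring_scheme \<Rightarrow> ('r, 'm, 'u) module_scheme \<Rightarrow> ('x \<Rightarrow> 'm) \<Rightarrow> ('x \<Rightarrow> 'r) \<Rightarrow> 'm"
  where "lin_ext R M \<phi> s = (\<Oplus>\<^bsub>M\<^esub>x\<in>{x. s x \<noteq> \<zero>\<^bsub>R\<^esub>}. s x \<odot>\<^bsub>M\<^esub> \<phi> x)"

context ring
begin

lemma free_left_module: "left_module R (free_module R X)"
  by (rule left_module.copower_left_module[OF regular_left_module])

lemma free_memD:
  assumes "s \<in> carrier (free_module R X)"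
  shows "s x \<in> carrier R" "finite {x. s x \<noteq> \<zero>}" "x \<notin> X \<Longrightarrow> s x = \<zero>"
  using assms by (auto simp: mem_copower_iff)

lemma free_memI:
  assumes "\<And>x. s x \<in> carrier R" "finite S" "S \<subseteq> X" "\<And>x. x \<notin> S \<Longrightarrow> s x = \<zero>"
  shows "s \<in> carrier (free_module R X)"
  using mem_copowerI[of s "regular R" S X] assms by simp

lemma basis_closed [simp]: "x \<in> X \<Longrightarrow> basis_elt R x \<in> carrier (free_module R X)"
  by (rule free_memI[of _ "{x}"]) (auto simp: basis_elt_def)

lemma free_smult_closed:
  "\<lbrakk>r \<in> carrier R; s \<in> carrier (free_module R X)\<rbrakk> \<Longrightarrow> (\<lambda>x. r \<otimes> s x) \<in> carrier (free_module R X)"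
  using left_module.copower_smult_closed[OF regular_left_module, of r s X] by simp

lemma free_module_induct [consumes 1, case_names zero add basis]:
  fixes s :: "'x \<Rightarrow> 'a"
  assumes "s \<in> carrier (free_module R X)"
    and zero: "P (\<lambda>x. \<zero>)"
    and add: "\<And>s t. \<lbrakk>s \<in> carrier (free_module R X); t \<in> carrier (free_module R X); P s; P t\<rbrakk>
      \<Longrightarrow> P (\<lambda>x. s x \<oplus> t x)"
    and basis: "\<And>r x. \<lbrakk>r \<in> carrier R; x \<in> X\<rbrakk> \<Longrightarrow> P (\<lambda>y. r \<otimes> basis_elt R x y)"
  shows "P s"
proof -
  have "\<forall>s \<in> carrier (free_module R X). {x. s x \<noteq> \<zero>} \<subseteq> S \<longrightarrow> P s" if "finite S" "S \<subseteq> X" for S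
    using that
  proof (induction S)
    case empty
    show ?case
    proof (intro ballI impI)
      fix s :: "'x \<Rightarrow> 'a" assume "{x. s x \<noteq> \<zero>} \<subseteq> {}"
      then have "s = (\<lambda>x. \<zero>)" by auto
      with zero show "P s" by simp
    qed
  next
    case (insert a S)
    show ?case
    proof (intro ballI impI)
      fix s assume s: "s \<in> carrier (free_module R X)" "{x. s x \<noteq> \<zero>} \<subseteq> insert a S"
      let ?t = "s(a := \<zero>)" and ?u = "\<lambda>y. s a \<otimes> basis_elt R a y"
      have t: "?t \<in> carrier (free_module R X)"
        using s insert.prems insert.hyps free_memD[OF s(1)] by (intro free_memI[of _ S]) auto
      have u: "?u \<in> carrier (free_module R X)"
        using free_memD[OF s(1)] insert.prems by (simp add: free_smult_closed)
      have "{x. ?t x \<noteq> \<zero>} \<subseteq> S" using s(2) by auto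
      then have "P ?t" using insert.IH insert.prems t by blast
      moreover have "P ?u" using basis insert.prems free_memD[OF s(1)] by simp
      ultimately have "P (\<lambda>x. ?t x \<oplus> ?u x)" by (rule add[OF t u])
      moreover have "(\<lambda>x. ?t x \<oplus> ?u x) = s"
        using free_memD(1)[OF s(1)] by (auto simp: basis_elt_def)
      ultimately show "P s" by simp
    qed
  qed
  moreover have "{x. s x \<noteq> \<zero>} \<subseteq> X" using free_memD(3)[OF assms(1)] by auto
  ultimately show ?thesis
    using assms(1) free_memD(2)[OF assms(1)] by simp
qed

lemma free_module_eqI:
  assumes f: "f \<in> lin_maps R (free_module R X) M" and g: "g \<in> lin_maps R (free_module R X) M"
    and M: "left_module R M"
    and eq: "\<And>x. x \<in> X \<Longrightarrow> f (basis_elt R x) = g (basis_elt R x)"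
    and s: "s \<in> carrier (free_module R X)"
  shows "f s = g s"
proof -
  interpret f: linear_map R "free_module R X" M f using assms by (simp add: linear_mapI free_left_module)
  interpret g: linear_map R "free_module R X" M g using assms by (simp add: linear_mapI free_left_module)
  from s show ?thesis
  proof (induction rule: free_module_induct)
    case zero then show ?case using f.zero g.zero by simp
  next
    case (add s t) then show ?case using f.add[of s t] g.add[of s t] by simp
  next
    case (basis r x)
    then show ?case
      using f.smult[of r "basis_elt R x"] g.smult[of r "basis_elt R x"] eq by simp
  qed
qed

lemma lin_ext_eq:
  assumes M: "left_module R M" and "\<phi> \<in> X \<rightarrow> carrier M"
    and s: "s \<in> carrier (free_module R X)" "{x. s x \<noteq> \<zero>} \<subseteq> S" "finite S" "S \<subseteq> X"
  shows "lin_ext R M \<phi> s = (\<Oplus>\<^bsub>M\<^esub>x\<in>S. s x \<odot>\<^bsub>M\<^esub> \<phi> x)"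
proof -
  interpret M: left_module R M by fact
  show ?thesis unfolding lin_ext_def
    by (rule M.M.add.finprod_mono_neutral_cong_left)
      (use assms free_memD(1)[OF s(1)] in \<open>auto simp: Pi_iff subset_iff\<close>)
qed

lemma lin_ext_lin:
  assumes M: "left_module R M" and \<phi>: "\<phi> \<in> X \<rightarrow> carrier M"
  shows "lin_ext R M \<phi> \<in> lin_maps R (free_module R X) M"
proof (rule lin_mapsI)
  interpret M: left_module R M by fact
  fix s assume s: "s \<in> carrier (free_module R X)"
  note sD = free_memD[OF s]
  let ?S = "{x. s x \<noteq> \<zero>}"
  have S: "?S \<subseteq> X" using sD by auto
  have \<phi>S: "\<phi> x \<in> carrier M" if "x \<in> X" for x using \<phi> that by auto
  have terms: "s x \<odot>\<^bsub>M\<^esub> \<phi> x \<in> carrier M" if "x \<in> X" for x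
    using that \<phi>S sD by simp
  then show "lin_ext R M \<phi> s \<in> carrier M"
    unfolding lin_ext_def using S by (intro M.M.finsum_closed) auto
  show "lin_ext R M \<phi> (r \<odot>\<^bsub>free_module R X\<^esub> s) = r \<odot>\<^bsub>M\<^esub> lin_ext R M \<phi> s" if r: "r \<in> carrier R" for r
  proof -
    have "lin_ext R M \<phi> (r \<odot>\<^bsub>free_module R X\<^esub> s) = (\<Oplus>\<^bsub>M\<^esub>x\<in>?S. (r \<otimes> s x) \<odot>\<^bsub>M\<^esub> \<phi> x)"
      using r sD S left_module.copower_smult_closed[OF regular_left_module r s]
      by (subst lin_ext_eq[OF M \<phi>, of _ ?S]) auto
    also have "\<dots> = (\<Oplus>\<^bsub>M\<^esub>x\<in>?S. r \<odot>\<^bsub>M\<^esub> (s x \<odot>\<^bsub>M\<^esub> \<phi> x))"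
      using r sD S terms \<phi>S by (intro M.M.finsum_cong') (auto simp: M.smult_assoc subset_iff)
    also have "\<dots> = r \<odot>\<^bsub>M\<^esub> lin_ext R M \<phi> s"
      unfolding lin_ext_def using r terms S by (intro M.smult_finsum[symmetric]) auto
    finally show ?thesis .
  qed
  fix t assume t: "t \<in> carrier (free_module R X)"
  note tD = free_memD[OF t]
  let ?U = "?S \<union> {x. t x \<noteq> \<zero>}"
  have U: "finite ?U" "?U \<subseteq> X" using sD tD by auto
  have termt: "t x \<odot>\<^bsub>M\<^esub> \<phi> x \<in> carrier M" if "x \<in> X" for x
    using that \<phi>S tD by simp
  have "lin_ext R M \<phi> (s \<oplus>\<^bsub>free_module R X\<^esub> t) = (\<Oplus>\<^bsub>M\<^esub>x\<in>?U. (s x \<oplus> t x) \<odot>\<^bsub>M\<^esub> \<phi> x)"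
    using U left_module.copower_add_closed[OF regular_left_module s t]
    by (subst lin_ext_eq[OF M \<phi>, of _ ?U]) auto
  also have "\<dots> = (\<Oplus>\<^bsub>M\<^esub>x\<in>?U. s x \<odot>\<^bsub>M\<^esub> \<phi> x \<oplus>\<^bsub>M\<^esub> t x \<odot>\<^bsub>M\<^esub> \<phi> x)"
    using U(2) terms termt sD(1) tD(1) \<phi>S
    by (intro M.M.finsum_cong') (auto simp: M.smult_l_distr subset_iff)
  also have "\<dots> = (\<Oplus>\<^bsub>M\<^esub>x\<in>?U. s x \<odot>\<^bsub>M\<^esub> \<phi> x) \<oplus>\<^bsub>M\<^esub> (\<Oplus>\<^bsub>M\<^esub>x\<in>?U. t x \<odot>\<^bsub>M\<^esub> \<phi> x)"
    using U(2) terms termt by (intro M.M.finsum_addf) auto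
  also have "\<dots> = lin_ext R M \<phi> s \<oplus>\<^bsub>M\<^esub> lin_ext R M \<phi> t"
    using U s t by (simp add: lin_ext_eq[OF M \<phi>, of _ ?U])
  finally show "lin_ext R M \<phi> (s \<oplus>\<^bsub>free_module R X\<^esub> t) = lin_ext R M \<phi> s \<oplus>\<^bsub>M\<^esub> lin_ext R M \<phi> t" .
qed

lemma lin_ext_basis:
  assumes M: "left_module R M" and \<phi>: "\<phi> \<in> X \<rightarrow> carrier M" and x: "x \<in> X"
  shows "lin_ext R M \<phi> (basis_elt R x) = \<phi> x"
proof -
  interpret M: left_module R M by fact
  have "lin_ext R M \<phi> (basis_elt R x) = (\<Oplus>\<^bsub>M\<^esub>y\<in>{x}. basis_elt R x y \<odot>\<^bsub>M\<^esub> \<phi> y)"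
    using x basis_closed[OF x] by (intro lin_ext_eq[OF M \<phi>]) (auto simp: basis_elt_def split: if_splits)
  also have "\<dots> = \<phi> x" using funcset_mem[OF \<phi> x] by simp
  finally show ?thesis .
qed

lemma push_forward_eq_lin_ext:
  assumes s: "s \<in> carrier (free_module R X)" and h: "h \<in> X \<rightarrow> Y"
  shows "push_forward R h s = lin_ext R (free_module R Y) (\<lambda>x. basis_elt R (h x)) s"
proof
  fix y
  note sD = free_memD[OF s]
  let ?S = "{x. s x \<noteq> \<zero>}"
  have hS: "h x \<in> Y" if "x \<in> ?S" for x using that h sD(3) by auto
  have "lin_ext R (free_module R Y) (\<lambda>x. basis_elt R (h x)) s y
      = (\<Oplus>x\<in>?S. s x \<otimes> basis_elt R (h x) y)"
  proof -
    have "(\<lambda>x. s x \<odot>\<^bsub>free_module R Y\<^esub> basis_elt R (h x)) \<in> ?S \<rightarrow> carrier (free_module R Y)"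
      using hS sD(1) by (auto simp: Pi_iff intro!: free_smult_closed)
    from left_module.finsum_copower_apply[OF regular_left_module this]
    show ?thesis unfolding lin_ext_def by (simp add: finsum_regular)
  qed
  also have "\<dots> = (\<Oplus>x\<in>{x. s x \<noteq> \<zero> \<and> h x = y}. s x)"
    by (rule add.finprod_mono_neutral_cong_right) (use sD in \<open>auto simp: basis_elt_def\<close>)
  finally show "push_forward R h s y = lin_ext R (free_module R Y) (\<lambda>x. basis_elt R (h x)) s y"
    by (simp add: push_forward_def)
qed

end

section \<open>Projective modules\<close>

text \<open>
  The basis vectors of the free module are lifted one by one; the lift of the free module is then
  restricted to the direct summand.
\<close>

lemma projective_lift:
  assumes P: "projective R P" and M: "left_module R M" and N: "left_module R N"
    and g: "g \<in> lin_maps R M N" and f: "f \<in> lin_maps R P N"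
    and im: "\<And>x. x \<in> carrier P \<Longrightarrow> f x \<in> g ` carrier M"
  shows "\<exists>h\<in>lin_maps R P M. \<forall>x\<in>carrier P. g (h x) = f x"
proof -
  interpret P: left_module R P using P by (simp add: projective_def)
  obtain X :: "'c set" and i p where i: "i \<in> lin_maps R P (free_module R X)"
    and p: "p \<in> lin_maps R (free_module R X) P" and pi: "\<And>x. x \<in> carrier P \<Longrightarrow> p (i x) = x"
    using P unfolding projective_def by blast
  have "\<exists>y. y \<in> carrier M \<and> g y = f (p (basis_elt R x))" if "x \<in> X" for x
    using im[of "p (basis_elt R x)"] lin_maps_closed[OF p] that by fastforce
  then obtain \<phi> where \<phi>: "\<And>x. x \<in> X \<Longrightarrow> \<phi> x \<in> carrier M"
    and g\<phi>: "\<And>x. x \<in> X \<Longrightarrow> g (\<phi> x) = f (p (basis_elt R x))"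
    by metis
  have \<phi>': "\<phi> \<in> X \<rightarrow> carrier M" using \<phi> by blast
  let ?h = "lin_ext R M \<phi>"
  note h = P.R.lin_ext_lin[OF M \<phi>']
  have "g (?h s) = f (p s)" if "s \<in> carrier (free_module R X)" for s
    by (rule P.R.free_module_eqI[OF lin_maps_compose[OF h g] lin_maps_compose[OF p f] N _ that])
      (simp add: P.R.lin_ext_basis[OF M \<phi>'] g\<phi>)
  then have "\<forall>x\<in>carrier P. g (?h (i x)) = f x"
    using lin_maps_closed[OF i] pi by auto
  then show ?thesis by (rule bexI[OF _ lin_maps_compose[OF i h]])
qed

section \<open>Tensor products\<close>

lemma opposite_simps [simp]:
  "carrier (opposite A) = carrier A" "zero (opposite A) = zero A" "add (opposite A) = add A"
  "one (opposite A) = one A" "mult (opposite A) x y = mult A y x"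
  by (simp_all add: opposite_def)

text \<open>
  A right module over \<open>R\<close> is a left module over the opposite ring; \<open>balanced K R M N V \<phi>\<close> says that
  \<open>\<phi>\<close> satisfies the relations imposed on \<open>x \<otimes> y\<close>.
\<close>

definition balanced ::
    "('k, 'q) ring_scheme \<Rightarrow> ('k, 'r, 's) module_scheme \<Rightarrow> ('r, 'm, 'u) module_scheme
      \<Rightarrow> ('r, 'n, 'v) module_scheme \<Rightarrow> ('k, 'w, 'z) module_scheme \<Rightarrow> ('m \<Rightarrow> 'n \<Rightarrow> 'w) \<Rightarrow> bool"
  where "balanced K R M N V \<phi> \<longleftrightarrow>
    (\<forall>x\<in>carrier M. \<forall>y\<in>carrier N. \<phi> x y \<in> carrier V) \<and>
    (\<forall>x\<in>carrier M. \<forall>x'\<in>carrier M. \<forall>y\<in>carrier N. \<phi> (x \<oplus>\<^bsub>M\<^esub> x') y = \<phi> x y \<oplus>\<^bsub>V\<^esub> \<phi> x' y) \<and>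
    (\<forall>x\<in>carrier M. \<forall>y\<in>carrier N. \<forall>y'\<in>carrier N. \<phi> x (y \<oplus>\<^bsub>N\<^esub> y') = \<phi> x y \<oplus>\<^bsub>V\<^esub> \<phi> x y') \<and>
    (\<forall>r\<in>carrier R. \<forall>x\<in>carrier M. \<forall>y\<in>carrier N. \<phi> (r \<odot>\<^bsub>M\<^esub> x) y = \<phi> x (r \<odot>\<^bsub>N\<^esub> y)) \<and>
    (\<forall>k\<in>carrier K. \<forall>x\<in>carrier M. \<forall>y\<in>carrier N.
       \<phi> ((k \<odot>\<^bsub>R\<^esub> \<one>\<^bsub>R\<^esub>) \<odot>\<^bsub>M\<^esub> x) y = k \<odot>\<^bsub>V\<^esub> \<phi> x y)"

lemma balancedI:
  assumes "\<And>x y. \<lbrakk>x \<in> carrier M; y \<in> carrier N\<rbrakk> \<Longrightarrow> \<phi> x y \<in> carrier V"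
    and "\<And>x x' y. \<lbrakk>x \<in> carrier M; x' \<in> carrier M; y \<in> carrier N\<rbrakk>
      \<Longrightarrow> \<phi> (x \<oplus>\<^bsub>M\<^esub> x') y = \<phi> x y \<oplus>\<^bsub>V\<^esub> \<phi> x' y"
    and "\<And>x y y'. \<lbrakk>x \<in> carrier M; y \<in> carrier N; y' \<in> carrier N\<rbrakk>
      \<Longrightarrow> \<phi> x (y \<oplus>\<^bsub>N\<^esub> y') = \<phi> x y \<oplus>\<^bsub>V\<^esub> \<phi> x y'"
    and "\<And>r x y. \<lbrakk>r \<in> carrier R; x \<in> carrier M; y \<in> carrier N\<rbrakk>
      \<Longrightarrow> \<phi> (r \<odot>\<^bsub>M\<^esub> x) y = \<phi> x (r \<odot>\<^bsub>N\<^esub> y)"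
    and "\<And>k x y. \<lbrakk>k \<in> carrier K; x \<in> carrier M; y \<in> carrier N\<rbrakk>
      \<Longrightarrow> \<phi> ((k \<odot>\<^bsub>R\<^esub> \<one>\<^bsub>R\<^esub>) \<odot>\<^bsub>M\<^esub> x) y = k \<odot>\<^bsub>V\<^esub> \<phi> x y"
  shows "balanced K R M N V \<phi>"
  using assms unfolding balanced_def by blast

lemma balancedD:
  assumes "balanced K R M N V \<phi>"
  shows balanced_closed: "\<And>x y. \<lbrakk>x \<in> carrier M; y \<in> carrier N\<rbrakk> \<Longrightarrow> \<phi> x y \<in> carrier V"
    and balanced_add_l: "\<And>x x' y. \<lbrakk>x \<in> carrier M; x' \<in> carrier M; y \<in> carrier N\<rbrakk>
      \<Longrightarrow> \<phi> (x \<oplus>\<^bsub>M\<^esub> x') y = \<phi> x y \<oplus>\<^bsub>V\<^esub> \<phi> x' y"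
    and balanced_add_r: "\<And>x y y'. \<lbrakk>x \<in> carrier M; y \<in> carrier N; y' \<in> carrier N\<rbrakk>
      \<Longrightarrow> \<phi> x (y \<oplus>\<^bsub>N\<^esub> y') = \<phi> x y \<oplus>\<^bsub>V\<^esub> \<phi> x y'"
    and balanced_mid: "\<And>r x y. \<lbrakk>r \<in> carrier R; x \<in> carrier M; y \<in> carrier N\<rbrakk>
      \<Longrightarrow> \<phi> (r \<odot>\<^bsub>M\<^esub> x) y = \<phi> x (r \<odot>\<^bsub>N\<^esub> y)"
    and balanced_smult: "\<And>k x y. \<lbrakk>k \<in> carrier K; x \<in> carrier M; y \<in> carrier N\<rbrakk>
      \<Longrightarrow> \<phi> ((k \<odot>\<^bsub>R\<^esub> \<one>\<^bsub>R\<^esub>) \<odot>\<^bsub>M\<^esub> x) y = k \<odot>\<^bsub>V\<^esub> \<phi> x y"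
  using assms unfolding balanced_def by blast+

definition tensor_lift ::
    "('k, 'q) ring_scheme \<Rightarrow> ('k, 'w, 'z) module_scheme \<Rightarrow> ('m \<Rightarrow> 'n \<Rightarrow> 'w) \<Rightarrow> ('m \<times> 'n \<Rightarrow> 'k) set \<Rightarrow> 'w"
  where "tensor_lift K V \<phi> = on_coset (lin_ext K V (\<lambda>p. \<phi> (fst p) (snd p)))"

locale tensor_product = K: cring K + M: left_module "opposite R" M + N: left_module R N
  for K :: "('k, 'q) ring_scheme" and R :: "('k, 'r, 's) module_scheme"
    and M :: "('r, 'm, 'u) module_scheme" and N :: "('r, 'n, 'v) module_scheme" +
  assumes unit_smult_closed: "k \<in> carrier K \<Longrightarrow> k \<odot>\<^bsub>R\<^esub> \<one>\<^bsub>R\<^esub> \<in> carrier R"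
begin

abbreviation "F \<equiv> free_module K (carrier M \<times> carrier N)"
abbreviation "rels \<equiv> tensor_rels K R M N"
abbreviation "T \<equiv> tensor K R M N"
abbreviation t where "t x y \<equiv> basis_elt K (x, y)"

text \<open>
  The generators of \<open>tensor_rels\<close>. With a name of their own, they can be treated by cases without
  unfolding the span.
\<close>

definition gens where "gens =
  {t (x \<oplus>\<^bsub>M\<^esub> x') y \<ominus>\<^bsub>F\<^esub> (t x y \<oplus>\<^bsub>F\<^esub> t x' y) | x x' y.
      x \<in> carrier M \<and> x' \<in> carrier M \<and> y \<in> carrier N} \<union>
  {t x (y \<oplus>\<^bsub>N\<^esub> y') \<ominus>\<^bsub>F\<^esub> (t x y \<oplus>\<^bsub>F\<^esub> t x y') | x y y'.
      x \<in> carrier M \<and> y \<in> carrier N \<and> y' \<in> carrier N} \<union>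
  {t (r \<odot>\<^bsub>M\<^esub> x) y \<ominus>\<^bsub>F\<^esub> t x (r \<odot>\<^bsub>N\<^esub> y) | r x y.
      r \<in> carrier R \<and> x \<in> carrier M \<and> y \<in> carrier N} \<union>
  {t ((k \<odot>\<^bsub>R\<^esub> \<one>\<^bsub>R\<^esub>) \<odot>\<^bsub>M\<^esub> x) y \<ominus>\<^bsub>F\<^esub> (k \<odot>\<^bsub>F\<^esub> t x y) | k x y.
      k \<in> carrier K \<and> x \<in> carrier M \<and> y \<in> carrier N}"

lemma rels_eq: "rels = lin_span K F gens"
  by (simp only: tensor_rels_def gens_def Let_def)

lemma F_module: "left_module K F"
  by (rule K.free_left_module)

sublocale F: left_module K F
  by (rule F_module)

lemma gensE:
  assumes "g \<in> gens"
  obtains (add_l) x x' y where "x \<in> carrier M" "x' \<in> carrier M" "y \<in> carrier N"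
      "g = t (x \<oplus>\<^bsub>M\<^esub> x') y \<ominus>\<^bsub>F\<^esub> (t x y \<oplus>\<^bsub>F\<^esub> t x' y)"
  | (add_r) x y y' where "x \<in> carrier M" "y \<in> carrier N" "y' \<in> carrier N"
      "g = t x (y \<oplus>\<^bsub>N\<^esub> y') \<ominus>\<^bsub>F\<^esub> (t x y \<oplus>\<^bsub>F\<^esub> t x y')"
  | (mid) r x y where "r \<in> carrier R" "x \<in> carrier M" "y \<in> carrier N"
      "g = t (r \<odot>\<^bsub>M\<^esub> x) y \<ominus>\<^bsub>F\<^esub> t x (r \<odot>\<^bsub>N\<^esub> y)"
  | (smult) k x y where "k \<in> carrier K" "x \<in> carrier M" "y \<in> carrier N"
      "g = t ((k \<odot>\<^bsub>R\<^esub> \<one>\<^bsub>R\<^esub>) \<odot>\<^bsub>M\<^esub> x) y \<ominus>\<^bsub>F\<^esub> (k \<odot>\<^bsub>F\<^esub> t x y)"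
  using assms unfolding gens_def Un_iff mem_Collect_eq
proof (elim disjE exE conjE)
qed (rule add_l add_r mid smult; assumption)+

lemma gens_add_l:
  "\<lbrakk>x \<in> carrier M; x' \<in> carrier M; y \<in> carrier N\<rbrakk>
    \<Longrightarrow> t (x \<oplus>\<^bsub>M\<^esub> x') y \<ominus>\<^bsub>F\<^esub> (t x y \<oplus>\<^bsub>F\<^esub> t x' y) \<in> gens"
  unfolding gens_def Un_iff mem_Collect_eq
  by (rule disjI1, rule disjI1, rule disjI1, intro exI, rule conjI, rule refl, intro conjI)

lemma gens_add_r:
  "\<lbrakk>x \<in> carrier M; y \<in> carrier N; y' \<in> carrier N\<rbrakk>
    \<Longrightarrow> t x (y \<oplus>\<^bsub>N\<^esub> y') \<ominus>\<^bsub>F\<^esub> (t x y \<oplus>\<^bsub>F\<^esub> t x y') \<in> gens"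
  unfolding gens_def Un_iff mem_Collect_eq
  by (rule disjI1, rule disjI1, rule disjI2, intro exI, rule conjI, rule refl, intro conjI)

lemma gens_mid:
  "\<lbrakk>r \<in> carrier R; x \<in> carrier M; y \<in> carrier N\<rbrakk>
    \<Longrightarrow> t (r \<odot>\<^bsub>M\<^esub> x) y \<ominus>\<^bsub>F\<^esub> t x (r \<odot>\<^bsub>N\<^esub> y) \<in> gens"
  unfolding gens_def Un_iff mem_Collect_eq
  by (rule disjI1, rule disjI2, intro exI, rule conjI, rule refl, intro conjI)

lemma gens_smult:
  "\<lbrakk>k \<in> carrier K; x \<in> carrier M; y \<in> carrier N\<rbrakk>
    \<Longrightarrow> t ((k \<odot>\<^bsub>R\<^esub> \<one>\<^bsub>R\<^esub>) \<odot>\<^bsub>M\<^esub> x) y \<ominus>\<^bsub>F\<^esub> (k \<odot>\<^bsub>F\<^esub> t x y) \<in> gens"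
  unfolding gens_def Un_iff mem_Collect_eq
  by (rule disjI2, intro exI, rule conjI, rule refl, intro conjI)

lemmas gensI = gens_add_l gens_add_r gens_mid gens_smult

lemma gens_subset: "gens \<subseteq> carrier F"
proof
  fix g assume "g \<in> gens"
  then show "g \<in> carrier F"
    by (cases rule: gensE)
      (simp_all del: copower_simps add: unit_smult_closed)
qed

lemma rels_submodule: "submodule rels K F"
  unfolding rels_eq by (rule F.lin_span_submodule[OF gens_subset])

sublocale Q: quotient K F rels
  by (rule quotientI[OF F_module rels_submodule])

lemma T_eq: "T = quot_module F rels"
  by (simp add: tensor_def)

abbreviation tens where "tens x y \<equiv> rels +>\<^bsub>F\<^esub> t x y"

lemma T_module: "left_module K T"
  unfolding T_eq by (rule Q.left_module_quot)

text \<open>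
  A linear map kills the span of the relations as soon as it kills the generators, and that is what being
  balanced on the basis means.
\<close>

lemma rels_killed:
  assumes V: "left_module K V" and f: "f \<in> lin_maps K F V"
    and bal: "balanced K R M N V (\<lambda>x y. f (t x y))" and s: "s \<in> rels"
  shows "f s = \<zero>\<^bsub>V\<^esub>"
proof -
  interpret f: linear_map K F V f by (rule linear_mapI[OF F_module V f])
  note b = balancedD[OF bal]
  have "rels \<subseteq> {x \<in> carrier F. f x = \<zero>\<^bsub>V\<^esub>}"
    unfolding rels_eq
  proof (rule F.lin_span_least[OF f.kernel_submodule], rule subsetI)
    fix g assume g: "g \<in> gens"
    note simps = f.diff f.add f.smult unit_smult_closed f.N.M.a_minus_eq_zero_iff b(1)
    from g have "f g = \<zero>\<^bsub>V\<^esub>"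
    proof (cases rule: gensE)
      case add_l then show ?thesis by (simp add: simps b(2) del: copower_simps)
    next
      case add_r then show ?thesis by (simp add: simps b(3) del: copower_simps)
    next
      case mid then show ?thesis by (simp add: simps b(4) del: copower_simps)
    next
      case smult then show ?thesis by (simp add: simps b(5) del: copower_simps)
    qed
    with g gens_subset show "g \<in> {x \<in> carrier F. f x = \<zero>\<^bsub>V\<^esub>}" by blast
  qed
  with s show ?thesis by blast
qed

lemma tensor_lift:
  assumes V: "left_module K V" and bal: "balanced K R M N V \<phi>"
  shows tensor_lift_lin: "tensor_lift K V \<phi> \<in> lin_maps K T V"
    and tensor_lift_tens: "\<And>x y. \<lbrakk>x \<in> carrier M; y \<in> carrier N\<rbrakk> \<Longrightarrow> tensor_lift K V \<phi> (tens x y) = \<phi> x y"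
    and tensor_lift_proj: "\<And>s. s \<in> carrier F \<Longrightarrow>
      tensor_lift K V \<phi> (rels +>\<^bsub>F\<^esub> s) = lin_ext K V (\<lambda>p. \<phi> (fst p) (snd p)) s"
proof -
  let ?f = "lin_ext K V (\<lambda>p. \<phi> (fst p) (snd p))"
  have \<phi>: "(\<lambda>p. \<phi> (fst p) (snd p)) \<in> carrier M \<times> carrier N \<rightarrow> carrier V"
    using balanced_closed[OF bal] by auto
  note lin = K.lin_ext_lin[OF V \<phi>]
  have val: "?f (t x y) = \<phi> x y" if "x \<in> carrier M" "y \<in> carrier N" for x y
    using K.lin_ext_basis[OF V \<phi>, of "(x, y)"] that by simp
  have "balanced K R M N V (\<lambda>x y. ?f (t x y))"
    by (rule balancedI; simp add: val unit_smult_closed; intro balancedD[OF bal]; assumption)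
  note kill = rels_killed[OF V lin this]
  show "tensor_lift K V \<phi> \<in> lin_maps K T V"
    unfolding tensor_lift_def T_eq using Q.on_coset_lin[OF V lin kill] .
  show proj: "\<And>s. s \<in> carrier F \<Longrightarrow> tensor_lift K V \<phi> (rels +>\<^bsub>F\<^esub> s) = ?f s"
    unfolding tensor_lift_def using Q.on_coset_proj[OF V lin kill] .
  show "\<And>x y. \<lbrakk>x \<in> carrier M; y \<in> carrier N\<rbrakk> \<Longrightarrow> tensor_lift K V \<phi> (tens x y) = \<phi> x y"
    by (simp add: proj val)
qed

lemma balanced_tens: "balanced K R M N T tens"
proof (rule balancedI)
  have gen: "rels +>\<^bsub>F\<^esub> u = rels +>\<^bsub>F\<^esub> v"
    if "u \<ominus>\<^bsub>F\<^esub> v \<in> gens" "u \<in> carrier F" "v \<in> carrier F" for u v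
  proof -
    have "u \<ominus>\<^bsub>F\<^esub> v \<in> rels" using that F.lin_span_superset[of gens] by (auto simp: rels_eq)
    then show ?thesis using that by (simp only: Q.proj_eq_iff)
  qed
  show "tens x y \<in> carrier T" if "x \<in> carrier M" "y \<in> carrier N" for x y
    using that by (simp add: T_eq Q.carrier_quot)
  show "tens (x \<oplus>\<^bsub>M\<^esub> x') y = tens x y \<oplus>\<^bsub>T\<^esub> tens x' y"
    if "x \<in> carrier M" "x' \<in> carrier M" "y \<in> carrier N" for x x' y
  proof -
    have "tens (x \<oplus>\<^bsub>M\<^esub> x') y = rels +>\<^bsub>F\<^esub> (t x y \<oplus>\<^bsub>F\<^esub> t x' y)"
      using that by (intro gen) (simp_all del: copower_simps add: gensI)
    then show ?thesis using that by (simp add: T_eq Q.add_quot del: copower_simps)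
  qed
  show "tens x (y \<oplus>\<^bsub>N\<^esub> y') = tens x y \<oplus>\<^bsub>T\<^esub> tens x y'"
    if "x \<in> carrier M" "y \<in> carrier N" "y' \<in> carrier N" for x y y'
  proof -
    have "tens x (y \<oplus>\<^bsub>N\<^esub> y') = rels +>\<^bsub>F\<^esub> (t x y \<oplus>\<^bsub>F\<^esub> t x y')"
      using that by (intro gen) (simp_all del: copower_simps add: gensI)
    then show ?thesis using that by (simp add: T_eq Q.add_quot del: copower_simps)
  qed
  show "tens (r \<odot>\<^bsub>M\<^esub> x) y = tens x (r \<odot>\<^bsub>N\<^esub> y)"
    if "r \<in> carrier R" "x \<in> carrier M" "y \<in> carrier N" for r x y
    using that by (intro gen) (simp_all del: copower_simps add: gensI)
  show "tens ((k \<odot>\<^bsub>R\<^esub> \<one>\<^bsub>R\<^esub>) \<odot>\<^bsub>M\<^esub> x) y = k \<odot>\<^bsub>T\<^esub> tens x y"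
    if "k \<in> carrier K" "x \<in> carrier M" "y \<in> carrier N" for k x y
  proof -
    have "tens ((k \<odot>\<^bsub>R\<^esub> \<one>\<^bsub>R\<^esub>) \<odot>\<^bsub>M\<^esub> x) y = rels +>\<^bsub>F\<^esub> (k \<odot>\<^bsub>F\<^esub> t x y)"
      using that by (intro gen) (simp_all del: copower_simps add: unit_smult_closed gensI)
    then show ?thesis using that by (simp add: T_eq Q.smult_quot del: copower_simps)
  qed
qed

lemmas tens_closed [simp] = balanced_closed[OF balanced_tens]
lemmas tens_add_l = balanced_add_l[OF balanced_tens]
lemmas tens_add_r = balanced_add_r[OF balanced_tens]
lemmas tens_mid = balanced_mid[OF balanced_tens]
lemmas tens_smult = balanced_smult[OF balanced_tens]

lemma tensor_eqI:
  assumes V: "left_module K V" and f: "f \<in> lin_maps K T V" and g: "g \<in> lin_maps K T V"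
    and eq: "\<And>x y. \<lbrakk>x \<in> carrier M; y \<in> carrier N\<rbrakk> \<Longrightarrow> f (tens x y) = g (tens x y)"
    and X: "X \<in> carrier T"
  shows "f X = g X"
proof -
  obtain s where s: "s \<in> carrier F" "X = rels +>\<^bsub>F\<^esub> s"
    using X unfolding T_eq by (rule Q.carrier_quotE)
  note pr = Q.proj_lin[folded T_eq]
  have "f (rels +>\<^bsub>F\<^esub> s) = g (rels +>\<^bsub>F\<^esub> s)"
    by (rule K.free_module_eqI[OF lin_maps_compose[OF pr f] lin_maps_compose[OF pr g] V _ s(1)])
      (auto simp: eq)
  then show ?thesis using s by simp
qed

lemma tensor_map:
  assumes tp': "tensor_product K R M N'" and f: "f \<in> lin_maps R N N'"
  shows tensor_map_lin: "tensor_map K R M N' f \<in> lin_maps K T (tensor K R M N')"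
    and tensor_map_tens: "\<And>x y. \<lbrakk>x \<in> carrier M; y \<in> carrier N\<rbrakk> \<Longrightarrow>
      tensor_map K R M N' f (tens x y)
        = tensor_rels K R M N' +>\<^bsub>free_module K (carrier M \<times> carrier N')\<^esub> basis_elt K (x, f y)"
proof -
  interpret T': tensor_product K R M N' by fact
  interpret f: linear_map R N N' f
    by (rule linear_mapI[OF N.left_module_axioms T'.N.left_module_axioms f])
  let ?\<phi> = "\<lambda>x y. T'.tens x (f y)"
  have bal: "balanced K R M N T'.T ?\<phi>"
    by (rule balancedI; (simp only: f.add f.smult)?; rule balancedD[OF T'.balanced_tens]; simp)
  note lift = tensor_lift[OF T'.T_module bal]
  let ?h = "map_prod id f"
  have h: "?h \<in> carrier M \<times> carrier N \<rightarrow> carrier M \<times> carrier N'" by auto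
  have \<phi>: "(\<lambda>p. ?\<phi> (fst p) (snd p)) \<in> carrier M \<times> carrier N \<rightarrow> carrier T'.T" by auto
  have b: "(\<lambda>p. basis_elt K (?h p)) \<in> carrier M \<times> carrier N \<rightarrow> carrier T'.F" by auto
  have push: "tensor_rels K R M N' +>\<^bsub>T'.F\<^esub> push_forward K ?h s = tensor_lift K T'.T ?\<phi> (rels +>\<^bsub>F\<^esub> s)"
    if s: "s \<in> carrier F" for s
  proof -
    have "tensor_rels K R M N' +>\<^bsub>T'.F\<^esub> lin_ext K T'.F (\<lambda>p. basis_elt K (?h p)) s
        = lin_ext K T'.T (\<lambda>p. ?\<phi> (fst p) (snd p)) s"
      by (rule K.free_module_eqI[OF lin_maps_compose[OF K.lin_ext_lin[OF T'.F_module b]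
              T'.Q.proj_lin[folded T'.T_eq]] K.lin_ext_lin[OF T'.T_module \<phi>] T'.T_module _ s])
        (auto simp: K.lin_ext_basis[OF T'.F_module b] K.lin_ext_basis[OF T'.T_module \<phi>])
    then show ?thesis
      by (simp add: K.push_forward_eq_lin_ext[OF s h] lift(3)[OF s])
  qed
  have eq: "tensor_map K R M N' f (rels +>\<^bsub>F\<^esub> s) = tensor_lift K T'.T ?\<phi> (rels +>\<^bsub>F\<^esub> s)"
    if s: "s \<in> carrier F" for s
    unfolding tensor_map_def
    by (subst Q.UN_proj_const[OF s]) (use s in \<open>simp_all add: push\<close>)
  have eq': "tensor_map K R M N' f X = tensor_lift K T'.T ?\<phi> X" if "X \<in> carrier T" for X
    using that eq unfolding T_eq by (metis Q.carrier_quotE)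
  interpret lift: linear_map K T T'.T "tensor_lift K T'.T ?\<phi>"
    by (rule linear_mapI[OF T_module T'.T_module lift(1)])
  interpret T: left_module K T by (rule T_module)
  show "tensor_map K R M N' f \<in> lin_maps K T (tensor K R M N')"
    by (rule lin_mapsI) (simp_all add: eq' lift.add lift.smult)
  show "\<And>x y. \<lbrakk>x \<in> carrier M; y \<in> carrier N\<rbrakk> \<Longrightarrow> tensor_map K R M N' f (tens x y) = T'.tens x (f y)"
    by (simp add: eq lift(2))
qed

end

section \<open>Algebras over a commutative ring\<close>

locale k_algebra = K: cring K + A: ring A + L: left_module K A
  for K :: "('k, 'q) ring_scheme" and A :: "('k, 'a) module" +
  assumes smult_mult_l: "\<lbrakk>k \<in> carrier K; a \<in> carrier A; b \<in> carrier A\<rbrakk>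
      \<Longrightarrow> (k \<odot>\<^bsub>A\<^esub> a) \<otimes>\<^bsub>A\<^esub> b = k \<odot>\<^bsub>A\<^esub> (a \<otimes>\<^bsub>A\<^esub> b)"
    and smult_mult_r: "\<lbrakk>k \<in> carrier K; a \<in> carrier A; b \<in> carrier A\<rbrakk>
      \<Longrightarrow> a \<otimes>\<^bsub>A\<^esub> (k \<odot>\<^bsub>A\<^esub> b) = k \<odot>\<^bsub>A\<^esub> (a \<otimes>\<^bsub>A\<^esub> b)"
begin

lemma mult_left_lin: "a \<in> carrier A \<Longrightarrow> (\<lambda>x. a \<otimes>\<^bsub>A\<^esub> x) \<in> lin_maps K A A"
  by (rule lin_mapsI) (simp_all add: A.r_distr smult_mult_r)

lemma mult_right_lin: "a \<in> carrier A \<Longrightarrow> (\<lambda>x. x \<otimes>\<^bsub>A\<^esub> a) \<in> lin_maps K A A"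
  by (rule lin_mapsI) (simp_all add: A.l_distr smult_mult_l)

lemma ideal_submodule:
  assumes "ideal I A"
  shows "submodule I K A"
proof (rule L.submoduleI)
  interpret ideal I A by fact
  show "I \<subseteq> carrier A" using Icarr by blast
  show "k \<odot>\<^bsub>A\<^esub> x \<in> I" if "k \<in> carrier K" "x \<in> I" for k x
    using I_l_closed[OF that(2), of "k \<odot>\<^bsub>A\<^esub> \<one>\<^bsub>A\<^esub>"] that Icarr by (simp add: smult_mult_l)
qed (use assms in \<open>auto intro: additive_subgroup.a_closed additive_subgroup.zero_closed ideal.axioms(1)\<close>)

end

lemma abelian_group_cong:
  assumes "abelian_group M" "carrier N = carrier M" "add N = add M" "zero N = zero M"
  shows "abelian_group N"
proof -
  interpret abelian_group M by fact
  show ?thesis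
  proof (rule abelian_groupI)
    fix x assume "x \<in> carrier N"
    then show "\<exists>y\<in>carrier N. y \<oplus>\<^bsub>N\<^esub> x = \<zero>\<^bsub>N\<^esub>"
      unfolding assms(2-4) by (intro bexI[of _ "\<ominus>\<^bsub>M\<^esub> x"]) (simp_all add: l_neg)
  qed (simp_all add: assms(2-4) a_ac)
qed

lemma left_module_cong:
  assumes "left_module R M" "carrier N = carrier M" "add N = add M" "zero N = zero M"
    "smult N = smult M"
  shows "left_module R N"
proof -
  interpret left_module R M by fact
  show ?thesis
    by (rule left_moduleI[OF R.ring_axioms abelian_group_cong[OF M.abelian_group_axioms assms(2-4)]])
      (simp_all add: assms(2-5) smult_l_distr smult_r_distr smult_assoc)
qed

subsection \<open>Quotient algebras\<close>

locale quotient_algebra = k_algebra + fixes I assumes ideal: "ideal I A"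
begin

sublocale Q: quotient K A I
  by (rule quotientI[OF L.left_module_axioms ideal_submodule[OF ideal]])

abbreviation "B \<equiv> quot_module A I"

lemma mult_quot:
  "\<lbrakk>x \<in> carrier A; y \<in> carrier A\<rbrakk> \<Longrightarrow> (I +>\<^bsub>A\<^esub> x) \<otimes>\<^bsub>B\<^esub> (I +>\<^bsub>A\<^esub> y) = I +>\<^bsub>A\<^esub> (x \<otimes>\<^bsub>A\<^esub> y)"
  by (simp add: quot_module_def ideal.rcoset_mult_add[OF ideal])

lemma one_quot: "\<one>\<^bsub>B\<^esub> = I +>\<^bsub>A\<^esub> \<one>\<^bsub>A\<^esub>"
  by (simp add: quot_module_def)

lemma quot_k_algebra: "k_algebra K B"
proof -
  interpret B: left_module K B by (rule Q.left_module_quot)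
  have mem: "I +>\<^bsub>A\<^esub> x \<in> carrier B" if "x \<in> carrier A" for x
    using that by (simp add: Q.carrier_quot)
  note simps = mem mult_quot Q.add_quot Q.smult_quot one_quot
  have rep: "\<exists>x\<in>carrier A. X = I +>\<^bsub>A\<^esub> x" if "X \<in> carrier B" for X
    using that by (auto simp: Q.carrier_quot)
  have mon: "monoid B"
  proof (rule monoidI)
    fix X Y assume "X \<in> carrier B" "Y \<in> carrier B"
    then obtain x y where xy: "x \<in> carrier A" "X = I +>\<^bsub>A\<^esub> x" "y \<in> carrier A" "Y = I +>\<^bsub>A\<^esub> y"
      using rep by meson
    then show "X \<otimes>\<^bsub>B\<^esub> Y \<in> carrier B" by (simp add: simps)
    fix Z assume "Z \<in> carrier B"
    then obtain z where "z \<in> carrier A" "Z = I +>\<^bsub>A\<^esub> z" using rep by meson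
    then show "X \<otimes>\<^bsub>B\<^esub> Y \<otimes>\<^bsub>B\<^esub> Z = X \<otimes>\<^bsub>B\<^esub> (Y \<otimes>\<^bsub>B\<^esub> Z)"
      using xy by (simp add: simps A.m_assoc)
  next
    fix X assume "X \<in> carrier B"
    then obtain x where "x \<in> carrier A" "X = I +>\<^bsub>A\<^esub> x" using rep by meson
    then show "\<one>\<^bsub>B\<^esub> \<otimes>\<^bsub>B\<^esub> X = X" "X \<otimes>\<^bsub>B\<^esub> \<one>\<^bsub>B\<^esub> = X" by (simp_all add: simps)
  qed (simp add: simps)
  have "ring B"
  proof (rule ringI[OF B.M.abelian_group_axioms mon])
    fix X Y Z assume "X \<in> carrier B" "Y \<in> carrier B" "Z \<in> carrier B"
    then obtain x y z where "x \<in> carrier A" "X = I +>\<^bsub>A\<^esub> x" "y \<in> carrier A" "Y = I +>\<^bsub>A\<^esub> y"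
      "z \<in> carrier A" "Z = I +>\<^bsub>A\<^esub> z"
      using rep by meson
    then show "(X \<oplus>\<^bsub>B\<^esub> Y) \<otimes>\<^bsub>B\<^esub> Z = X \<otimes>\<^bsub>B\<^esub> Z \<oplus>\<^bsub>B\<^esub> Y \<otimes>\<^bsub>B\<^esub> Z"
      "Z \<otimes>\<^bsub>B\<^esub> (X \<oplus>\<^bsub>B\<^esub> Y) = Z \<otimes>\<^bsub>B\<^esub> X \<oplus>\<^bsub>B\<^esub> Z \<otimes>\<^bsub>B\<^esub> Y"
      by (simp_all add: simps A.l_distr A.r_distr)
  qed
  moreover have "k_algebra_axioms K B"
  proof
    fix k X Y assume k: "k \<in> carrier K" and "X \<in> carrier B" "Y \<in> carrier B"
    then obtain x y where "x \<in> carrier A" "X = I +>\<^bsub>A\<^esub> x" "y \<in> carrier A" "Y = I +>\<^bsub>A\<^esub> y"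
      using rep by meson
    then show "(k \<odot>\<^bsub>B\<^esub> X) \<otimes>\<^bsub>B\<^esub> Y = k \<odot>\<^bsub>B\<^esub> (X \<otimes>\<^bsub>B\<^esub> Y)"
      "X \<otimes>\<^bsub>B\<^esub> (k \<odot>\<^bsub>B\<^esub> Y) = k \<odot>\<^bsub>B\<^esub> (X \<otimes>\<^bsub>B\<^esub> Y)"
      using k by (simp_all add: simps smult_mult_l smult_mult_r)
  qed
  ultimately show ?thesis
    by (intro k_algebra.intro K.cring_axioms B.left_module_axioms)
qed

end

subsection \<open>Monoid algebras\<close>

locale monoid_alg = K: cring K + G: monoid G
  for K :: "('k, 'q) ring_scheme" and G :: "('g, 'h) monoid_scheme"
begin

abbreviation "F \<equiv> free_module K (carrier G)"
abbreviation "MA \<equiv> monoid_algebra K G"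

lemma MA_simps [simp]:
  "carrier MA = carrier F" "add MA = add F" "zero MA = zero F" "smult MA = smult F"
  "\<one>\<^bsub>MA\<^esub> = basis_elt K \<one>\<^bsub>G\<^esub>"
  by (simp_all add: monoid_algebra_def)

sublocale F: left_module K F
  by (rule K.free_left_module)

lemma MA_module: "left_module K MA"
  by (rule left_module_cong[OF F.left_module_axioms]) simp_all

lemma mult_eq:
  assumes f: "f \<in> carrier F" and g: "g \<in> carrier F"
    and S: "finite S" "{x. f x \<noteq> \<zero>\<^bsub>K\<^esub>} \<subseteq> S" and T: "finite T" "{x. g x \<noteq> \<zero>\<^bsub>K\<^esub>} \<subseteq> T"
  shows "(f \<otimes>\<^bsub>MA\<^esub> g) x
    = (\<Oplus>\<^bsub>K\<^esub>p\<in>{p \<in> S \<times> T. fst p \<otimes>\<^bsub>G\<^esub> snd p = x}. f (fst p) \<otimes>\<^bsub>K\<^esub> g (snd p))"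
proof -
  have "(\<Oplus>\<^bsub>K\<^esub>p\<in>{(u, v). f u \<noteq> \<zero>\<^bsub>K\<^esub> \<and> g v \<noteq> \<zero>\<^bsub>K\<^esub> \<and> u \<otimes>\<^bsub>G\<^esub> v = x}. f (fst p) \<otimes>\<^bsub>K\<^esub> g (snd p))
    = (\<Oplus>\<^bsub>K\<^esub>p\<in>{p \<in> S \<times> T. fst p \<otimes>\<^bsub>G\<^esub> snd p = x}. f (fst p) \<otimes>\<^bsub>K\<^esub> g (snd p))"
  proof (rule K.add.finprod_mono_neutral_cong_left)
    fix p assume "p \<in> {p \<in> S \<times> T. fst p \<otimes>\<^bsub>G\<^esub> snd p = x}
      - {(u, v). f u \<noteq> \<zero>\<^bsub>K\<^esub> \<and> g v \<noteq> \<zero>\<^bsub>K\<^esub> \<and> u \<otimes>\<^bsub>G\<^esub> v = x}"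
    then have "f (fst p) = \<zero>\<^bsub>K\<^esub> \<or> g (snd p) = \<zero>\<^bsub>K\<^esub>" by auto
    then show "f (fst p) \<otimes>\<^bsub>K\<^esub> g (snd p) = \<zero>\<^bsub>K\<^esub>"
      using K.free_memD(1)[OF f] K.free_memD(1)[OF g] by auto
  qed (use S T K.free_memD(1)[OF f] K.free_memD(1)[OF g] in auto)
  then show ?thesis by (simp add: monoid_algebra_def)
qed

lemma mult_closed:
  assumes f: "f \<in> carrier F" and g: "g \<in> carrier F"
  shows "f \<otimes>\<^bsub>MA\<^esub> g \<in> carrier F"
proof -
  let ?S = "{x. f x \<noteq> \<zero>\<^bsub>K\<^esub>}" and ?T = "{x. g x \<noteq> \<zero>\<^bsub>K\<^esub>}"
  note fD = K.free_memD[OF f] and gD = K.free_memD[OF g]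
  note eq = mult_eq[OF f g fD(2) order.refl gD(2) order.refl]
  let ?U = "(\<lambda>p. fst p \<otimes>\<^bsub>G\<^esub> snd p) ` (?S \<times> ?T)"
  have "?S \<subseteq> carrier G" "?T \<subseteq> carrier G" using fD(3) gD(3) by auto
  then have U: "?U \<subseteq> carrier G" by (auto simp: subset_iff)
  have "(f \<otimes>\<^bsub>MA\<^esub> g) x = \<zero>\<^bsub>K\<^esub>" if "x \<notin> ?U" for x
  proof -
    have *: "{p \<in> ?S \<times> ?T. fst p \<otimes>\<^bsub>G\<^esub> snd p = x} = {}"
      using that unfolding image_def by blast
    show ?thesis unfolding eq * by simp
  qed
  then show ?thesis
    using U fD gD by (intro K.free_memI[of _ ?U]) (auto simp: eq intro!: K.finsum_closed)
qed

lemma mult_right_lin: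
  assumes g: "g \<in> carrier F"
  shows "(\<lambda>f. f \<otimes>\<^bsub>MA\<^esub> g) \<in> lin_maps K F F"
proof (rule lin_mapsI)
  note gD = K.free_memD[OF g]
  let ?T = "{x. g x \<noteq> \<zero>\<^bsub>K\<^esub>}"
  fix f assume f: "f \<in> carrier F"
  note fD = K.free_memD[OF f]
  let ?S = "{x. f x \<noteq> \<zero>\<^bsub>K\<^esub>}"
  show "f \<otimes>\<^bsub>MA\<^esub> g \<in> carrier F" by (rule mult_closed[OF f g])
  show "(r \<odot>\<^bsub>F\<^esub> f) \<otimes>\<^bsub>MA\<^esub> g = r \<odot>\<^bsub>F\<^esub> (f \<otimes>\<^bsub>MA\<^esub> g)" if r: "r \<in> carrier K" for r
  proof
    fix x
    let ?P = "{p \<in> ?S \<times> ?T. fst p \<otimes>\<^bsub>G\<^esub> snd p = x}"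
    have "((r \<odot>\<^bsub>F\<^esub> f) \<otimes>\<^bsub>MA\<^esub> g) x = (\<Oplus>\<^bsub>K\<^esub>p\<in>?P. (r \<odot>\<^bsub>F\<^esub> f) (fst p) \<otimes>\<^bsub>K\<^esub> g (snd p))"
      by (rule mult_eq[OF F.smult_closed[OF r f] g fD(2) _ gD(2) order.refl]) (use r in auto)
    also have "\<dots> = (\<Oplus>\<^bsub>K\<^esub>p\<in>?P. r \<otimes>\<^bsub>K\<^esub> (f (fst p) \<otimes>\<^bsub>K\<^esub> g (snd p)))"
      using r fD gD by (intro K.finsum_cong') (auto simp: K.m_assoc)
    also have "\<dots> = r \<otimes>\<^bsub>K\<^esub> (\<Oplus>\<^bsub>K\<^esub>p\<in>?P. f (fst p) \<otimes>\<^bsub>K\<^esub> g (snd p))"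
      using r fD gD by (intro K.finsum_rdistr[symmetric]) auto
    also have "\<dots> = (r \<odot>\<^bsub>F\<^esub> (f \<otimes>\<^bsub>MA\<^esub> g)) x"
      using mult_eq[OF f g fD(2) order.refl gD(2) order.refl, of x] by simp
    finally show "((r \<odot>\<^bsub>F\<^esub> f) \<otimes>\<^bsub>MA\<^esub> g) x = (r \<odot>\<^bsub>F\<^esub> (f \<otimes>\<^bsub>MA\<^esub> g)) x" .
  qed
  fix h assume h: "h \<in> carrier F"
  note hD = K.free_memD[OF h]
  let ?U = "?S \<union> {x. h x \<noteq> \<zero>\<^bsub>K\<^esub>}"
  have U: "finite ?U" "?S \<subseteq> ?U" "{x. h x \<noteq> \<zero>\<^bsub>K\<^esub>} \<subseteq> ?U" using fD hD by auto
  show "(f \<oplus>\<^bsub>F\<^esub> h) \<otimes>\<^bsub>MA\<^esub> g = f \<otimes>\<^bsub>MA\<^esub> g \<oplus>\<^bsub>F\<^esub> h \<otimes>\<^bsub>MA\<^esub> g"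
  proof
    fix x
    let ?P = "{p \<in> ?U \<times> ?T. fst p \<otimes>\<^bsub>G\<^esub> snd p = x}"
    have "((f \<oplus>\<^bsub>F\<^esub> h) \<otimes>\<^bsub>MA\<^esub> g) x = (\<Oplus>\<^bsub>K\<^esub>p\<in>?P. (f \<oplus>\<^bsub>F\<^esub> h) (fst p) \<otimes>\<^bsub>K\<^esub> g (snd p))"
      by (rule mult_eq[OF F.M.a_closed[OF f h] g U(1) _ gD(2) order.refl]) auto
    also have "\<dots> = (\<Oplus>\<^bsub>K\<^esub>p\<in>?P. f (fst p) \<otimes>\<^bsub>K\<^esub> g (snd p) \<oplus>\<^bsub>K\<^esub> h (fst p) \<otimes>\<^bsub>K\<^esub> g (snd p))"
      using fD gD hD by (intro K.finsum_cong') (auto simp: K.l_distr)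
    also have "\<dots> = (\<Oplus>\<^bsub>K\<^esub>p\<in>?P. f (fst p) \<otimes>\<^bsub>K\<^esub> g (snd p)) \<oplus>\<^bsub>K\<^esub> (\<Oplus>\<^bsub>K\<^esub>p\<in>?P. h (fst p) \<otimes>\<^bsub>K\<^esub> g (snd p))"
      using fD gD hD by (intro K.finsum_addf) auto
    also have "\<dots> = (f \<otimes>\<^bsub>MA\<^esub> g \<oplus>\<^bsub>F\<^esub> h \<otimes>\<^bsub>MA\<^esub> g) x"
      using mult_eq[OF f g U(1,2) gD(2) order.refl, of x] mult_eq[OF h g U(1,3) gD(2) order.refl, of x]
      by simp
    finally show "((f \<oplus>\<^bsub>F\<^esub> h) \<otimes>\<^bsub>MA\<^esub> g) x = (f \<otimes>\<^bsub>MA\<^esub> g \<oplus>\<^bsub>F\<^esub> h \<otimes>\<^bsub>MA\<^esub> g) x" .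
  qed
qed

text \<open>The factors are exchanged by passing to the opposite monoid.\<close>

lemma mult_left_lin:
  assumes f: "f \<in> carrier F"
  shows "(\<lambda>g. f \<otimes>\<^bsub>MA\<^esub> g) \<in> lin_maps K F F"
proof -
  let ?G = "G\<lparr>mult := \<lambda>x y. y \<otimes>\<^bsub>G\<^esub> x\<rparr>"
  have "monoid ?G"
    by (rule monoidI) (simp_all add: G.m_assoc)
  then interpret O: monoid_alg K ?G
    by (intro monoid_alg.intro K.cring_axioms)
  have swap: "f \<otimes>\<^bsub>MA\<^esub> g = g \<otimes>\<^bsub>O.MA\<^esub> f" if g: "g \<in> carrier F" for g
  proof
    fix x
    let ?P = "{(v, u). g v \<noteq> \<zero>\<^bsub>K\<^esub> \<and> f u \<noteq> \<zero>\<^bsub>K\<^esub> \<and> v \<otimes>\<^bsub>?G\<^esub> u = x}"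
    let ?Q = "{(u, v). f u \<noteq> \<zero>\<^bsub>K\<^esub> \<and> g v \<noteq> \<zero>\<^bsub>K\<^esub> \<and> u \<otimes>\<^bsub>G\<^esub> v = x}"
    have "?Q = prod.swap ` ?P" by force
    then have "(\<Oplus>\<^bsub>K\<^esub>p\<in>?Q. f (fst p) \<otimes>\<^bsub>K\<^esub> g (snd p))
        = (\<Oplus>\<^bsub>K\<^esub>p\<in>prod.swap ` ?P. f (fst p) \<otimes>\<^bsub>K\<^esub> g (snd p))" by simp
    also have "\<dots> = (\<Oplus>\<^bsub>K\<^esub>p\<in>?P. f (fst (prod.swap p)) \<otimes>\<^bsub>K\<^esub> g (snd (prod.swap p)))"
      using K.free_memD(1)[OF f] K.free_memD(1)[OF g] by (intro K.finsum_reindex) auto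
    also have "\<dots> = (\<Oplus>\<^bsub>K\<^esub>p\<in>?P. g (fst p) \<otimes>\<^bsub>K\<^esub> f (snd p))"
      using K.free_memD(1)[OF f] K.free_memD(1)[OF g] by (intro K.finsum_cong') (auto simp: K.m_comm)
    finally show "(f \<otimes>\<^bsub>MA\<^esub> g) x = (g \<otimes>\<^bsub>O.MA\<^esub> f) x"
      by (simp add: monoid_algebra_def)
  qed
  have "(\<lambda>g. g \<otimes>\<^bsub>O.MA\<^esub> f) \<in> lin_maps K F F"
    using O.mult_right_lin[of f] f by simp
  from lin_mapsD[OF this] show ?thesis
    by (intro lin_mapsI)
      (simp_all only: swap mult_closed[OF f] F.M.a_closed F.smult_closed)
qed

lemma mult_basis:
  assumes "u \<in> carrier G" "v \<in> carrier G"
  shows "basis_elt K u \<otimes>\<^bsub>MA\<^esub> basis_elt K v = basis_elt K (u \<otimes>\<^bsub>G\<^esub> v)"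
proof
  fix x
  have *: "{p \<in> {u} \<times> {v}. fst p \<otimes>\<^bsub>G\<^esub> snd p = x} = (if u \<otimes>\<^bsub>G\<^esub> v = x then {(u, v)} else {})"
    by auto
  have "(basis_elt K u \<otimes>\<^bsub>MA\<^esub> basis_elt K v) x = (\<Oplus>\<^bsub>K\<^esub>p\<in>{p \<in> {u} \<times> {v}. fst p \<otimes>\<^bsub>G\<^esub> snd p = x}.
      basis_elt K u (fst p) \<otimes>\<^bsub>K\<^esub> basis_elt K v (snd p))"
    using assms by (intro mult_eq) (auto simp: basis_elt_def[of K u] basis_elt_def[of K v] K.basis_closed[unfolded basis_elt_def])
  also have "\<dots> = basis_elt K (u \<otimes>\<^bsub>G\<^esub> v) x"
    unfolding * by (simp add: basis_elt_def)
  finally show "(basis_elt K u \<otimes>\<^bsub>MA\<^esub> basis_elt K v) x = basis_elt K (u \<otimes>\<^bsub>G\<^esub> v) x" .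
qed

lemma MA_k_algebra: "k_algebra K MA"
proof -
  have FM: "left_module K F" by (rule F.left_module_axioms)
  note bas = K.basis_closed
  have comp: "(\<lambda>x. f (g x)) \<in> lin_maps K F F" if "g \<in> lin_maps K F F" "f \<in> lin_maps K F F" for f g
    using lin_maps_compose[OF that] .
  \<comment> \<open>Associativity holds on the basis and extends to one factor at a time.\<close>
  have assoc1: "(basis_elt K u \<otimes>\<^bsub>MA\<^esub> basis_elt K v) \<otimes>\<^bsub>MA\<^esub> h = basis_elt K u \<otimes>\<^bsub>MA\<^esub> (basis_elt K v \<otimes>\<^bsub>MA\<^esub> h)"
    if uv: "u \<in> carrier G" "v \<in> carrier G" and h: "h \<in> carrier F" for u v h
    by (rule K.free_module_eqI[OF mult_left_lin comp[OF mult_left_lin mult_left_lin] FM _ h])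
      (use uv in \<open>simp_all add: mult_basis G.m_assoc mult_closed\<close>)
  have assoc2: "(basis_elt K u \<otimes>\<^bsub>MA\<^esub> g) \<otimes>\<^bsub>MA\<^esub> h = basis_elt K u \<otimes>\<^bsub>MA\<^esub> (g \<otimes>\<^bsub>MA\<^esub> h)"
    if u: "u \<in> carrier G" and g: "g \<in> carrier F" and h: "h \<in> carrier F" for u g h
    by (rule K.free_module_eqI[OF comp[OF mult_left_lin mult_right_lin]
          comp[OF mult_right_lin mult_left_lin] FM _ g])
      (use u h in \<open>simp_all add: assoc1\<close>)
  have assoc: "(f \<otimes>\<^bsub>MA\<^esub> g) \<otimes>\<^bsub>MA\<^esub> h = f \<otimes>\<^bsub>MA\<^esub> (g \<otimes>\<^bsub>MA\<^esub> h)"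
    if f: "f \<in> carrier F" and g: "g \<in> carrier F" and h: "h \<in> carrier F" for f g h
    by (rule K.free_module_eqI[OF comp[OF mult_right_lin mult_right_lin] mult_right_lin FM _ f])
      (use g h in \<open>simp_all add: assoc2 mult_closed\<close>)
  have id: "(\<lambda>x. x) \<in> lin_maps K F F" by (rule lin_mapsI) auto
  have one_l: "\<one>\<^bsub>MA\<^esub> \<otimes>\<^bsub>MA\<^esub> f = f" if f: "f \<in> carrier F" for f
    by (rule K.free_module_eqI[OF mult_left_lin id FM _ f]) (simp_all add: mult_basis)
  have one_r: "f \<otimes>\<^bsub>MA\<^esub> \<one>\<^bsub>MA\<^esub> = f" if f: "f \<in> carrier F" for f
    by (rule K.free_module_eqI[OF mult_right_lin id FM _ f]) (simp_all add: mult_basis)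
  interpret M: left_module K MA by (rule MA_module)
  have "monoid MA"
    by (rule monoidI) (simp_all only: MA_simps(1) mult_closed assoc one_l one_r, simp)
  then have "ring MA"
    using lin_maps_add[OF mult_left_lin] lin_maps_add[OF mult_right_lin]
    by (intro ringI[OF M.M.abelian_group_axioms]) (simp_all only: MA_simps)
  moreover have "k_algebra_axioms K MA"
    using lin_maps_smult[OF mult_left_lin] lin_maps_smult[OF mult_right_lin]
    by (intro k_algebra_axioms.intro) (simp_all only: MA_simps)
  ultimately show ?thesis
    by (intro k_algebra.intro K.cring_axioms M.left_module_axioms)
qed

end

section \<open>The enveloping algebra\<close>

lemma (in tensor_product) tensor_span:
  assumes H: "submodule H K T" and tens: "\<And>x y. \<lbrakk>x \<in> carrier M; y \<in> carrier N\<rbrakk> \<Longrightarrow> tens x y \<in> H"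
  shows "carrier T \<subseteq> H"
proof
  interpret T: left_module K T by (rule T_module)
  interpret pr: linear_map K F T "\<lambda>s. rels +>\<^bsub>F\<^esub> s"
    by (rule linear_mapI[OF F_module T_module Q.proj_lin[folded T_eq]])
  fix X assume "X \<in> carrier T"
  then obtain s where s: "s \<in> carrier F" "X = rels +>\<^bsub>F\<^esub> s"
    unfolding T_eq by (rule Q.carrier_quotE)
  from s(1) have "rels +>\<^bsub>F\<^esub> s \<in> H"
  proof (induction rule: K.free_module_induct)
    case zero then show ?case using pr.zero T.submodule_zero[OF H] by simp
  next
    case (add s t) then show ?case
      using pr.add[of s t] T.submodule_add[OF H] by simp
  next
    case (basis k p) then show ?case
      using pr.smult[of k "basis_elt K p"] T.submodule_smult[OF H] tens by auto
  qed
  with s show "X \<in> H" by simp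
qed

lemma smult_opposite [simp]: "smult (opposite A) = smult A"
  for A :: "('k, 'a) module"
  by (simp add: opposite_def)

text \<open>
  A module over a commutative ring is also one over \<open>regular K\<close> and over the opposite of \<open>regular K\<close>; in
  this way both factors of \<open>A \<otimes> A\<^sup>o\<^sup>p\<close> are modules over the ring that the tensor product is taken over.
\<close>

lemma (in cring) left_module_cong_ring:
  assumes "left_module R M" "carrier S = carrier R" "add S = add R" "zero S = zero R" "one S = one R"
    and mult: "\<And>x y. \<lbrakk>x \<in> carrier R; y \<in> carrier R\<rbrakk> \<Longrightarrow> x \<otimes>\<^bsub>S\<^esub> y = x \<otimes> y"
  shows "left_module S M"
proof -
  interpret M: left_module R M by fact
  have "abelian_group S"
    by (rule abelian_group_cong[OF abelian_group_axioms assms(2-4)])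
  moreover have "monoid S"
    by (rule monoidI) (simp_all add: assms(2-5) mult m_assoc)
  ultimately have "ring S"
    by (rule ringI) (simp_all add: assms(2-5) mult l_distr r_distr)
  then show ?thesis
    by (rule left_moduleI[OF _ M.M.abelian_group_axioms])
      (simp_all add: assms(2-5) mult M.smult_l_distr M.smult_r_distr M.smult_assoc)
qed

locale enveloping_algebra = k_algebra K A
  for K :: "('k, 'q) ring_scheme" and A :: "('k, 'a) module"
begin

abbreviation "E \<equiv> enveloping K A"
abbreviation "F \<equiv> free_module K (carrier A \<times> carrier A)"
abbreviation "rels \<equiv> tensor_rels K (regular K) A (opposite A)"
abbreviation "AA \<equiv> monoid_algebra K (A \<times>\<times> opposite A)"

lemma opposite_module: "left_module K (opposite A)"
  by (rule left_module_cong[OF L.left_module_axioms]) simp_all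

sublocale T: tensor_product K "regular K" A "opposite A"
proof -
  have "left_module (opposite (regular K)) A"
    by (rule K.left_module_cong_ring[OF L.left_module_axioms]) (simp_all add: K.m_comm)
  moreover have "left_module (regular K) (opposite A)"
    by (rule K.left_module_cong_ring[OF opposite_module]) simp_all
  ultimately show "tensor_product K (regular K) A (opposite A)"
    by (intro tensor_product.intro tensor_product_axioms.intro K.cring_axioms) simp_all
qed

sublocale P: monoid_alg K "A \<times>\<times> opposite A"
proof -
  have "monoid (opposite A)" by (rule monoidI) (simp_all add: A.m_assoc)
  then show "monoid_alg K (A \<times>\<times> opposite A)"
    by (intro monoid_alg.intro K.cring_axioms DirProd_monoid A.monoid_axioms)
qed

definition \<tau> :: "'a \<Rightarrow> 'a \<Rightarrow> ('a \<times> 'a \<Rightarrow> 'k) set"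
  where "\<tau> a b = rels +>\<^bsub>F\<^esub> basis_elt K (a, b)"

lemma tens_eq_\<tau>: "T.tens a b = \<tau> a b"
  by (simp add: \<tau>_def)

lemma \<tau>_bilinear:
  shows "\<lbrakk>a \<in> carrier A; b \<in> carrier A\<rbrakk> \<Longrightarrow> \<tau> a b \<in> carrier T.T"
    and "\<lbrakk>a \<in> carrier A; a' \<in> carrier A; b \<in> carrier A\<rbrakk>
      \<Longrightarrow> \<tau> (a \<oplus>\<^bsub>A\<^esub> a') b = \<tau> a b \<oplus>\<^bsub>T.T\<^esub> \<tau> a' b"
    and "\<lbrakk>a \<in> carrier A; b \<in> carrier A; b' \<in> carrier A\<rbrakk>
      \<Longrightarrow> \<tau> a (b \<oplus>\<^bsub>A\<^esub> b') = \<tau> a b \<oplus>\<^bsub>T.T\<^esub> \<tau> a b'"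
    and "\<lbrakk>k \<in> carrier K; a \<in> carrier A; b \<in> carrier A\<rbrakk>
      \<Longrightarrow> \<tau> (k \<odot>\<^bsub>A\<^esub> a) b = k \<odot>\<^bsub>T.T\<^esub> \<tau> a b"
    and "\<lbrakk>k \<in> carrier K; a \<in> carrier A; b \<in> carrier A\<rbrakk>
      \<Longrightarrow> \<tau> a (k \<odot>\<^bsub>A\<^esub> b) = k \<odot>\<^bsub>T.T\<^esub> \<tau> a b"
  using T.tens_closed[of a b] T.tens_add_l[of a a' b] T.tens_add_r[of a b b'] T.tens_smult[of k a b]
    T.tens_mid[of k a b]
  unfolding tens_eq_\<tau> by simp_all

lemma bilinear_balanced:
  assumes "\<And>a b. \<lbrakk>a \<in> carrier A; b \<in> carrier A\<rbrakk> \<Longrightarrow> \<phi> a b \<in> carrier V"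
    and "\<And>a a' b. \<lbrakk>a \<in> carrier A; a' \<in> carrier A; b \<in> carrier A\<rbrakk>
      \<Longrightarrow> \<phi> (a \<oplus>\<^bsub>A\<^esub> a') b = \<phi> a b \<oplus>\<^bsub>V\<^esub> \<phi> a' b"
    and "\<And>a b b'. \<lbrakk>a \<in> carrier A; b \<in> carrier A; b' \<in> carrier A\<rbrakk>
      \<Longrightarrow> \<phi> a (b \<oplus>\<^bsub>A\<^esub> b') = \<phi> a b \<oplus>\<^bsub>V\<^esub> \<phi> a b'"
    and "\<And>k a b. \<lbrakk>k \<in> carrier K; a \<in> carrier A; b \<in> carrier A\<rbrakk>
      \<Longrightarrow> \<phi> (k \<odot>\<^bsub>A\<^esub> a) b = k \<odot>\<^bsub>V\<^esub> \<phi> a b"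
    and "\<And>k a b. \<lbrakk>k \<in> carrier K; a \<in> carrier A; b \<in> carrier A\<rbrakk>
      \<Longrightarrow> \<phi> a (k \<odot>\<^bsub>A\<^esub> b) = k \<odot>\<^bsub>V\<^esub> \<phi> a b"
  shows "balanced K (regular K) A (opposite A) V \<phi>"
  by (rule balancedI) (simp_all add: assms)

text \<open>
  Left or right multiplication by a pair carries the tensor relations to tensor relations, because
  \<open>x \<otimes> y \<mapsto> u x \<otimes> y v\<close> and \<open>x \<otimes> y \<mapsto> x u \<otimes> v y\<close> are balanced.
\<close>

lemma rels_ideal: "ideal rels AA"
proof -
  interpret AA: k_algebra K AA by (rule P.MA_k_algebra)
  interpret TT: left_module K T.T by (rule T.T_module)
  note sub = T.rels_submodule
  have pr: "(\<lambda>s. T.Q.proj s) \<in> lin_maps K F T.T"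
    using T.Q.proj_lin[folded T.T_eq] by simp
  have relF: "s \<in> carrier F" if "s \<in> rels" for s
    using that T.F.submodule_subset[OF sub] by auto
  have rels_iff: "s \<in> rels \<longleftrightarrow> T.Q.proj s = \<zero>\<^bsub>T.T\<^esub>" if "s \<in> carrier F" for s
    using that T.Q.proj_eq_I_iff[of s] T.Q.zero_quot by (simp add: T.T_eq)
  have ml: "(\<lambda>s. r \<otimes>\<^bsub>AA\<^esub> s) \<in> lin_maps K F F" and mr: "(\<lambda>s. s \<otimes>\<^bsub>AA\<^esub> r) \<in> lin_maps K F F"
    if "r \<in> carrier F" for r
    using P.mult_left_lin[of r] P.mult_right_lin[of r] that by simp_all
  have zero: "(\<lambda>_. \<zero>\<^bsub>T.T\<^esub>) \<in> lin_maps K F T.T" by (rule lin_mapsI) simp_all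
  have mb: "basis_elt K (u, v) \<otimes>\<^bsub>AA\<^esub> basis_elt K (x, y) = basis_elt K (u \<otimes>\<^bsub>A\<^esub> x, y \<otimes>\<^bsub>A\<^esub> v)"
    if "u \<in> carrier A" "v \<in> carrier A" "x \<in> carrier A" "y \<in> carrier A" for u v x y
    using that P.mult_basis[of "(u, v)" "(x, y)"] by simp
  have pair: "T.Q.proj (basis_elt K (u, v) \<otimes>\<^bsub>AA\<^esub> s) = \<zero>\<^bsub>T.T\<^esub>"
      "T.Q.proj (s \<otimes>\<^bsub>AA\<^esub> basis_elt K (u, v)) = \<zero>\<^bsub>T.T\<^esub>"
    if s: "s \<in> rels" and uv: "u \<in> carrier A" "v \<in> carrier A" for u v s
  proof -
    have b: "basis_elt K (u, v) \<in> carrier F" using uv by (intro K.basis_closed) simp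
    have "balanced K (regular K) A (opposite A) T.T (\<lambda>x y. T.Q.proj (basis_elt K (u, v) \<otimes>\<^bsub>AA\<^esub> T.t x y))"
      by (rule bilinear_balanced)
        (simp_all add: mb uv A.l_distr A.r_distr smult_mult_l smult_mult_r \<tau>_bilinear flip: \<tau>_def)
    then show "T.Q.proj (basis_elt K (u, v) \<otimes>\<^bsub>AA\<^esub> s) = \<zero>\<^bsub>T.T\<^esub>"
      using T.rels_killed[OF T.T_module _ _ s] lin_maps_compose[OF ml[OF b] pr] by simp
    have "balanced K (regular K) A (opposite A) T.T (\<lambda>x y. T.Q.proj (T.t x y \<otimes>\<^bsub>AA\<^esub> basis_elt K (u, v)))"
      by (rule bilinear_balanced)
        (simp_all add: mb uv A.l_distr A.r_distr smult_mult_l smult_mult_r \<tau>_bilinear flip: \<tau>_def)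
    then show "T.Q.proj (s \<otimes>\<^bsub>AA\<^esub> basis_elt K (u, v)) = \<zero>\<^bsub>T.T\<^esub>"
      using T.rels_killed[OF T.T_module _ _ s] lin_maps_compose[OF mr[OF b] pr] by simp
  qed
  have prod: "r \<otimes>\<^bsub>AA\<^esub> s \<in> rels" "s \<otimes>\<^bsub>AA\<^esub> r \<in> rels" if s: "s \<in> rels" and r: "r \<in> carrier F" for r s
  proof -
    have "T.Q.proj (r \<otimes>\<^bsub>AA\<^esub> s) = \<zero>\<^bsub>T.T\<^esub>"
      by (rule K.free_module_eqI[OF lin_maps_compose[OF mr[OF relF[OF s]] pr] zero T.T_module _ r])
        (use pair s in auto)
    then show "r \<otimes>\<^bsub>AA\<^esub> s \<in> rels"
      using rels_iff lin_maps_closed[OF ml[OF r] relF[OF s]] by simp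
    have "T.Q.proj (s \<otimes>\<^bsub>AA\<^esub> r) = \<zero>\<^bsub>T.T\<^esub>"
      by (rule K.free_module_eqI[OF lin_maps_compose[OF ml[OF relF[OF s]] pr] zero T.T_module _ r])
        (use pair s in auto)
    then show "s \<otimes>\<^bsub>AA\<^esub> r \<in> rels"
      using rels_iff lin_maps_closed[OF mr[OF r] relF[OF s]] by simp
  qed
  show ?thesis
  proof (rule idealI[OF AA.A.ring_axioms])
    have "subgroup rels (add_monoid T.F)" using sub by (rule submodule.axioms(1))
    then show "subgroup rels (add_monoid AA)" by simp
  qed (use prod in simp_all)
qed

sublocale EQ: quotient_algebra K AA rels
  by (intro quotient_algebra.intro P.MA_k_algebra quotient_algebra_axioms.intro rels_ideal)

lemma E_eq: "E = quot_module AA rels"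
  by (simp add: enveloping_def tensor_algebra_def)

lemma coset_AA: "rels +>\<^bsub>AA\<^esub> s = T.Q.proj s"
  by (simp add: a_r_coset_def r_coset_def)

lemma T_simps [simp]:
  "carrier T.T = carrier E" "add T.T = add E" "zero T.T = zero E" "smult T.T = smult E"
  by (simp_all add: E_eq T.T_eq quot_module_def A_RCOSETS_def' set_add_def' coset_AA fun_eq_iff)

lemma E_k_algebra: "k_algebra K E"
  unfolding E_eq by (rule EQ.quot_k_algebra)

sublocale E: k_algebra K E
  by (rule E_k_algebra)

lemma lin_maps_E: "lin_maps K T.T M = lin_maps K E M" "lin_maps K M T.T = lin_maps K M E"
  by (simp_all add: lin_maps_def)

lemma \<tau>_closed [simp]: "\<lbrakk>a \<in> carrier A; b \<in> carrier A\<rbrakk> \<Longrightarrow> \<tau> a b \<in> carrier E"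
  using \<tau>_bilinear(1) by simp

lemma \<tau>_l_lin: "b \<in> carrier A \<Longrightarrow> (\<lambda>a. \<tau> a b) \<in> lin_maps K A E"
  and \<tau>_r_lin: "a \<in> carrier A \<Longrightarrow> (\<lambda>b. \<tau> a b) \<in> lin_maps K A E"
  using \<tau>_bilinear by (auto intro!: lin_mapsI)

lemma \<tau>_mult: "\<lbrakk>a \<in> carrier A; b \<in> carrier A; a' \<in> carrier A; b' \<in> carrier A\<rbrakk>
    \<Longrightarrow> \<tau> a b \<otimes>\<^bsub>E\<^esub> \<tau> a' b' = \<tau> (a \<otimes>\<^bsub>A\<^esub> a') (b' \<otimes>\<^bsub>A\<^esub> b)"
  unfolding \<tau>_def using EQ.mult_quot[of "basis_elt K (a, b)" "basis_elt K (a', b')"] P.mult_basis[of "(a, b)" "(a', b')"]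
  by (simp add: E_eq coset_AA)

lemma \<tau>_one: "\<tau> \<one>\<^bsub>A\<^esub> \<one>\<^bsub>A\<^esub> = \<one>\<^bsub>E\<^esub>"
  unfolding \<tau>_def using EQ.one_quot by (simp add: E_eq coset_AA)

lemma E_span:
  assumes "submodule H K E" "\<And>a b. \<lbrakk>a \<in> carrier A; b \<in> carrier A\<rbrakk> \<Longrightarrow> \<tau> a b \<in> H" "X \<in> carrier E"
  shows "X \<in> H"
proof -
  interpret TT: left_module K T.T by (rule T.T_module)
  have "submodule H K T.T"
    using E.L.submoduleD[OF assms(1)] by (intro TT.submoduleI) simp_all
  from T.tensor_span[OF this] show ?thesis
    using assms(2,3) unfolding tens_eq_\<tau> by auto
qed

lemma E_eqI:
  assumes "left_module K V" "f \<in> lin_maps K E V" "g \<in> lin_maps K E V"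
    and "\<And>a b. \<lbrakk>a \<in> carrier A; b \<in> carrier A\<rbrakk> \<Longrightarrow> f (\<tau> a b) = g (\<tau> a b)" "X \<in> carrier E"
  shows "f X = g X"
proof (rule T.tensor_eqI[OF assms(1)])
  show "f \<in> lin_maps K T.T V" "g \<in> lin_maps K T.T V" using assms by (simp_all add: lin_maps_E)
  show "X \<in> carrier T.T" using assms by simp
  show "f (T.tens x y) = g (T.tens x y)" if "x \<in> carrier A" "y \<in> carrier (opposite A)" for x y
    using that assms(4) unfolding tens_eq_\<tau> by simp
qed

lemma E_lift:
  assumes V: "left_module K V" and bal: "balanced K (regular K) A (opposite A) V \<phi>"
  shows E_lift_lin: "tensor_lift K V \<phi> \<in> lin_maps K E V"
    and E_lift_\<tau>: "\<And>a b. \<lbrakk>a \<in> carrier A; b \<in> carrier A\<rbrakk> \<Longrightarrow> tensor_lift K V \<phi> (\<tau> a b) = \<phi> a b"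
  using T.tensor_lift(1)[OF V bal] T.tensor_lift(2)[OF V bal] unfolding tens_eq_\<tau> lin_maps_E
  by simp_all

subsection \<open>The two actions on the algebra\<close>

definition trilinear :: "('a \<Rightarrow> 'a \<Rightarrow> 'a \<Rightarrow> 'a) \<Rightarrow> bool"
  where "trilinear \<beta> \<longleftrightarrow>
    (\<forall>a\<in>carrier A. \<forall>b\<in>carrier A. \<beta> a b \<in> lin_maps K A A \<and>
      (\<lambda>x. \<beta> x a b) \<in> lin_maps K A A \<and> (\<lambda>x. \<beta> a x b) \<in> lin_maps K A A)"

lemma trilinear_balanced:
  assumes "trilinear \<beta>" "a \<in> carrier A"
  shows "balanced K (regular K) A (opposite A) A (\<lambda>x y. \<beta> x y a)"
  using assms unfolding trilinear_def
  by (intro bilinear_balanced) (simp_all add: lin_maps_def Pi_iff)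

text \<open>
  Both \<open>(x \<otimes> y) a = x a y\<close> and \<open>a (x \<otimes> y) = y a x\<close> are instances: \<open>S\<close> is the enveloping algebra
  or its opposite, and \<open>\<beta> x y a\<close> is the value of the action.
\<close>

lemma action_module:
  fixes S :: "(('a \<times> 'a \<Rightarrow> 'k) set, 's) ring_scheme" and N :: "(('a \<times> 'a \<Rightarrow> 'k) set, 'a) module"
  assumes S: "ring S" "carrier S = carrier E" "add S = add E" "one S = one E"
    and S_l: "\<And>X. X \<in> carrier E \<Longrightarrow> (\<lambda>Y. X \<otimes>\<^bsub>S\<^esub> Y) \<in> lin_maps K E E"
    and S_r: "\<And>Y. Y \<in> carrier E \<Longrightarrow> (\<lambda>X. X \<otimes>\<^bsub>S\<^esub> Y) \<in> lin_maps K E E"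
    and N: "carrier N = carrier A" "add N = add A" "zero N = zero A"
    and act: "\<And>X a. X \<odot>\<^bsub>N\<^esub> a = tensor_lift K A (\<lambda>x y. \<beta> x y a) X"
    and tri: "trilinear \<beta>"
    and mult: "\<And>x y u v a. \<lbrakk>x \<in> carrier A; y \<in> carrier A; u \<in> carrier A; v \<in> carrier A; a \<in> carrier A\<rbrakk>
      \<Longrightarrow> (\<tau> x y \<otimes>\<^bsub>S\<^esub> \<tau> u v) \<odot>\<^bsub>N\<^esub> a = \<beta> x y (\<beta> u v a)"
    and one: "\<And>a. a \<in> carrier A \<Longrightarrow> \<beta> \<one>\<^bsub>A\<^esub> \<one>\<^bsub>A\<^esub> a = a"
  shows action_left_module: "left_module S N"
    and action_lin: "\<And>a. a \<in> carrier A \<Longrightarrow> (\<lambda>X. X \<odot>\<^bsub>N\<^esub> a) \<in> lin_maps K E A"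
    and action_\<tau>: "\<And>x y a. \<lbrakk>x \<in> carrier A; y \<in> carrier A; a \<in> carrier A\<rbrakk> \<Longrightarrow> \<tau> x y \<odot>\<^bsub>N\<^esub> a = \<beta> x y a"
proof -
  note LA = L.left_module_axioms
  show lin: "(\<lambda>X. X \<odot>\<^bsub>N\<^esub> a) \<in> lin_maps K E A" if a: "a \<in> carrier A" for a
    using E_lift(1)[OF LA trilinear_balanced[OF tri a]] by (simp add: act)
  show val: "\<tau> x y \<odot>\<^bsub>N\<^esub> a = \<beta> x y a" if "x \<in> carrier A" "y \<in> carrier A" "a \<in> carrier A" for x y a
    using E_lift(2)[OF LA trilinear_balanced[OF tri that(3)], of x y] that by (simp add: act)
  have clos: "X \<odot>\<^bsub>N\<^esub> a \<in> carrier A" if "X \<in> carrier E" "a \<in> carrier A" for X a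
    using lin_maps_closed[OF lin[OF that(2)] that(1)] .
  have \<beta>: "\<beta> x y \<in> lin_maps K A A" if "x \<in> carrier A" "y \<in> carrier A" for x y
    using tri that unfolding trilinear_def by blast
  have assoc1: "(\<tau> x y \<otimes>\<^bsub>S\<^esub> Y) \<odot>\<^bsub>N\<^esub> a = \<beta> x y (Y \<odot>\<^bsub>N\<^esub> a)"
    if xy: "x \<in> carrier A" "y \<in> carrier A" and Y: "Y \<in> carrier E" and a: "a \<in> carrier A" for x y Y a
  proof -
    have "\<tau> x y \<in> carrier E" using xy by simp
    then show ?thesis
      by (intro E_eqI[OF LA lin_maps_compose[OF S_l lin[OF a]] lin_maps_compose[OF lin[OF a] \<beta>[OF xy]] _ Y])
        (simp_all add: mult xy a val)
  qed
  have assoc: "(X \<otimes>\<^bsub>S\<^esub> Y) \<odot>\<^bsub>N\<^esub> a = X \<odot>\<^bsub>N\<^esub> (Y \<odot>\<^bsub>N\<^esub> a)"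
    if X: "X \<in> carrier E" and Y: "Y \<in> carrier E" and a: "a \<in> carrier A" for X Y a
    by (rule E_eqI[OF LA lin_maps_compose[OF S_r[OF Y] lin[OF a]] lin[OF clos[OF Y a]] _ X])
      (use Y a clos in \<open>simp add: assoc1 val\<close>)
  have add: "X \<odot>\<^bsub>N\<^esub> (a \<oplus>\<^bsub>A\<^esub> b) = X \<odot>\<^bsub>N\<^esub> a \<oplus>\<^bsub>A\<^esub> X \<odot>\<^bsub>N\<^esub> b"
    if X: "X \<in> carrier E" and ab: "a \<in> carrier A" "b \<in> carrier A" for X a b
    by (rule E_eqI[OF LA lin L.lin_maps_sum[OF E.L.left_module_axioms lin[OF ab(1)] lin[OF ab(2)]] _ X])
      (use ab in \<open>simp_all add: val lin_maps_add[OF \<beta>]\<close>)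
  show "left_module S N"
  proof (rule left_moduleI[OF S(1) abelian_group_cong[OF A.abelian_group_axioms N]])
    fix a x assume a: "a \<in> carrier S" and x: "x \<in> carrier N"
    have ax: "a \<in> carrier E" "x \<in> carrier A" using a x S(2) N(1) by simp_all
    show "a \<odot>\<^bsub>N\<^esub> x \<in> carrier N" unfolding N using clos[OF ax] .
    fix b
    { assume "b \<in> carrier S"
      then have b: "b \<in> carrier E" using S(2) by simp
      show "(a \<oplus>\<^bsub>S\<^esub> b) \<odot>\<^bsub>N\<^esub> x = a \<odot>\<^bsub>N\<^esub> x \<oplus>\<^bsub>N\<^esub> b \<odot>\<^bsub>N\<^esub> x"
        unfolding S(3) N(2) using lin_maps_add[OF lin[OF ax(2)] ax(1) b] .
      show "(a \<otimes>\<^bsub>S\<^esub> b) \<odot>\<^bsub>N\<^esub> x = a \<odot>\<^bsub>N\<^esub> (b \<odot>\<^bsub>N\<^esub> x)"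
        using assoc[OF ax(1) b ax(2)] . }
  next
    fix a x y assume "a \<in> carrier S" "x \<in> carrier N" "y \<in> carrier N"
    then show "a \<odot>\<^bsub>N\<^esub> (x \<oplus>\<^bsub>N\<^esub> y) = a \<odot>\<^bsub>N\<^esub> x \<oplus>\<^bsub>N\<^esub> a \<odot>\<^bsub>N\<^esub> y"
      using add[of a x y] S(2) N(1,2) by simp
  next
    fix x assume "x \<in> carrier N"
    then show "\<one>\<^bsub>S\<^esub> \<odot>\<^bsub>N\<^esub> x = x"
      using val[of "\<one>\<^bsub>A\<^esub>" "\<one>\<^bsub>A\<^esub>" x] one[of x] N(1) S(4) by (simp add: \<tau>_one)
  qed
qed

lemma env_smult:
  "X \<odot>\<^bsub>env_left K A\<^esub> a = tensor_lift K A (\<lambda>x y. x \<otimes>\<^bsub>A\<^esub> a \<otimes>\<^bsub>A\<^esub> y) X"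
  "X \<odot>\<^bsub>env_right K A\<^esub> a = tensor_lift K A (\<lambda>x y. y \<otimes>\<^bsub>A\<^esub> a \<otimes>\<^bsub>A\<^esub> x) X"
  by (simp_all add: env_left_def env_right_def tensor_lift_def on_coset_def lin_ext_def)

lemma env_simps [simp]:
  "carrier (env_left K A) = carrier A" "add (env_left K A) = add A" "zero (env_left K A) = zero A"
  "carrier (env_right K A) = carrier A" "add (env_right K A) = add A" "zero (env_right K A) = zero A"
  by (simp_all add: env_left_def env_right_def)

lemma trilinear_env:
  "trilinear (\<lambda>x y a. x \<otimes>\<^bsub>A\<^esub> a \<otimes>\<^bsub>A\<^esub> y)" "trilinear (\<lambda>x y a. y \<otimes>\<^bsub>A\<^esub> a \<otimes>\<^bsub>A\<^esub> x)"
  by (simp_all add: trilinear_def lin_maps_def A.l_distr A.r_distr smult_mult_l smult_mult_r)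

lemma env_left_facts:
  shows env_left_module: "left_module E (env_left K A)"
    and env_left_lin: "\<And>a. a \<in> carrier A \<Longrightarrow> (\<lambda>X. X \<odot>\<^bsub>env_left K A\<^esub> a) \<in> lin_maps K E A"
    and env_left_\<tau>: "\<And>x y a. \<lbrakk>x \<in> carrier A; y \<in> carrier A; a \<in> carrier A\<rbrakk>
      \<Longrightarrow> \<tau> x y \<odot>\<^bsub>env_left K A\<^esub> a = x \<otimes>\<^bsub>A\<^esub> a \<otimes>\<^bsub>A\<^esub> y"
proof -
  have "(\<tau> x y \<otimes>\<^bsub>E\<^esub> \<tau> u v) \<odot>\<^bsub>env_left K A\<^esub> a = x \<otimes>\<^bsub>A\<^esub> (u \<otimes>\<^bsub>A\<^esub> a \<otimes>\<^bsub>A\<^esub> v) \<otimes>\<^bsub>A\<^esub> y"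
    if "x \<in> carrier A" "y \<in> carrier A" "u \<in> carrier A" "v \<in> carrier A" "a \<in> carrier A" for x y u v a
    using E_lift(2)[OF L.left_module_axioms trilinear_balanced[OF trilinear_env(1) that(5)],
        of "x \<otimes>\<^bsub>A\<^esub> u" "v \<otimes>\<^bsub>A\<^esub> y"] that
    by (simp add: \<tau>_mult env_smult A.m_assoc)
  note * = action_module[OF E.A.ring_axioms refl refl refl E.mult_left_lin E.mult_right_lin
      env_simps(1-3) env_smult(1) trilinear_env(1) this]
  show "left_module E (env_left K A)" using *(1) by simp
  show "\<And>a. a \<in> carrier A \<Longrightarrow> (\<lambda>X. X \<odot>\<^bsub>env_left K A\<^esub> a) \<in> lin_maps K E A" using *(2) by simp
  show "\<And>x y a. \<lbrakk>x \<in> carrier A; y \<in> carrier A; a \<in> carrier A\<rbrakk>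
      \<Longrightarrow> \<tau> x y \<odot>\<^bsub>env_left K A\<^esub> a = x \<otimes>\<^bsub>A\<^esub> a \<otimes>\<^bsub>A\<^esub> y" using *(3) by simp
qed

lemma opposite_ring: "ring (opposite E)"
proof -
  have "abelian_group (opposite E)"
    by (rule abelian_group_cong[OF E.A.abelian_group_axioms]) simp_all
  moreover have "monoid (opposite E)"
  proof (rule monoidI)
    fix x y z assume "x \<in> carrier (opposite E)" "y \<in> carrier (opposite E)" "z \<in> carrier (opposite E)"
    then show "x \<otimes>\<^bsub>opposite E\<^esub> y \<otimes>\<^bsub>opposite E\<^esub> z = x \<otimes>\<^bsub>opposite E\<^esub> (y \<otimes>\<^bsub>opposite E\<^esub> z)"
      using E.A.m_assoc[of z y x] by simp
  qed (use E.A.m_closed E.A.one_closed E.A.l_one E.A.r_one in simp_all)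
  ultimately show ?thesis
    by (rule ringI) (use E.A.l_distr E.A.r_distr in simp_all)
qed

lemma env_right_facts:
  shows env_right_module: "left_module (opposite E) (env_right K A)"
    and env_right_lin: "\<And>a. a \<in> carrier A \<Longrightarrow> (\<lambda>X. X \<odot>\<^bsub>env_right K A\<^esub> a) \<in> lin_maps K E A"
    and env_right_\<tau>: "\<And>x y a. \<lbrakk>x \<in> carrier A; y \<in> carrier A; a \<in> carrier A\<rbrakk>
      \<Longrightarrow> \<tau> x y \<odot>\<^bsub>env_right K A\<^esub> a = y \<otimes>\<^bsub>A\<^esub> a \<otimes>\<^bsub>A\<^esub> x"
proof -
  have m: "(\<tau> x y \<otimes>\<^bsub>opposite E\<^esub> \<tau> u v) \<odot>\<^bsub>env_right K A\<^esub> a = y \<otimes>\<^bsub>A\<^esub> (v \<otimes>\<^bsub>A\<^esub> a \<otimes>\<^bsub>A\<^esub> u) \<otimes>\<^bsub>A\<^esub> x"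
    if "x \<in> carrier A" "y \<in> carrier A" "u \<in> carrier A" "v \<in> carrier A" "a \<in> carrier A" for x y u v a
    using E_lift(2)[OF L.left_module_axioms trilinear_balanced[OF trilinear_env(2) that(5)],
        of "u \<otimes>\<^bsub>A\<^esub> x" "y \<otimes>\<^bsub>A\<^esub> v"] that
    by (simp add: \<tau>_mult env_smult A.m_assoc)
  have l: "(\<lambda>Y. X \<otimes>\<^bsub>opposite E\<^esub> Y) \<in> lin_maps K E E"
    and r: "(\<lambda>Y. Y \<otimes>\<^bsub>opposite E\<^esub> X) \<in> lin_maps K E E" if "X \<in> carrier E" for X
    using E.mult_left_lin[OF that] E.mult_right_lin[OF that] by simp_all
  note * = action_module[OF opposite_ring opposite_simps(1,3,4) l r
      env_simps(4-6) env_smult(2) trilinear_env(2) m]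
  show "left_module (opposite E) (env_right K A)" using *(1) by simp
  show "\<And>a. a \<in> carrier A \<Longrightarrow> (\<lambda>X. X \<odot>\<^bsub>env_right K A\<^esub> a) \<in> lin_maps K E A" using *(2) by simp
  show "\<And>x y a. \<lbrakk>x \<in> carrier A; y \<in> carrier A; a \<in> carrier A\<rbrakk>
      \<Longrightarrow> \<tau> x y \<odot>\<^bsub>env_right K A\<^esub> a = y \<otimes>\<^bsub>A\<^esub> a \<otimes>\<^bsub>A\<^esub> x" using *(3) by simp
qed

lemma env_right_tensor_product:
  "left_module E N \<Longrightarrow> tensor_product K E (env_right K A) N"
  by (intro tensor_product.intro tensor_product_axioms.intro K.cring_axioms env_right_module)
    (use E.L.smult_closed E.A.one_closed in blast)+

end

section \<open>The localized free algebra\<close>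

text \<open>
  Membership in the carrier is part of the induction, since \<open>h\<close> is compatible with the operations only
  there.
\<close>

lemma continuant_hom:
  assumes "h \<zero>\<^bsub>R\<^esub> = \<zero>\<^bsub>S\<^esub>" "h \<one>\<^bsub>R\<^esub> = \<one>\<^bsub>S\<^esub>" "ring R"
    and "\<And>x y. \<lbrakk>x \<in> carrier R; y \<in> carrier R\<rbrakk> \<Longrightarrow> h (x \<oplus>\<^bsub>R\<^esub> y) = h x \<oplus>\<^bsub>S\<^esub> h y"
    and "\<And>x y. \<lbrakk>x \<in> carrier R; y \<in> carrier R\<rbrakk> \<Longrightarrow> h (x \<otimes>\<^bsub>R\<^esub> y) = h x \<otimes>\<^bsub>S\<^esub> h y"
    and "\<And>i. \<lbrakk>1 \<le> i; i < n\<rbrakk> \<Longrightarrow> z i \<in> carrier R" "\<And>i. \<lbrakk>1 \<le> i; i < n\<rbrakk> \<Longrightarrow> h (z i) = z' i"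
  shows "continuant R z n \<in> carrier R \<and> h (continuant R z n) = continuant S z' n"
  using assms(6,7)
proof (induction n rule: less_induct)
  case (less n)
  interpret R: ring R by fact
  consider "n = 0" | "n = Suc 0" | j where "n = Suc (Suc j)" by (metis not0_implies_Suc)
  then show ?case
  proof cases
    case 3
    then show ?thesis
      using less.IH[of j] less.IH[of "Suc j"] less.prems by (simp add: assms(4,5))
  qed (simp_all add: assms(1,2))
qed

lemma continuant_closed:
  assumes "ring R" "\<And>i. \<lbrakk>1 \<le> i; i < n\<rbrakk> \<Longrightarrow> z i \<in> carrier R"
  shows "continuant R z n \<in> carrier R"
  using continuant_hom[of "\<lambda>x. x" R R n z z] assms by simp

lemma free_monoid_simps [simp]:
  "carrier (free_monoid X) = lists X" "mult (free_monoid X) = append" "one (free_monoid X) = []"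
  by (simp_all add: free_monoid_def)

lemma monoid_free_monoid: "monoid (free_monoid X)"
  by (rule monoidI) auto

definition word_value :: "('a, 'q) ring_scheme \<Rightarrow> ('x \<Rightarrow> 'a) \<Rightarrow> 'x list \<Rightarrow> 'a"
  where "word_value S s w = foldr (\<lambda>x a. s x \<otimes>\<^bsub>S\<^esub> a) w \<one>\<^bsub>S\<^esub>"

lemma word_value_simps [simp]:
  "word_value S s [] = \<one>\<^bsub>S\<^esub>" "word_value S s (x # w) = s x \<otimes>\<^bsub>S\<^esub> word_value S s w"
  by (simp_all add: word_value_def)

lemma word_value_closed:
  "\<lbrakk>monoid S; s \<in> X \<rightarrow> carrier S; w \<in> lists X\<rbrakk> \<Longrightarrow> word_value S s w \<in> carrier S"
  by (induction w) (auto simp: monoid.m_closed monoid.one_closed Pi_iff)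

lemma word_value_append:
  assumes "monoid S" "s \<in> X \<rightarrow> carrier S" "v \<in> lists X" "w \<in> lists X"
  shows "word_value S s (v @ w) = word_value S s v \<otimes>\<^bsub>S\<^esub> word_value S s w"
  using assms(3)
proof (induction v)
  case Nil then show ?case using assms word_value_closed[OF assms(1,2,4)] by (simp add: monoid.l_one)
next
  case (Cons x v)
  then have "s x \<in> carrier S" "word_value S s v \<in> carrier S"
    using assms(2) word_value_closed[OF assms(1,2)] by auto
  then show ?case
    using Cons word_value_closed[OF assms(1,2,4)] by (simp add: monoid.m_assoc[OF assms(1)])
qed

text \<open>The homomorphism out of the free algebra that sends each letter \<open>x\<close> to \<open>s x\<close>.\<close>

definition free_hom ::
    "('k, 'q) ring_scheme \<Rightarrow> ('k, 'a) module \<Rightarrow> ('x \<Rightarrow> 'a) \<Rightarrow> ('x list \<Rightarrow> 'k) \<Rightarrow> 'a"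
  where "free_hom K S s = lin_ext K S (word_value S s)"

locale free_alg = K: cring K
  for K :: "('k, 'q) ring_scheme" and X :: "'x set"
begin

abbreviation "Fr \<equiv> free_algebra K X"

sublocale MA: monoid_alg K "free_monoid X"
  by (intro monoid_alg.intro K.cring_axioms monoid_free_monoid)

lemma Fr_eq: "Fr = monoid_algebra K (free_monoid X)"
  by (simp add: free_algebra_def)

lemma Fr_simps:
  "carrier Fr = carrier (free_module K (lists X))" "zero Fr = zero (free_module K (lists X))"
  "add Fr = add (free_module K (lists X))" "smult Fr = smult (free_module K (lists X))"
  "one Fr = basis_elt K []"
  by (simp_all add: Fr_eq)

lemma lin_maps_Fr: "lin_maps K Fr M = lin_maps K (free_module K (lists X)) M"
  by (simp add: lin_maps_def Fr_simps)

sublocale Fr: k_algebra K Fr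
  unfolding Fr_eq by (rule MA.MA_k_algebra)

lemma basis_Fr [simp]: "w \<in> lists X \<Longrightarrow> basis_elt K w \<in> carrier Fr"
  by (simp add: Fr_simps)

lemma basis_mult_Fr: "\<lbrakk>v \<in> lists X; w \<in> lists X\<rbrakk> \<Longrightarrow> basis_elt K v \<otimes>\<^bsub>Fr\<^esub> basis_elt K w = basis_elt K (v @ w)"
  using MA.mult_basis[of v w] by (simp add: Fr_eq)

lemma free_hom:
  assumes S: "k_algebra K S" and s: "s \<in> X \<rightarrow> carrier S"
  shows free_hom_lin: "free_hom K S s \<in> lin_maps K Fr S"
    and free_hom_word: "\<And>w. w \<in> lists X \<Longrightarrow> free_hom K S s (basis_elt K w) = word_value S s w"
    and free_hom_one: "free_hom K S s \<one>\<^bsub>Fr\<^esub> = \<one>\<^bsub>S\<^esub>"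
    and free_hom_mult: "\<And>f g. \<lbrakk>f \<in> carrier Fr; g \<in> carrier Fr\<rbrakk>
      \<Longrightarrow> free_hom K S s (f \<otimes>\<^bsub>Fr\<^esub> g) = free_hom K S s f \<otimes>\<^bsub>S\<^esub> free_hom K S s g"
proof -
  interpret S: k_algebra K S by fact
  let ?h = "free_hom K S s"
  have SM: "left_module K S" by (rule S.L.left_module_axioms)
  have wv: "word_value S s \<in> lists X \<rightarrow> carrier S"
    using word_value_closed[OF S.A.monoid_axioms s] by blast
  show lin: "?h \<in> lin_maps K Fr S"
    unfolding lin_maps_Fr free_hom_def by (rule K.lin_ext_lin[OF SM wv])
  show word: "?h (basis_elt K w) = word_value S s w" if "w \<in> lists X" for w
    unfolding free_hom_def by (rule K.lin_ext_basis[OF SM wv that])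
  show "?h \<one>\<^bsub>Fr\<^esub> = \<one>\<^bsub>S\<^esub>" by (simp add: Fr_simps word)
  have closed: "?h f \<in> carrier S" if "f \<in> carrier Fr" for f using lin_maps_closed[OF lin that] .
  have comp: "(\<lambda>x. g (f x)) \<in> lin_maps K (free_module K (lists X)) S"
    if "f \<in> lin_maps K Fr L" "g \<in> lin_maps K L S" for f g and L :: "('k, 'l) module"
    using lin_maps_compose[OF that] by (simp add: lin_maps_Fr)
  have mult1: "?h (basis_elt K v \<otimes>\<^bsub>Fr\<^esub> g) = word_value S s v \<otimes>\<^bsub>S\<^esub> ?h g"
    if v: "v \<in> lists X" and g: "g \<in> carrier Fr" for v g
  proof (rule K.free_module_eqI[OF comp[OF Fr.mult_left_lin lin] comp[OF lin S.mult_left_lin] SM])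
    show "g \<in> carrier (free_module K (lists X))" using g by (simp add: Fr_simps)
    show "basis_elt K v \<in> carrier Fr" using v by simp
    show "word_value S s v \<in> carrier S" using wv v by blast
    show "?h (basis_elt K v \<otimes>\<^bsub>Fr\<^esub> basis_elt K w) = word_value S s v \<otimes>\<^bsub>S\<^esub> ?h (basis_elt K w)"
      if "w \<in> lists X" for w
      using that v by (simp add: basis_mult_Fr word word_value_append[OF S.A.monoid_axioms s])
  qed
  show "?h (f \<otimes>\<^bsub>Fr\<^esub> g) = ?h f \<otimes>\<^bsub>S\<^esub> ?h g" if f: "f \<in> carrier Fr" and g: "g \<in> carrier Fr" for f g
  proof (rule K.free_module_eqI[OF comp[OF Fr.mult_right_lin[OF g] lin]
        comp[OF lin S.mult_right_lin[OF closed[OF g]]] SM])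
    show "f \<in> carrier (free_module K (lists X))" using f by (simp add: Fr_simps)
    show "?h (basis_elt K w \<otimes>\<^bsub>Fr\<^esub> g) = ?h (basis_elt K w) \<otimes>\<^bsub>S\<^esub> ?h g" if "w \<in> lists X" for w
      using that g by (simp add: mult1 word)
  qed
qed

end

locale localization = K: cring K
  for K :: "('k, 'q) ring_scheme" and m :: nat
begin

sublocale free_alg K "{0..m}"
  by unfold_locales

abbreviation "A \<equiv> loc_algebra K m"
abbreviation "I \<equiv> loc_ideal K m"
abbreviation "z \<equiv> loc_gen K m"

text \<open>
  The adjoined inverse and the continuant, as elements of the localization.
\<close>

definition y where "y = I +>\<^bsub>Fr\<^esub> letter K 0"
definition c where "c = continuant A z (Suc m)"

lemma letter_closed: "i \<le> m \<Longrightarrow> letter K i \<in> carrier Fr"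
  unfolding letter_def by (rule basis_Fr) simp

lemma cont_closed: "continuant Fr (letter K) (Suc m) \<in> carrier Fr"
  by (rule continuant_closed[OF Fr.A.ring_axioms]) (simp_all add: letter_closed)

definition rel_gens where "rel_gens =
  {continuant Fr (letter K) (Suc m) \<otimes>\<^bsub>Fr\<^esub> letter K 0 \<ominus>\<^bsub>Fr\<^esub> \<one>\<^bsub>Fr\<^esub>,
   letter K 0 \<otimes>\<^bsub>Fr\<^esub> continuant Fr (letter K) (Suc m) \<ominus>\<^bsub>Fr\<^esub> \<one>\<^bsub>Fr\<^esub>}"

lemma I_eq: "I = Idl\<^bsub>Fr\<^esub> rel_gens"
  by (simp only: loc_ideal_def rel_gens_def Let_def)

lemma rel_gens_closed: "rel_gens \<subseteq> carrier Fr"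
  unfolding rel_gens_def using cont_closed letter_closed[of 0] by simp

lemma I_ideal: "ideal I Fr"
  unfolding I_eq by (rule Fr.A.genideal_ideal[OF rel_gens_closed])

sublocale Q: quotient_algebra K Fr I
  by (intro quotient_algebra.intro Fr.k_algebra_axioms quotient_algebra_axioms.intro I_ideal)

lemma A_eq: "A = quot_module Fr I"
  by (simp add: loc_algebra_def)

sublocale A: k_algebra K A
  unfolding A_eq by (rule Q.quot_k_algebra)

abbreviation proj where "proj f \<equiv> I +>\<^bsub>Fr\<^esub> f"

lemma proj_facts:
  shows proj_lin: "(\<lambda>f. proj f) \<in> lin_maps K Fr A"
    and proj_mult: "\<And>f g. \<lbrakk>f \<in> carrier Fr; g \<in> carrier Fr\<rbrakk> \<Longrightarrow> proj (f \<otimes>\<^bsub>Fr\<^esub> g) = proj f \<otimes>\<^bsub>A\<^esub> proj g"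
    and proj_one: "proj \<one>\<^bsub>Fr\<^esub> = \<one>\<^bsub>A\<^esub>"
  using Q.Q.proj_lin Q.mult_quot Q.one_quot by (simp_all add: A_eq)

sublocale proj: linear_map K Fr A "\<lambda>f. proj f"
  by (rule linear_mapI[OF Fr.L.left_module_axioms A.L.left_module_axioms proj_lin])

lemma z_closed [simp]: "i \<le> m \<Longrightarrow> z i \<in> carrier A"
  by (simp add: loc_gen_def letter_closed)

lemma y_closed [simp]: "y \<in> carrier A"
  by (simp add: y_def letter_closed)

lemma proj_cont: "proj (continuant Fr (letter K) (Suc m)) = c"
  unfolding c_def
  by (rule continuant_hom[where h = "\<lambda>f. proj f" and R = Fr, THEN conjunct2])
    (use proj.zero in \<open>simp_all add: proj_one Fr.A.ring_axioms proj.add proj_mult letter_closed loc_gen_def\<close>)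

lemma c_closed [simp]: "c \<in> carrier A"
  using proj.closed[OF cont_closed] by (simp only: proj_cont)

lemma rel_gens_in_I: "rel_gens \<subseteq> I"
  unfolding I_eq genideal_def by blast

lemma c_y: "c \<otimes>\<^bsub>A\<^esub> y = \<one>\<^bsub>A\<^esub>" and y_c: "y \<otimes>\<^bsub>A\<^esub> c = \<one>\<^bsub>A\<^esub>"
proof -
  note cl = cont_closed letter_closed[of 0, simplified]
  have "proj (continuant Fr (letter K) (Suc m) \<otimes>\<^bsub>Fr\<^esub> letter K 0) = proj \<one>\<^bsub>Fr\<^esub>"
    using rel_gens_in_I cl unfolding rel_gens_def
    by (subst Q.Q.proj_eq_iff) (simp_all del: continuant.simps)
  then show "c \<otimes>\<^bsub>A\<^esub> y = \<one>\<^bsub>A\<^esub>"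
    using cl by (simp only: proj_mult proj_cont proj_one y_def)
  have "proj (letter K 0 \<otimes>\<^bsub>Fr\<^esub> continuant Fr (letter K) (Suc m)) = proj \<one>\<^bsub>Fr\<^esub>"
    using rel_gens_in_I cl unfolding rel_gens_def
    by (subst Q.Q.proj_eq_iff) (simp_all del: continuant.simps)
  then show "y \<otimes>\<^bsub>A\<^esub> c = \<one>\<^bsub>A\<^esub>"
    using cl by (simp only: proj_mult proj_cont proj_one y_def)
qed

text \<open>
  Every element is the class of a linear combination of words, that is, of products of the \<open>z\<^sub>i\<close> and \<open>y\<close>.
\<close>

lemma A_induct:
  assumes H: "submodule H K A" and one: "\<one>\<^bsub>A\<^esub> \<in> H" and z: "\<And>i. \<lbrakk>1 \<le> i; i \<le> m\<rbrakk> \<Longrightarrow> z i \<in> H"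
    and y: "y \<in> H" and mult: "\<And>a b. \<lbrakk>a \<in> H; b \<in> H\<rbrakk> \<Longrightarrow> a \<otimes>\<^bsub>A\<^esub> b \<in> H"
    and a: "a \<in> carrier A"
  shows "a \<in> H"
proof -
  have letters: "proj (letter K i) \<in> H" if "i \<le> m" for i
    using that z[of i] y unfolding y_def loc_gen_def by (cases "i = 0") auto
  have words: "proj (basis_elt K w) \<in> H" if "w \<in> lists {0..m}" for w
    using that
  proof (induction w)
    case Nil show ?case using one by (simp flip: proj_one add: Fr_simps)
  next
    case (Cons i w)
    then have "basis_elt K (i # w) = letter K i \<otimes>\<^bsub>Fr\<^esub> basis_elt K w"
      by (simp add: letter_def basis_mult_Fr)
    then show ?case using Cons letters[of i] by (simp add: proj_mult letter_closed mult)
  qed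
  obtain f where f: "f \<in> carrier Fr" "a = proj f"
    using a unfolding A_eq by (rule Q.Q.carrier_quotE)
  have "f \<in> carrier (free_module K (lists {0..m}))" using f by (simp add: Fr_simps)
  then have "proj f \<in> H"
  proof (induction rule: K.free_module_induct)
    case zero
    then show ?case using proj.zero A.L.submodule_zero[OF H] by (simp add: Fr_simps)
  next
    case (add f g)
    then show ?case using proj.add[of f g] A.L.submodule_add[OF H] by (simp add: Fr_simps)
  next
    case (basis k w)
    then show ?case
      using proj.smult[of k "basis_elt K w"] A.L.submodule_smult[OF H] words by (simp add: Fr_simps)
  qed
  with f show ?thesis by simp
qed

text \<open>
  The homomorphism out of the free algebra factors through the localization, because its kernel is an ideal
  and contains the two defining relations.
\<close>

lemma localization_hom:
  assumes S: "k_algebra K S" and s: "s \<in> {0..m} \<rightarrow> carrier S"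
    and inv: "continuant S s (Suc m) \<otimes>\<^bsub>S\<^esub> s 0 = \<one>\<^bsub>S\<^esub>" "s 0 \<otimes>\<^bsub>S\<^esub> continuant S s (Suc m) = \<one>\<^bsub>S\<^esub>"
  obtains h where "h \<in> lin_maps K A S" "h \<one>\<^bsub>A\<^esub> = \<one>\<^bsub>S\<^esub>" "h y = s 0"
    "\<And>i. \<lbrakk>1 \<le> i; i \<le> m\<rbrakk> \<Longrightarrow> h (z i) = s i"
    "\<And>a b. \<lbrakk>a \<in> carrier A; b \<in> carrier A\<rbrakk> \<Longrightarrow> h (a \<otimes>\<^bsub>A\<^esub> b) = h a \<otimes>\<^bsub>S\<^esub> h b"
proof -
  interpret S: k_algebra K S by fact
  let ?f = "free_hom K S s"
  note hom = free_hom[OF S s]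
  interpret f: linear_map K Fr S ?f
    by (rule linear_mapI[OF Fr.L.left_module_axioms S.L.left_module_axioms hom(1)])
  have letter: "?f (letter K i) = s i" if "i \<le> m" for i
    using hom(2)[of "[i]"] funcset_mem[OF s, of i] that by (simp add: letter_def)
  have cont: "?f (continuant Fr (letter K) (Suc m)) = continuant S s (Suc m)"
    by (rule continuant_hom[where h = ?f and R = Fr, THEN conjunct2])
      (use f.zero in \<open>simp_all add: hom(3,4) Fr.A.ring_axioms f.add letter_closed letter\<close>)
  let ?ker = "{x \<in> carrier Fr. ?f x = \<zero>\<^bsub>S\<^esub>}"
  have "ideal ?ker Fr"
  proof (rule idealI[OF Fr.A.ring_axioms])
    show "subgroup ?ker (add_monoid Fr)"
      using f.kernel_submodule by (rule submodule.axioms(1))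
  qed (simp_all add: hom(4))
  moreover have "rel_gens \<subseteq> ?ker"
    unfolding rel_gens_def using cont_closed letter_closed[of 0]
    by (simp add: f.diff hom(3,4) cont letter inv S.A.a_minus_eq_zero_iff del: continuant.simps)
  ultimately have "I \<subseteq> ?ker" unfolding I_eq genideal_def by blast
  then have kill: "?f x = \<zero>\<^bsub>S\<^esub>" if "x \<in> I" for x using that by blast
  let ?h = "on_coset ?f"
  have val: "?h (proj x) = ?f x" if "x \<in> carrier Fr" for x
    by (rule Q.Q.on_coset_proj[OF S.L.left_module_axioms hom(1) kill that])
  show thesis
  proof (rule that[of ?h])
    show "?h \<in> lin_maps K A S"
      unfolding A_eq by (rule Q.Q.on_coset_lin[OF S.L.left_module_axioms hom(1) kill])
    show "?h \<one>\<^bsub>A\<^esub> = \<one>\<^bsub>S\<^esub>" by (simp flip: proj_one add: val hom(3))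
    show "?h y = s 0" by (simp add: y_def val letter_closed letter)
    show "?h (z i) = s i" if "1 \<le> i" "i \<le> m" for i
      using that by (simp add: loc_gen_def val letter_closed letter)
    fix a b assume "a \<in> carrier A" "b \<in> carrier A"
    then obtain f g where "f \<in> carrier Fr" "a = proj f" "g \<in> carrier Fr" "b = proj g"
      unfolding A_eq by (metis Q.Q.carrier_quotE)
    then show "?h (a \<otimes>\<^bsub>A\<^esub> b) = ?h a \<otimes>\<^bsub>S\<^esub> ?h b"
      by (simp add: val hom(4) flip: proj_mult)
  qed
qed

end

section \<open>Derivations into the enveloping algebra\<close>

context enveloping_algebra
begin

abbreviation lmul where "lmul a \<equiv> \<tau> a \<one>\<^bsub>A\<^esub>"
abbreviation rmul where "rmul b \<equiv> \<tau> \<one>\<^bsub>A\<^esub> b"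

sublocale lmul: linear_map K A E lmul
  by (rule linear_mapI[OF L.left_module_axioms E.L.left_module_axioms \<tau>_l_lin]) simp

sublocale rmul: linear_map K A E rmul
  by (rule linear_mapI[OF L.left_module_axioms E.L.left_module_axioms \<tau>_r_lin]) simp

lemma lmul_mult:
    "\<lbrakk>a \<in> carrier A; b \<in> carrier A\<rbrakk> \<Longrightarrow> lmul (a \<otimes>\<^bsub>A\<^esub> b) = lmul a \<otimes>\<^bsub>E\<^esub> lmul b"
  and rmul_mult:
    "\<lbrakk>a \<in> carrier A; b \<in> carrier A\<rbrakk> \<Longrightarrow> rmul (a \<otimes>\<^bsub>A\<^esub> b) = rmul b \<otimes>\<^bsub>E\<^esub> rmul a"
  and lmul_rmul:
    "\<lbrakk>a \<in> carrier A; b \<in> carrier A\<rbrakk> \<Longrightarrow> lmul a \<otimes>\<^bsub>E\<^esub> rmul b = \<tau> a b"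
  and rmul_lmul:
    "\<lbrakk>a \<in> carrier A; b \<in> carrier A\<rbrakk> \<Longrightarrow> rmul b \<otimes>\<^bsub>E\<^esub> lmul a = \<tau> a b"
  by (simp_all add: \<tau>_mult)

text \<open>
  The square-zero extension of \<open>A\<close> by its enveloping algebra. An algebra map \<open>a \<mapsto> (a, D a)\<close> into it is
  the same as a derivation \<open>D\<close> of \<open>A\<close> with values in the bimodule \<open>A \<otimes> A\<close>.
\<close>

definition sq_zero :: "('k, 'a \<times> ('a \<times> 'a \<Rightarrow> 'k) set) module"
  where "sq_zero =
    \<lparr>carrier = carrier A \<times> carrier E,
     mult = (\<lambda>p q. (fst p \<otimes>\<^bsub>A\<^esub> fst q, lmul (fst p) \<otimes>\<^bsub>E\<^esub> snd q \<oplus>\<^bsub>E\<^esub> rmul (fst q) \<otimes>\<^bsub>E\<^esub> snd p)),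
     one = (\<one>\<^bsub>A\<^esub>, \<zero>\<^bsub>E\<^esub>), zero = (\<zero>\<^bsub>A\<^esub>, \<zero>\<^bsub>E\<^esub>),
     add = (\<lambda>p q. (fst p \<oplus>\<^bsub>A\<^esub> fst q, snd p \<oplus>\<^bsub>E\<^esub> snd q)),
     smult = (\<lambda>k p. (k \<odot>\<^bsub>A\<^esub> fst p, k \<odot>\<^bsub>E\<^esub> snd p))\<rparr>"

lemma sq_zero_simps [simp]:
  "carrier sq_zero = carrier A \<times> carrier E"
  "(a, u) \<otimes>\<^bsub>sq_zero\<^esub> (b, v) = (a \<otimes>\<^bsub>A\<^esub> b, lmul a \<otimes>\<^bsub>E\<^esub> v \<oplus>\<^bsub>E\<^esub> rmul b \<otimes>\<^bsub>E\<^esub> u)"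
  "\<one>\<^bsub>sq_zero\<^esub> = (\<one>\<^bsub>A\<^esub>, \<zero>\<^bsub>E\<^esub>)" "\<zero>\<^bsub>sq_zero\<^esub> = (\<zero>\<^bsub>A\<^esub>, \<zero>\<^bsub>E\<^esub>)"
  "(a, u) \<oplus>\<^bsub>sq_zero\<^esub> (b, v) = (a \<oplus>\<^bsub>A\<^esub> b, u \<oplus>\<^bsub>E\<^esub> v)"
  "k \<odot>\<^bsub>sq_zero\<^esub> (a, u) = (k \<odot>\<^bsub>A\<^esub> a, k \<odot>\<^bsub>E\<^esub> u)"
  by (simp_all add: sq_zero_def)

lemma sq_zero_mult:
  "p \<otimes>\<^bsub>sq_zero\<^esub> q = (fst p \<otimes>\<^bsub>A\<^esub> fst q, lmul (fst p) \<otimes>\<^bsub>E\<^esub> snd q \<oplus>\<^bsub>E\<^esub> rmul (fst q) \<otimes>\<^bsub>E\<^esub> snd p)"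
  by (simp add: sq_zero_def)

lemma sq_zero_k_algebra: "k_algebra K sq_zero"
proof -
  have ab: "abelian_group sq_zero"
  proof (rule abelian_groupI)
    fix p assume "p \<in> carrier sq_zero"
    then show "\<exists>q\<in>carrier sq_zero. q \<oplus>\<^bsub>sq_zero\<^esub> p = \<zero>\<^bsub>sq_zero\<^esub>"
      by (intro bexI[of _ "(\<ominus>\<^bsub>A\<^esub> fst p, \<ominus>\<^bsub>E\<^esub> snd p)"]) (auto simp: A.l_neg E.A.l_neg)
  qed (auto simp: A.a_ac E.A.a_ac)
  have assoc: "((a, u) \<otimes>\<^bsub>sq_zero\<^esub> (b, v)) \<otimes>\<^bsub>sq_zero\<^esub> (c, w) = (a, u) \<otimes>\<^bsub>sq_zero\<^esub> ((b, v) \<otimes>\<^bsub>sq_zero\<^esub> (c, w))"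
    if "a \<in> carrier A" "b \<in> carrier A" "c \<in> carrier A" "u \<in> carrier E" "v \<in> carrier E" "w \<in> carrier E"
    for a b c u v w
  proof -
    have "rmul c \<otimes>\<^bsub>E\<^esub> (lmul a \<otimes>\<^bsub>E\<^esub> v) = lmul a \<otimes>\<^bsub>E\<^esub> (rmul c \<otimes>\<^bsub>E\<^esub> v)"
      using that lmul_rmul[of a c] rmul_lmul[of a c] by (simp flip: E.A.m_assoc)
    then show ?thesis
      using that by (simp add: lmul_mult rmul_mult A.m_assoc E.A.m_assoc E.A.r_distr E.A.a_assoc)
  qed
  have mon: "monoid sq_zero"
    by (rule monoidI) (use assoc in \<open>auto simp: \<tau>_one\<close>)
  have ring: "ring sq_zero"
    by (rule ringI[OF ab mon])
      (auto simp: A.l_distr A.r_distr E.A.l_distr E.A.r_distr lmul.add rmul.add E.A.a_ac)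
  have "left_module K sq_zero"
    by (rule left_moduleI[OF K.ring_axioms ab])
      (auto simp: L.smult_l_distr L.smult_r_distr L.smult_assoc
        E.L.smult_l_distr E.L.smult_r_distr E.L.smult_assoc)
  moreover have "k_algebra_axioms K sq_zero"
    by (rule k_algebra_axioms.intro)
      (auto simp: smult_mult_l smult_mult_r E.smult_mult_l E.smult_mult_r lmul.smult rmul.smult E.L.smult_r_distr)
  ultimately show ?thesis
    by (intro k_algebra.intro K.cring_axioms ring)
qed

end

locale localization_env = localization
begin

sublocale EA: enveloping_algebra K A
  by (intro enveloping_algebra.intro A.k_algebra_axioms)

abbreviation "E \<equiv> enveloping K A"
abbreviation \<tau> where "\<tau> \<equiv> EA.\<tau>"
lemmas A_mod = A.L.left_module_axioms
lemmas E_mod = EA.E.L.left_module_axioms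

abbreviation lmul where "lmul a \<equiv> EA.\<tau> a \<one>\<^bsub>A\<^esub>"
abbreviation rmul where "rmul b \<equiv> EA.\<tau> \<one>\<^bsub>A\<^esub> b"

text \<open>
  Derivations of the localization may be prescribed freely on the \<open>z\<^sub>i\<close>: in the square-zero extension,
  an element is invertible as soon as its first component is.
\<close>

lemma derivation_exists:
  assumes \<delta>: "\<And>i. \<lbrakk>1 \<le> i; i \<le> m\<rbrakk> \<Longrightarrow> \<delta> i \<in> carrier E"
  obtains D where "D \<in> lin_maps K A E" "\<And>i. \<lbrakk>1 \<le> i; i \<le> m\<rbrakk> \<Longrightarrow> D (z i) = \<delta> i"
    "\<And>a b. \<lbrakk>a \<in> carrier A; b \<in> carrier A\<rbrakk>
      \<Longrightarrow> D (a \<otimes>\<^bsub>A\<^esub> b) = lmul a \<otimes>\<^bsub>E\<^esub> D b \<oplus>\<^bsub>E\<^esub> rmul b \<otimes>\<^bsub>E\<^esub> D a"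
proof -
  let ?S = "EA.sq_zero"
  interpret S: k_algebra K ?S by (rule EA.sq_zero_k_algebra)
  let ?s0 = "\<lambda>i. (z i, \<delta> i)"
  let ?c = "continuant ?S ?s0 (Suc m)"
  have cS: "?c \<in> carrier ?S"
    by (rule continuant_closed[OF S.A.ring_axioms]) (simp add: \<delta>)
  moreover have "fst ?c = c"
    unfolding c_def
    by (rule continuant_hom[where h = fst and R = ?S and z = ?s0, THEN conjunct2])
      (use S.A.ring_axioms \<delta> in auto)
  ultimately obtain \<mu> where \<mu>: "?c = (c, \<mu>)" "\<mu> \<in> carrier E"
    by (cases ?c) auto
  \<comment> \<open>The derivative of the inverse is forced: \<open>D (c\<^sup>-\<^sup>1) = - c\<^sup>-\<^sup>1 (D c) c\<^sup>-\<^sup>1\<close>.\<close>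
  let ?s = "\<lambda>i. if i = 0 then (y, \<ominus>\<^bsub>E\<^esub> (\<tau> y y \<otimes>\<^bsub>E\<^esub> \<mu>)) else ?s0 i"
  have yy: "\<tau> y y \<otimes>\<^bsub>E\<^esub> \<mu> \<in> carrier E" using \<mu>(2) by simp
  have sS: "?s \<in> {0..m} \<rightarrow> carrier ?S" using yy \<delta> by auto
  have c': "continuant ?S ?s (Suc m) = (c, \<mu>)"
    unfolding \<mu>(1)[symmetric]
    by (rule continuant_hom[where h = "\<lambda>x. x" and R = ?S, THEN conjunct2])
      (use S.A.ring_axioms \<delta> in auto)
  have lc: "lmul c \<otimes>\<^bsub>E\<^esub> (\<tau> y y \<otimes>\<^bsub>E\<^esub> \<mu>) = rmul y \<otimes>\<^bsub>E\<^esub> \<mu>"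
    using \<mu>(2) by (simp add: EA.\<tau>_mult c_y flip: EA.E.A.m_assoc)
  have rc: "rmul c \<otimes>\<^bsub>E\<^esub> (\<tau> y y \<otimes>\<^bsub>E\<^esub> \<mu>) = lmul y \<otimes>\<^bsub>E\<^esub> \<mu>"
    using \<mu>(2) by (simp add: EA.\<tau>_mult y_c flip: EA.E.A.m_assoc)
  have "continuant ?S ?s (Suc m) \<otimes>\<^bsub>?S\<^esub> ?s 0 = \<one>\<^bsub>?S\<^esub>"
    unfolding c' using \<mu>(2) yy by (simp add: c_y EA.E.A.r_minus lc EA.E.A.l_neg)
  moreover have "?s 0 \<otimes>\<^bsub>?S\<^esub> continuant ?S ?s (Suc m) = \<one>\<^bsub>?S\<^esub>"
    unfolding c' using \<mu>(2) yy by (simp add: y_c EA.E.A.r_minus rc EA.E.A.r_neg)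
  ultimately obtain h where h: "h \<in> lin_maps K A ?S" "h \<one>\<^bsub>A\<^esub> = \<one>\<^bsub>?S\<^esub>" "h y = ?s 0"
    "\<And>i. \<lbrakk>1 \<le> i; i \<le> m\<rbrakk> \<Longrightarrow> h (z i) = ?s i"
    "\<And>a b. \<lbrakk>a \<in> carrier A; b \<in> carrier A\<rbrakk> \<Longrightarrow> h (a \<otimes>\<^bsub>A\<^esub> b) = h a \<otimes>\<^bsub>?S\<^esub> h b"
    using localization_hom[OF S.k_algebra_axioms sS] by blast
  have pf: "fst \<in> lin_maps K ?S A" "snd \<in> lin_maps K ?S E"
    by (auto intro!: lin_mapsI)
  interpret hf: linear_map K A A "\<lambda>a. fst (h a)"
    by (rule linear_mapI[OF A_mod A_mod lin_maps_compose[OF h(1) pf(1)]])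
  interpret hs: linear_map K A E "\<lambda>a. snd (h a)"
    by (rule linear_mapI[OF A_mod E_mod lin_maps_compose[OF h(1) pf(2)]])
  have fst_h: "fst (h a) = a" if a: "a \<in> carrier A" for a
  proof -
    let ?H = "{a \<in> carrier A. fst (h a) = a}"
    have "a \<in> ?H"
    proof (rule A_induct[OF _ _ _ _ _ a])
      show "submodule ?H K A"
        by (rule A.L.submoduleI) (use hf.zero hf.add hf.smult in auto)
    qed (simp_all add: h(2-5) EA.sq_zero_mult)
    then show ?thesis by blast
  qed
  show thesis
  proof (rule that[of "\<lambda>a. snd (h a)"])
    show "(\<lambda>a. snd (h a)) \<in> lin_maps K A E" by (rule hs.lin)
  qed (simp_all add: h(4,5) EA.sq_zero_mult fst_h)
qed

section \<open>The bimodule resolution\<close>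

text \<open>The images of the basis of the free bimodule of rank \<open>m\<close> in \<open>A \<otimes> A\<close>.\<close>

definition w where "w i = lmul (z i) \<ominus>\<^bsub>E\<^esub> rmul (z i)"

text \<open>
  The left ideal generated by the \<open>w\<^sub>i\<close>, which turns out to be the kernel of the multiplication.
\<close>

definition J where "J = {\<Oplus>\<^bsub>E\<^esub>i\<in>{1..m}. r i \<otimes>\<^bsub>E\<^esub> w i | r. r \<in> {1..m} \<rightarrow> carrier E}"

lemma w_closed [simp]: "i \<le> m \<Longrightarrow> w i \<in> carrier E"
  by (simp add: w_def)

lemma J_elt: "r \<in> {1..m} \<rightarrow> carrier E \<Longrightarrow> (\<Oplus>\<^bsub>E\<^esub>i\<in>{1..m}. r i \<otimes>\<^bsub>E\<^esub> w i) \<in> J"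
  unfolding J_def by blast

lemma J_add:
  assumes "X \<in> J" "Y \<in> J"
  shows "X \<oplus>\<^bsub>E\<^esub> Y \<in> J"
proof -
  obtain r s where r: "r \<in> {1..m} \<rightarrow> carrier E" "X = (\<Oplus>\<^bsub>E\<^esub>i\<in>{1..m}. r i \<otimes>\<^bsub>E\<^esub> w i)"
    and s: "s \<in> {1..m} \<rightarrow> carrier E" "Y = (\<Oplus>\<^bsub>E\<^esub>i\<in>{1..m}. s i \<otimes>\<^bsub>E\<^esub> w i)"
    using assms unfolding J_def by blast
  have "(\<Oplus>\<^bsub>E\<^esub>i\<in>{1..m}. (r i \<oplus>\<^bsub>E\<^esub> s i) \<otimes>\<^bsub>E\<^esub> w i) = (\<Oplus>\<^bsub>E\<^esub>i\<in>{1..m}. r i \<otimes>\<^bsub>E\<^esub> w i \<oplus>\<^bsub>E\<^esub> s i \<otimes>\<^bsub>E\<^esub> w i)"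
    using r(1) s(1) by (intro EA.E.A.finsum_cong') (auto simp: Pi_iff EA.E.A.l_distr)
  also have "\<dots> = X \<oplus>\<^bsub>E\<^esub> Y"
    unfolding r(2) s(2) using r(1) s(1) by (intro EA.E.A.finsum_addf) (auto simp: Pi_iff)
  finally show ?thesis
    using J_elt[of "\<lambda>i. r i \<oplus>\<^bsub>E\<^esub> s i"] r(1) s(1) by (auto simp: Pi_iff)
qed

lemma J_mult:
  assumes "X \<in> J" "Y \<in> carrier E"
  shows "Y \<otimes>\<^bsub>E\<^esub> X \<in> J"
proof -
  obtain r where r: "r \<in> {1..m} \<rightarrow> carrier E" "X = (\<Oplus>\<^bsub>E\<^esub>i\<in>{1..m}. r i \<otimes>\<^bsub>E\<^esub> w i)"
    using assms unfolding J_def by blast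
  have "Y \<otimes>\<^bsub>E\<^esub> X = (\<Oplus>\<^bsub>E\<^esub>i\<in>{1..m}. Y \<otimes>\<^bsub>E\<^esub> (r i \<otimes>\<^bsub>E\<^esub> w i))"
    unfolding r(2) using r(1) assms(2) by (intro EA.E.A.finsum_rdistr) (auto simp: Pi_iff)
  also have "\<dots> = (\<Oplus>\<^bsub>E\<^esub>i\<in>{1..m}. (Y \<otimes>\<^bsub>E\<^esub> r i) \<otimes>\<^bsub>E\<^esub> w i)"
    using r(1) assms(2) by (intro EA.E.A.finsum_cong') (auto simp: Pi_iff EA.E.A.m_assoc)
  finally show ?thesis
    using J_elt[of "\<lambda>i. Y \<otimes>\<^bsub>E\<^esub> r i"] r(1) assms(2) by (auto simp: Pi_iff)
qed

lemma J_subset: "J \<subseteq> carrier E"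
  unfolding J_def by (auto simp: Pi_iff intro!: EA.E.A.finsum_closed)

lemma J_zero: "\<zero>\<^bsub>E\<^esub> \<in> J"
proof -
  have "(\<Oplus>\<^bsub>E\<^esub>i\<in>{1..m}. \<zero>\<^bsub>E\<^esub> \<otimes>\<^bsub>E\<^esub> w i) = \<zero>\<^bsub>E\<^esub>"
    by (rule EA.E.A.add.finprod_one_eqI) simp
  then show ?thesis using J_elt[of "\<lambda>_. \<zero>\<^bsub>E\<^esub>"] by simp
qed

lemma J_submodule: "submodule J K E"
proof (rule EA.E.L.submoduleI[OF J_subset J_zero J_add])
  show "k \<odot>\<^bsub>E\<^esub> X \<in> J" if "k \<in> carrier K" "X \<in> J" for k X
    using J_mult[OF that(2), of "k \<odot>\<^bsub>E\<^esub> \<one>\<^bsub>E\<^esub>"] that J_subset by (auto simp: EA.E.smult_mult_l)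
qed

lemma w_in_J: "\<lbrakk>1 \<le> i; i \<le> m\<rbrakk> \<Longrightarrow> w i \<in> J"
proof -
  assume i: "1 \<le> i" "i \<le> m"
  have "(\<Oplus>\<^bsub>E\<^esub>j\<in>{1..m}. (if i = j then \<one>\<^bsub>E\<^esub> else \<zero>\<^bsub>E\<^esub>) \<otimes>\<^bsub>E\<^esub> w j) = (\<Oplus>\<^bsub>E\<^esub>j\<in>{1..m}. if i = j then w j else \<zero>\<^bsub>E\<^esub>)"
    by (intro EA.E.A.finsum_cong') auto
  also have "\<dots> = w i" using i by (intro EA.E.A.finsum_singleton) auto
  finally show ?thesis using J_elt[of "\<lambda>j. if i = j then \<one>\<^bsub>E\<^esub> else \<zero>\<^bsub>E\<^esub>"] by auto
qed

text \<open>
  The elements \<open>a\<close> with \<open>a \<otimes> 1 - 1 \<otimes> a\<close> in the left ideal generated by the \<open>w\<^sub>i\<close> form a subalgebra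
  that is closed under inverses.
\<close>

lemma universal_derivation_in_J:
  assumes a: "a \<in> carrier A"
  shows "lmul a \<ominus>\<^bsub>E\<^esub> rmul a \<in> J"
proof -
  let ?d = "\<lambda>a. lmul a \<ominus>\<^bsub>E\<^esub> rmul a"
  interpret d: linear_map K A E ?d
    by (intro linear_mapI A_mod E_mod
        EA.E.L.lin_maps_diff EA.\<tau>_l_lin EA.\<tau>_r_lin) simp_all
  let ?H = "{a \<in> carrier A. ?d a \<in> J}"
  have sub: "submodule ?H K A" by (rule d.preimage_submodule[OF J_submodule])
  have one: "?d \<one>\<^bsub>A\<^esub> = \<zero>\<^bsub>E\<^esub>" by (simp add: EA.E.A.r_neg a_minus_def)
  have mult: "?d (a \<otimes>\<^bsub>A\<^esub> b) \<in> J" if a: "a \<in> carrier A" "?d a \<in> J" and b: "b \<in> carrier A" "?d b \<in> J" for a b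
  proof -
    have "lmul a \<otimes>\<^bsub>E\<^esub> ?d b \<oplus>\<^bsub>E\<^esub> rmul b \<otimes>\<^bsub>E\<^esub> ?d a
        = (lmul (a \<otimes>\<^bsub>A\<^esub> b) \<ominus>\<^bsub>E\<^esub> \<tau> a b) \<oplus>\<^bsub>E\<^esub> (\<tau> a b \<ominus>\<^bsub>E\<^esub> rmul (a \<otimes>\<^bsub>A\<^esub> b))"
      using a b by (simp add: a_minus_def EA.E.A.r_distr EA.E.A.r_minus EA.\<tau>_mult)
    also have "\<dots> = ?d (a \<otimes>\<^bsub>A\<^esub> b)"
      using a b by (simp add: a_minus_def EA.E.A.a_assoc EA.E.A.r_neg1)
    finally show ?thesis
      using J_add[OF J_mult[OF b(2), of "lmul a"] J_mult[OF a(2), of "rmul b"]] a b by simp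
  qed
  have cH: "c \<in> ?H"
  proof -
    have "\<forall>n\<le>Suc m. continuant A z n \<in> ?H"
    proof (intro allI impI)
      fix n show "n \<le> Suc m \<Longrightarrow> continuant A z n \<in> ?H"
      proof (induction n rule: less_induct)
        case (less n)
        consider "n = 0" | "n = Suc 0" | j where "n = Suc (Suc j)" by (metis not0_implies_Suc)
        then show ?case
        proof cases
          case 1 then show ?thesis using A.L.submodule_zero[OF sub] by simp
        next
          case 2 then show ?thesis using one J_zero by simp
        next
          case 3
          have zH: "z (Suc j) \<in> carrier A" "?d (z (Suc j)) \<in> J"
            using w_in_J[of "Suc j"] 3 less.prems by (auto simp: w_def)
          have h: "continuant A z (Suc j) \<in> ?H" "continuant A z j \<in> ?H"
            using less 3 by simp_all
          then have "z (Suc j) \<otimes>\<^bsub>A\<^esub> continuant A z (Suc j) \<in> ?H" using mult zH by simp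
          from A.L.submodule_add[OF sub this h(2)] show ?thesis by (simp only: 3 continuant.simps)
        qed
      qed
    qed
    then show ?thesis by (simp add: c_def)
  qed
  have y_eq: "?d y = \<ominus>\<^bsub>E\<^esub> (\<tau> y y \<otimes>\<^bsub>E\<^esub> ?d c)"
  proof -
    have "\<tau> y y \<otimes>\<^bsub>E\<^esub> ?d c = rmul y \<ominus>\<^bsub>E\<^esub> lmul y"
      by (simp add: a_minus_def EA.E.A.r_distr EA.E.A.r_minus EA.\<tau>_mult y_c c_y)
    then show ?thesis by (simp add: a_minus_def EA.E.A.minus_add EA.E.A.a_comm)
  qed
  have "a \<in> ?H"
  proof (rule A_induct[OF sub _ _ _ _ a])
    show "\<one>\<^bsub>A\<^esub> \<in> ?H" using one J_zero by simp
    show "y \<in> ?H"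
      using EA.E.L.submodule_neg[OF J_submodule] J_mult[of "?d c" "\<tau> y y"] cH by (simp add: y_eq)
    show "z i \<in> ?H" if "1 \<le> i" "i \<le> m" for i using w_in_J[OF that] that by (simp add: w_def)
  qed (use mult in simp_all)
  then show ?thesis by blast
qed

abbreviation \<epsilon> where "\<epsilon> X \<equiv> X \<odot>\<^bsub>env_left K A\<^esub> \<one>\<^bsub>A\<^esub>"

lemma \<epsilon>_w: "i \<le> m \<Longrightarrow> \<epsilon> (w i) = \<zero>\<^bsub>A\<^esub>"
proof -
  interpret \<epsilon>: linear_map K E A "\<lambda>X. \<epsilon> X"
    by (intro linear_mapI E_mod A_mod EA.env_left_lin) simp
  show "i \<le> m \<Longrightarrow> \<epsilon> (w i) = \<zero>\<^bsub>A\<^esub>"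
    by (simp add: w_def \<epsilon>.diff EA.env_left_\<tau> A.A.a_minus_eq_zero_iff)
qed

text \<open>Modulo \<open>J\<close>, every element of \<open>A \<otimes> A\<close> is congruent to one of the form \<open>1 \<otimes> a\<close>.\<close>

lemma kernel_\<epsilon>:
  assumes X: "X \<in> carrier E" "\<epsilon> X = \<zero>\<^bsub>A\<^esub>"
  shows "X \<in> J"
proof -
  have lin: "(\<lambda>X. X \<ominus>\<^bsub>E\<^esub> rmul (\<epsilon> X)) \<in> lin_maps K E E"
    using EA.E.L.lin_maps_diff[OF E_mod _
        lin_maps_compose[OF EA.env_left_lin EA.\<tau>_r_lin], of "\<lambda>X. X"]
    by (simp add: lin_mapsI)
  interpret f: linear_map K E E "\<lambda>X. X \<ominus>\<^bsub>E\<^esub> rmul (\<epsilon> X)"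
    by (rule linear_mapI[OF E_mod E_mod lin])
  have "X \<in> {X \<in> carrier E. X \<ominus>\<^bsub>E\<^esub> rmul (\<epsilon> X) \<in> J}"
  proof (rule EA.E_span[OF f.preimage_submodule[OF J_submodule] _ X(1)])
    fix a b assume ab: "a \<in> carrier A" "b \<in> carrier A"
    have "\<tau> a b \<ominus>\<^bsub>E\<^esub> rmul (\<epsilon> (\<tau> a b)) = rmul b \<otimes>\<^bsub>E\<^esub> (lmul a \<ominus>\<^bsub>E\<^esub> rmul a)"
      using ab by (simp add: EA.env_left_\<tau> a_minus_def EA.E.A.r_distr EA.E.A.r_minus EA.\<tau>_mult)
    then show "\<tau> a b \<in> {X \<in> carrier E. X \<ominus>\<^bsub>E\<^esub> rmul (\<epsilon> X) \<in> J}"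
      using J_mult[OF universal_derivation_in_J[OF ab(1)], of "rmul b"] ab by simp
  qed
  then have "X \<ominus>\<^bsub>E\<^esub> rmul (\<epsilon> X) \<in> J" by blast
  then show ?thesis
    using X EA.rmul.zero by (simp add: a_minus_def)
qed

text \<open>
  The coefficients with respect to the \<open>w\<^sub>i\<close> are unique: if \<open>D\<close> is the derivation with
  \<open>D z\<^sub>j = \<delta>\<^sub>i\<^sub>j\<close>, then \<open>a \<otimes> b \<mapsto> (D a) b\<close> extracts the coefficient of \<open>w\<^sub>i\<close>.
\<close>

lemma coefficient_exists:
  assumes i: "1 \<le> i" "i \<le> m"
  shows "\<exists>\<Phi>\<in>lin_maps K E E. \<forall>r\<in>{1..m} \<rightarrow> carrier E. \<Phi> (\<Oplus>\<^bsub>E\<^esub>j\<in>{1..m}. r j \<otimes>\<^bsub>E\<^esub> w j) = r i"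
proof -
  let ?\<delta> = "\<lambda>j. if i = j then \<one>\<^bsub>E\<^esub> else \<zero>\<^bsub>E\<^esub>"
  obtain D where D: "D \<in> lin_maps K A E" and Dz: "\<And>j. \<lbrakk>1 \<le> j; j \<le> m\<rbrakk> \<Longrightarrow> D (z j) = ?\<delta> j"
    and Dmult: "\<And>a b. \<lbrakk>a \<in> carrier A; b \<in> carrier A\<rbrakk>
      \<Longrightarrow> D (a \<otimes>\<^bsub>A\<^esub> b) = lmul a \<otimes>\<^bsub>E\<^esub> D b \<oplus>\<^bsub>E\<^esub> rmul b \<otimes>\<^bsub>E\<^esub> D a"
    by (rule derivation_exists[of ?\<delta>]) (simp, blast)
  interpret D: linear_map K A E D
    by (rule linear_mapI[OF A_mod E_mod D])
  let ?\<phi> = "\<lambda>a b. rmul b \<otimes>\<^bsub>E\<^esub> D a"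
  have bal: "balanced K (regular K) A (opposite A) E ?\<phi>"
    by (rule EA.bilinear_balanced)
      (simp_all add: D.add D.smult EA.rmul.add EA.rmul.smult EA.E.A.l_distr EA.E.A.r_distr
        EA.E.smult_mult_l EA.E.smult_mult_r)
  let ?\<Phi> = "tensor_lift K E ?\<phi>"
  note \<Phi> = EA.E_lift[OF E_mod bal]
  interpret \<Phi>: linear_map K E E ?\<Phi>
    by (rule linear_mapI[OF E_mod E_mod \<Phi>(1)])
  have val: "?\<Phi> (X \<otimes>\<^bsub>E\<^esub> w j) = X \<otimes>\<^bsub>E\<^esub> ?\<delta> j" if j: "1 \<le> j" "j \<le> m" and X: "X \<in> carrier E" for X j
  proof (rule EA.E_eqI[OF E_mod
        lin_maps_compose[OF EA.E.mult_right_lin \<Phi>(1)] EA.E.mult_right_lin _ X])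
    show "w j \<in> carrier E" "?\<delta> j \<in> carrier E" using j by simp_all
    fix a b assume ab: "a \<in> carrier A" "b \<in> carrier A"
    have Da: "D a \<in> carrier E" using ab by simp
    have "\<tau> a b \<otimes>\<^bsub>E\<^esub> w j = \<tau> (a \<otimes>\<^bsub>A\<^esub> z j) b \<ominus>\<^bsub>E\<^esub> \<tau> a (z j \<otimes>\<^bsub>A\<^esub> b)"
      using ab j by (simp add: w_def a_minus_def EA.E.A.r_distr EA.E.A.r_minus EA.\<tau>_mult)
    then have "?\<Phi> (\<tau> a b \<otimes>\<^bsub>E\<^esub> w j)
        = rmul b \<otimes>\<^bsub>E\<^esub> (lmul a \<otimes>\<^bsub>E\<^esub> ?\<delta> j \<oplus>\<^bsub>E\<^esub> rmul (z j) \<otimes>\<^bsub>E\<^esub> D a) \<ominus>\<^bsub>E\<^esub> rmul (z j \<otimes>\<^bsub>A\<^esub> b) \<otimes>\<^bsub>E\<^esub> D a"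
      using ab j by (simp only: \<Phi>.diff \<Phi>(2) Dmult Dz z_closed A.A.m_closed EA.\<tau>_closed)
    also have "\<dots> = (rmul b \<otimes>\<^bsub>E\<^esub> lmul a) \<otimes>\<^bsub>E\<^esub> ?\<delta> j"
    proof -
      have "rmul b \<otimes>\<^bsub>E\<^esub> (lmul a \<otimes>\<^bsub>E\<^esub> q \<oplus>\<^bsub>E\<^esub> rmul (z j) \<otimes>\<^bsub>E\<^esub> D a) \<ominus>\<^bsub>E\<^esub> rmul (z j \<otimes>\<^bsub>A\<^esub> b) \<otimes>\<^bsub>E\<^esub> D a
          = (rmul b \<otimes>\<^bsub>E\<^esub> lmul a) \<otimes>\<^bsub>E\<^esub> q" if "q \<in> carrier E" for q
        using that ab j Da
        by (simp add: EA.rmul_mult EA.E.A.r_distr EA.E.A.m_assoc a_minus_def EA.E.A.a_assoc EA.E.A.r_neg)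
      then show ?thesis by simp
    qed
    finally show "?\<Phi> (\<tau> a b \<otimes>\<^bsub>E\<^esub> w j) = \<tau> a b \<otimes>\<^bsub>E\<^esub> ?\<delta> j"
      using ab by (simp only: EA.rmul_lmul)
  qed
  have "?\<Phi> (\<Oplus>\<^bsub>E\<^esub>j\<in>{1..m}. r j \<otimes>\<^bsub>E\<^esub> w j) = r i" if r: "r \<in> {1..m} \<rightarrow> carrier E" for r
  proof -
    have "?\<Phi> (\<Oplus>\<^bsub>E\<^esub>j\<in>{1..m}. r j \<otimes>\<^bsub>E\<^esub> w j) = (\<Oplus>\<^bsub>E\<^esub>j\<in>{1..m}. ?\<Phi> (r j \<otimes>\<^bsub>E\<^esub> w j))"
      using r by (intro \<Phi>.finsum) (auto simp: Pi_iff)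
    also have "\<dots> = (\<Oplus>\<^bsub>E\<^esub>j\<in>{1..m}. if i = j then r j else \<zero>\<^bsub>E\<^esub>)"
      using r by (intro EA.E.A.finsum_cong') (auto simp: Pi_iff val)
    also have "\<dots> = r i" using r i by (intro EA.E.A.finsum_singleton) (auto simp: Pi_iff)
    finally show ?thesis .
  qed
  with \<Phi>(1) show ?thesis by blast
qed

text \<open>
  The coefficient of \<open>w\<^sub>i\<close>. It is \<open>K\<close>-linear on all of \<open>E\<close>, but only on \<open>J\<close> is it meaningful and, by
  uniqueness, \<open>E\<close>-linear.
\<close>

definition coef where "coef i = (SOME \<Phi>. \<Phi> \<in> lin_maps K E E \<and>
  (\<forall>r\<in>{1..m} \<rightarrow> carrier E. \<Phi> (\<Oplus>\<^bsub>E\<^esub>j\<in>{1..m}. r j \<otimes>\<^bsub>E\<^esub> w j) = r i))"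

lemma coef:
  assumes "1 \<le> i" "i \<le> m"
  shows coef_lin: "coef i \<in> lin_maps K E E"
    and coef_sum: "\<And>r. r \<in> {1..m} \<rightarrow> carrier E \<Longrightarrow> coef i (\<Oplus>\<^bsub>E\<^esub>j\<in>{1..m}. r j \<otimes>\<^bsub>E\<^esub> w j) = r i"
  using someI_ex[of "\<lambda>\<Phi>. \<Phi> \<in> lin_maps K E E \<and>
    (\<forall>r\<in>{1..m} \<rightarrow> carrier E. \<Phi> (\<Oplus>\<^bsub>E\<^esub>j\<in>{1..m}. r j \<otimes>\<^bsub>E\<^esub> w j) = r i)"] coefficient_exists[OF assms]
  unfolding coef_def[symmetric] by blast+

lemma J_expand:
  assumes "X \<in> J"
  shows "(\<Oplus>\<^bsub>E\<^esub>i\<in>{1..m}. coef i X \<otimes>\<^bsub>E\<^esub> w i) = X"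
proof -
  obtain r where r: "r \<in> {1..m} \<rightarrow> carrier E" "X = (\<Oplus>\<^bsub>E\<^esub>i\<in>{1..m}. r i \<otimes>\<^bsub>E\<^esub> w i)"
    using assms unfolding J_def by blast
  then have "coef i X = r i" if "i \<in> {1..m}" for i using that coef_sum by simp
  then show ?thesis unfolding r(2)
    using r(1) by (intro EA.E.A.finsum_cong') (auto simp: Pi_iff)
qed

lemma coef_mult:
  assumes "X \<in> J" "Y \<in> carrier E" "1 \<le> i" "i \<le> m"
  shows "coef i (Y \<otimes>\<^bsub>E\<^esub> X) = Y \<otimes>\<^bsub>E\<^esub> coef i X"
proof -
  have X: "X \<in> carrier E" using assms(1) J_subset by blast
  have cl: "coef j X \<in> carrier E" if "j \<in> {1..m}" for j
    using that lin_maps_closed[OF coef_lin X] by simp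
  have "Y \<otimes>\<^bsub>E\<^esub> X = (\<Oplus>\<^bsub>E\<^esub>j\<in>{1..m}. Y \<otimes>\<^bsub>E\<^esub> (coef j X \<otimes>\<^bsub>E\<^esub> w j))"
    using cl assms(2) by (subst J_expand[OF assms(1), symmetric], intro EA.E.A.finsum_rdistr) auto
  also have "\<dots> = (\<Oplus>\<^bsub>E\<^esub>j\<in>{1..m}. (Y \<otimes>\<^bsub>E\<^esub> coef j X) \<otimes>\<^bsub>E\<^esub> w j)"
    using cl assms(2) by (intro EA.E.A.finsum_cong') (auto simp: EA.E.A.m_assoc)
  finally show ?thesis
    using coef_sum[OF assms(3,4), of "\<lambda>j. Y \<otimes>\<^bsub>E\<^esub> coef j X"] cl assms(2) by simp
qed

lemma coef_w:
  assumes "1 \<le> i" "i \<le> m" "1 \<le> j" "j \<le> m"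
  shows "coef i (w j) = (if i = j then \<one>\<^bsub>E\<^esub> else \<zero>\<^bsub>E\<^esub>)"
proof -
  have "(\<Oplus>\<^bsub>E\<^esub>k\<in>{1..m}. (if j = k then \<one>\<^bsub>E\<^esub> else \<zero>\<^bsub>E\<^esub>) \<otimes>\<^bsub>E\<^esub> w k) = (\<Oplus>\<^bsub>E\<^esub>k\<in>{1..m}. if j = k then w k else \<zero>\<^bsub>E\<^esub>)"
    by (intro EA.E.A.finsum_cong') auto
  also have "\<dots> = w j" using assms by (intro EA.E.A.finsum_singleton) auto
  finally show ?thesis
    using coef_sum[OF assms(1,2), of "\<lambda>k. if j = k then \<one>\<^bsub>E\<^esub> else \<zero>\<^bsub>E\<^esub>"] by auto
qed

end

section \<open>Null homotopies on projective resolutions\<close>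

text \<open>
  The homotopy is built by degree: once \<open>h n\<close> is chosen, \<open>\<theta> (n + 1) - h n \<circ> d n\<close> takes values in the
  cycles, which are boundaries by exactness, and projectivity lifts it through \<open>d (n + 1)\<close>.
\<close>

lemma null_homotopy:
  assumes res: "projective_resolution R N P d e" and N: "left_module R N"
    and \<theta>: "\<And>n. \<theta> n \<in> lin_maps R (P n) (P n)"
    and chain: "\<And>n x. x \<in> carrier (P (Suc n)) \<Longrightarrow> d n (\<theta> (Suc n) x) = \<theta> n (d n x)"
    and aug: "\<And>x. x \<in> carrier (P 0) \<Longrightarrow> e (\<theta> 0 x) = \<zero>\<^bsub>N\<^esub>"
  obtains h where "\<And>n. h n \<in> lin_maps R (P n) (P (Suc n))"
    and "\<And>x. x \<in> carrier (P 0) \<Longrightarrow> d 0 (h 0 x) = \<theta> 0 x"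
    and "\<And>n x. x \<in> carrier (P (Suc n)) \<Longrightarrow>
      d (Suc n) (h (Suc n) x) = \<theta> (Suc n) x \<ominus>\<^bsub>P (Suc n)\<^esub> h n (d n x)"
proof -
  have proj: "projective R (P n)" and dl: "d n \<in> lin_maps R (P (Suc n)) (P n)" for n
    using res unfolding projective_resolution_def by auto
  have P: "left_module R (P n)" for n using proj unfolding projective_def by blast
  have im0: "d 0 ` carrier (P (Suc 0)) = {x \<in> carrier (P 0). e x = \<zero>\<^bsub>N\<^esub>}"
    and im: "d (Suc n) ` carrier (P (Suc (Suc n))) = {x \<in> carrier (P (Suc n)). d n x = \<zero>\<^bsub>P n\<^esub>}" for n
    using res unfolding projective_resolution_def by auto
  interpret P: left_module R "P n" for n by (rule P)
  interpret d: linear_map R "P (Suc n)" "P n" "d n" for n by (rule linear_mapI[OF P P dl])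
  interpret \<theta>: linear_map R "P n" "P n" "\<theta> n" for n by (rule linear_mapI[OF P P \<theta>])
  have dd: "d n (d (Suc n) x) = \<zero>\<^bsub>P n\<^esub>" if "x \<in> carrier (P (Suc (Suc n)))" for n x
    using im[of n] that by blast
  \<comment> \<open>The middle conjunct is what makes \<open>\<theta> (n + 1) - h n \<circ> d n\<close> cycle-valued. It holds in degree 0 by
    the choice of \<open>h 0\<close> and afterwards because \<open>d \<circ> d = 0\<close>.\<close>
  let ?inv = "\<lambda>n h. h \<in> lin_maps R (P n) (P (Suc n)) \<and>
    (\<forall>x\<in>carrier (P (Suc n)). d n (h (d n x)) = \<theta> n (d n x)) \<and>
    (n = 0 \<longrightarrow> (\<forall>x\<in>carrier (P 0). d 0 (h x) = \<theta> 0 x))"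
  let ?step = "\<lambda>n h h'. \<forall>x\<in>carrier (P (Suc n)). d (Suc n) (h' x) = \<theta> (Suc n) x \<ominus>\<^bsub>P (Suc n)\<^esub> h (d n x)"
  have "\<exists>h. \<forall>n. ?inv n (h n) \<and> ?step n (h n) (h (Suc n))"
  proof (rule dependent_nat_choice)
    have "\<theta> 0 x \<in> d 0 ` carrier (P (Suc 0))" if "x \<in> carrier (P 0)" for x
      unfolding im0 using that aug by simp
    from projective_lift[OF proj P P dl \<theta> this]
    obtain h where "h \<in> lin_maps R (P 0) (P (Suc 0))" "\<forall>x\<in>carrier (P 0). d 0 (h x) = \<theta> 0 x" by blast
    then show "\<exists>h. ?inv 0 h" by auto
  next
    fix h n assume h: "?inv n h"
    then have hl: "h \<in> lin_maps R (P n) (P (Suc n))" by blast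
    interpret h: linear_map R "P n" "P (Suc n)" h by (rule linear_mapI[OF P P hl])
    let ?f = "\<lambda>x. \<theta> (Suc n) x \<ominus>\<^bsub>P (Suc n)\<^esub> h (d n x)"
    have f: "?f \<in> lin_maps R (P (Suc n)) (P (Suc n))"
      by (rule P.lin_maps_diff[OF P \<theta> lin_maps_compose[OF dl hl]])
    have "d n (?f x) = \<zero>\<^bsub>P n\<^esub>" if x: "x \<in> carrier (P (Suc n))" for x
      using x h by (simp add: d.diff chain P.M.a_minus_eq_zero_iff)
    then have "?f x \<in> d (Suc n) ` carrier (P (Suc (Suc n)))" if "x \<in> carrier (P (Suc n))" for x
      unfolding im using that by simp
    from projective_lift[OF proj P P dl f this]
    obtain h' where h': "h' \<in> lin_maps R (P (Suc n)) (P (Suc (Suc n)))" "?step n h h'" by blast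
    have "d (Suc n) (h' (d (Suc n) x)) = \<theta> (Suc n) (d (Suc n) x)" if x: "x \<in> carrier (P (Suc (Suc n)))" for x
      using h'(2) x by (simp add: dd a_minus_def P.M.a_inv_zero)
    then show "\<exists>h'. ?inv (Suc n) h' \<and> ?step n h h'" using h' by auto
  qed
  then obtain h where "\<forall>n. ?inv n (h n) \<and> ?step n (h n) (h (Suc n))" by (rule exE)
  then have h: "?inv n (h n)" "?step n (h n) (h (Suc n))" for n by simp_all
  show thesis
  proof (rule that[of h])
    show "h n \<in> lin_maps R (P n) (P (Suc n))" for n using h(1)[of n] by (rule conjunct1)
    show "d 0 (h 0 x) = \<theta> 0 x" if "x \<in> carrier (P 0)" for x using h(1)[of 0] that by simp
    show "d (Suc n) (h (Suc n) x) = \<theta> (Suc n) x \<ominus>\<^bsub>P (Suc n)\<^esub> h n (d n x)"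
      if "x \<in> carrier (P (Suc n))" for n x using h(2)[of n] that by (rule bspec)
  qed
qed

section \<open>Hochschild homology of the localization\<close>

locale hochschild = localization_env +
  fixes P :: "nat \<Rightarrow> (((nat list \<Rightarrow> 'a) set \<times> (nat list \<Rightarrow> 'a) set \<Rightarrow> 'a) set, 'p) module"
    and d :: "nat \<Rightarrow> 'p \<Rightarrow> 'p" and e :: "'p \<Rightarrow> (nat list \<Rightarrow> 'a) set"
  assumes resolution: "projective_resolution E (env_left K A) P d e"
begin

lemma P_projective: "projective E (P n)"
  and d_lin: "d n \<in> lin_maps E (P (Suc n)) (P n)"
  and e_lin: "e \<in> lin_maps E (P 0) (env_left K A)"
  using resolution unfolding projective_resolution_def by auto

sublocale P: left_module E "P n" for n
  using P_projective unfolding projective_def by blast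

sublocale d: linear_map E "P (Suc n)" "P n" "d n" for n
  by (rule linear_mapI[OF P.left_module_axioms P.left_module_axioms d_lin])

sublocale e: linear_map E "P 0" "env_left K A" e
  by (rule linear_mapI[OF P.left_module_axioms EA.env_left_module e_lin])

lemma e_surj: "e ` carrier (P 0) = carrier A"
  and im_d0: "d 0 ` carrier (P (Suc 0)) = {x \<in> carrier (P 0). e x = \<zero>\<^bsub>A\<^esub>}"
  and im_d: "d (Suc n) ` carrier (P (Suc (Suc n))) = {x \<in> carrier (P (Suc n)). d n x = \<zero>\<^bsub>P n\<^esub>}"
  using resolution unfolding projective_resolution_def by auto

lemma e_d0: "x \<in> carrier (P (Suc 0)) \<Longrightarrow> e (d 0 x) = \<zero>\<^bsub>A\<^esub>"
  using im_d0 by blast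

lemma d_d: "x \<in> carrier (P (Suc (Suc n))) \<Longrightarrow> d n (d (Suc n) x) = \<zero>\<^bsub>P n\<^esub>"
  using im_d[of n] by blast

subsection \<open>Comparison with the bimodule resolution\<close>

lemma \<epsilon>_lin: "(\<lambda>X. \<epsilon> X) \<in> lin_maps E (regular E) (env_left K A)"
  by (rule lin_mapsI) (use e.N.smult_closed e.N.smult_l_distr e.N.smult_assoc in simp_all)

lemma comparison_exists:
  obtains g0 p0 p where
    "g0 \<in> lin_maps E (P 0) (regular E)" "\<And>x. x \<in> carrier (P 0) \<Longrightarrow> \<epsilon> (g0 x) = e x"
    "p0 \<in> carrier (P 0)" "e p0 = \<one>\<^bsub>A\<^esub>"
    "\<And>i. \<lbrakk>1 \<le> i; i \<le> m\<rbrakk> \<Longrightarrow> p i \<in> carrier (P 1)"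
    "\<And>i. \<lbrakk>1 \<le> i; i \<le> m\<rbrakk> \<Longrightarrow> d 0 (p i) = w i \<odot>\<^bsub>P 0\<^esub> p0"
proof -
  have RM: "left_module E (regular E)" by (rule EA.E.A.regular_left_module)
  have "e x \<in> (\<lambda>X. \<epsilon> X) ` carrier (regular E)" if "x \<in> carrier (P 0)" for x
  proof -
    have "e x \<in> carrier A" using e.closed[OF that] by simp
    then have "e x = \<epsilon> (lmul (e x))" "lmul (e x) \<in> carrier E" by (simp_all add: EA.env_left_\<tau>)
    then show ?thesis unfolding regular_simps by (rule image_eqI)
  qed
  from projective_lift[OF P_projective RM EA.env_left_module \<epsilon>_lin e_lin this]
  obtain g0 where g0: "g0 \<in> lin_maps E (P 0) (regular E)" and \<epsilon>g0: "\<And>x. x \<in> carrier (P 0) \<Longrightarrow> \<epsilon> (g0 x) = e x"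
    by blast
  have "\<one>\<^bsub>A\<^esub> \<in> e ` carrier (P 0)" unfolding e_surj by simp
  then obtain p0 where p0: "p0 \<in> carrier (P 0)" "e p0 = \<one>\<^bsub>A\<^esub>" by auto
  have "\<exists>p. p \<in> carrier (P 1) \<and> d 0 p = w i \<odot>\<^bsub>P 0\<^esub> p0" if "1 \<le> i" "i \<le> m" for i
  proof -
    have "e (w i \<odot>\<^bsub>P 0\<^esub> p0) = \<zero>\<^bsub>A\<^esub>" using that p0 by (simp add: e.smult \<epsilon>_w)
    then have "w i \<odot>\<^bsub>P 0\<^esub> p0 \<in> d 0 ` carrier (P (Suc 0))" unfolding im_d0 using that p0 by simp
    then show ?thesis by auto
  qed
  then obtain p where p: "\<And>i. \<lbrakk>1 \<le> i; i \<le> m\<rbrakk> \<Longrightarrow> p i \<in> carrier (P 1)"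
    and dp: "\<And>i. \<lbrakk>1 \<le> i; i \<le> m\<rbrakk> \<Longrightarrow> d 0 (p i) = w i \<odot>\<^bsub>P 0\<^esub> p0"
    by metis
  show thesis by (rule that[OF g0 \<epsilon>g0 p0 p dp])
qed

end

text \<open>
  A comparison of \<open>P\<close> with the resolution \<open>E\<^sup>m \<longrightarrow> E \<longrightarrow> A\<close>: the map to it is \<open>g0\<close> in degree 0, and
  the map from it sends the basis vectors to \<open>p0\<close> and to the \<open>p i\<close>.
\<close>

locale compared = hochschild +
  fixes g0 p0 p
  assumes g0_lin: "g0 \<in> lin_maps E (P 0) (regular E)"
    and \<epsilon>_g0: "x \<in> carrier (P 0) \<Longrightarrow> \<epsilon> (g0 x) = e x"
    and p0_closed [simp]: "p0 \<in> carrier (P 0)" and e_p0: "e p0 = \<one>\<^bsub>A\<^esub>"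
    and p_closed: "\<lbrakk>1 \<le> i; i \<le> m\<rbrakk> \<Longrightarrow> p i \<in> carrier (P 1)"
    and d_p: "\<lbrakk>1 \<le> i; i \<le> m\<rbrakk> \<Longrightarrow> d 0 (p i) = w i \<odot>\<^bsub>P 0\<^esub> p0"
begin

sublocale g0: linear_map E "P 0" "regular E" g0
  by (rule linear_mapI[OF P.left_module_axioms EA.E.A.regular_left_module g0_lin])

lemma g0_closed [simp]: "x \<in> carrier (P 0) \<Longrightarrow> g0 x \<in> carrier E"
  using g0.closed by simp

lemma g0_d_in_J: "x \<in> carrier (P 1) \<Longrightarrow> g0 (d 0 x) \<in> J"
  by (intro kernel_\<epsilon>) (simp_all add: \<epsilon>_g0 e_d0)

text \<open>
  In degree 1 the map to \<open>E\<^sup>m\<close> is forced, and it is linear because coefficients are unique.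
\<close>

definition g1 where "g1 i x = coef i (g0 (d 0 x))"

lemma g1_lin:
  assumes i: "1 \<le> i" "i \<le> m"
  shows "g1 i \<in> lin_maps E (P 1) (regular E)"
proof (rule lin_mapsI)
  fix x assume x: "x \<in> carrier (P 1)"
  show "g1 i x \<in> carrier (regular E)"
    using lin_maps_closed[OF coef_lin[OF i]] x by (simp add: g1_def)
  show "g1 i (r \<odot>\<^bsub>P 1\<^esub> x) = r \<odot>\<^bsub>regular E\<^esub> g1 i x" if r: "r \<in> carrier E" for r
    using x r coef_mult[OF g0_d_in_J[OF x] r i] by (simp add: g1_def d.smult g0.smult)
  fix x' assume x': "x' \<in> carrier (P 1)"
  show "g1 i (x \<oplus>\<^bsub>P 1\<^esub> x') = g1 i x \<oplus>\<^bsub>regular E\<^esub> g1 i x'"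
    using x x' by (simp add: g1_def d.add g0.add lin_maps_add[OF coef_lin[OF i]])
qed

lemma g1_closed: "\<lbrakk>1 \<le> i; i \<le> m; x \<in> carrier (P 1)\<rbrakk> \<Longrightarrow> g1 i x \<in> carrier E"
  using lin_maps_closed[OF g1_lin] by simp

lemma g1_sum: "x \<in> carrier (P 1) \<Longrightarrow> (\<Oplus>\<^bsub>E\<^esub>i\<in>{1..m}. g1 i x \<otimes>\<^bsub>E\<^esub> w i) = g0 (d 0 x)"
  unfolding g1_def by (rule J_expand[OF g0_d_in_J])

lemma g1_d: "\<lbrakk>1 \<le> i; i \<le> m; x \<in> carrier (P 2)\<rbrakk> \<Longrightarrow> g1 i (d 1 x) = \<zero>\<^bsub>E\<^esub>"
  using lin_maps_zero[OF E_mod E_mod coef_lin]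
    d_d[of x 0] g0.zero by (simp add: g1_def numeral_2_eq_2)

definition f1 where "f1 x = (\<Oplus>\<^bsub>P 1\<^esub>i\<in>{1..m}. g1 i x \<odot>\<^bsub>P 1\<^esub> p i)"

lemma f1_lin: "f1 \<in> lin_maps E (P 1) (P 1)"
proof -
  have "(\<lambda>x. g1 i x \<odot>\<^bsub>P 1\<^esub> p i) \<in> lin_maps E (P 1) (P 1)" if i: "1 \<le> i" "i \<le> m" for i
    using lin_mapsD[OF g1_lin[OF i]] p_closed[OF i]
    by (intro lin_mapsI) (simp_all add: P.smult_l_distr P.smult_assoc)
  then show ?thesis
    unfolding f1_def by (intro P.lin_maps_finsum P.left_module_axioms) auto
qed

lemma d_f1: "x \<in> carrier (P 1) \<Longrightarrow> d 0 (f1 x) = g0 (d 0 x) \<odot>\<^bsub>P 0\<^esub> p0"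
proof -
  assume x: "x \<in> carrier (P 1)"
  have "d 0 (f1 x) = (\<Oplus>\<^bsub>P 0\<^esub>i\<in>{1..m}. d 0 (g1 i x \<odot>\<^bsub>P 1\<^esub> p i))"
    using d.finsum[of "\<lambda>i. g1 i x \<odot>\<^bsub>P 1\<^esub> p i" "{1..m}" 0] g1_closed[OF _ _ x] p_closed
    by (simp add: Pi_iff f1_def)
  also have "\<dots> = (\<Oplus>\<^bsub>P 0\<^esub>i\<in>{1..m}. (g1 i x \<otimes>\<^bsub>E\<^esub> w i) \<odot>\<^bsub>P 0\<^esub> p0)"
    using g1_closed[OF _ _ x] p_closed d.smult[of _ _ 0]
    by (intro P.M.finsum_cong') (auto simp: d_p P.smult_assoc)
  also have "\<dots> = (\<Oplus>\<^bsub>E\<^esub>i\<in>{1..m}. g1 i x \<otimes>\<^bsub>E\<^esub> w i) \<odot>\<^bsub>P 0\<^esub> p0"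
    using g1_closed[OF _ _ x] by (intro P.finsum_smult[symmetric]) auto
  finally show ?thesis unfolding g1_sum[OF x] .
qed

lemma homotopy_exists:
  obtains h where "\<And>n. h n \<in> lin_maps E (P n) (P (Suc n))"
    "\<And>x. x \<in> carrier (P 0) \<Longrightarrow> d 0 (h 0 x) = x \<ominus>\<^bsub>P 0\<^esub> g0 x \<odot>\<^bsub>P 0\<^esub> p0"
    "\<And>x. x \<in> carrier (P 1) \<Longrightarrow> d 1 (h 1 x) = (x \<ominus>\<^bsub>P 1\<^esub> f1 x) \<ominus>\<^bsub>P 1\<^esub> h 0 (d 0 x)"
    "\<And>n x. x \<in> carrier (P (Suc (Suc n))) \<Longrightarrow>
      d (Suc (Suc n)) (h (Suc (Suc n)) x) = x \<ominus>\<^bsub>P (Suc (Suc n))\<^esub> h (Suc n) (d (Suc n) x)"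
proof -
  have id: "(\<lambda>x. x) \<in> lin_maps E (P n) (P n)" for n by (rule lin_mapsI) simp_all
  have f0: "(\<lambda>x. g0 x \<odot>\<^bsub>P 0\<^esub> p0) \<in> lin_maps E (P 0) (P 0)"
    by (intro lin_mapsI) (simp_all add: g0.add g0.smult P.smult_l_distr P.smult_assoc)
  \<comment> \<open>The defect of the composite \<open>P \<longrightarrow> (E\<^sup>m \<longrightarrow> E) \<longrightarrow> P\<close> from the identity.\<close>
  define \<theta> where "\<theta> n = (case n of 0 \<Rightarrow> (\<lambda>x. x \<ominus>\<^bsub>P 0\<^esub> g0 x \<odot>\<^bsub>P 0\<^esub> p0)
    | Suc n' \<Rightarrow> (case n' of 0 \<Rightarrow> (\<lambda>x. x \<ominus>\<^bsub>P 1\<^esub> f1 x) | Suc _ \<Rightarrow> (\<lambda>x. x)))" for n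
  have \<theta>: "\<theta> 0 = (\<lambda>x. x \<ominus>\<^bsub>P 0\<^esub> g0 x \<odot>\<^bsub>P 0\<^esub> p0)" "\<theta> (Suc 0) = (\<lambda>x. x \<ominus>\<^bsub>P 1\<^esub> f1 x)"
    "\<theta> (Suc (Suc n)) = (\<lambda>x. x)" for n
    by (simp_all add: \<theta>_def)
  have \<theta>_lin: "\<theta> n \<in> lin_maps E (P n) (P n)" for n
  proof -
    consider "n = 0" | "n = Suc 0" | k where "n = Suc (Suc k)" by (metis not0_implies_Suc)
    then show ?thesis
    proof cases
      case 1 then show ?thesis using P.lin_maps_diff[OF P.left_module_axioms id f0] by (simp add: \<theta>)
    next
      case 2 then show ?thesis using P.lin_maps_diff[OF P.left_module_axioms id f1_lin] by (simp add: \<theta>)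
    next
      case 3 then show ?thesis by (simp add: \<theta> id)
    qed
  qed
  have chain: "d n (\<theta> (Suc n) x) = \<theta> n (d n x)" if x: "x \<in> carrier (P (Suc n))" for n x
  proof -
    consider "n = 0" | "n = Suc 0" | k where "n = Suc (Suc k)" by (metis not0_implies_Suc)
    then show ?thesis
    proof cases
      case 1
      then show ?thesis
        using x lin_maps_closed[OF f1_lin, of x] d_f1[of x] d.diff[of x 0 "f1 x"] by (simp add: \<theta>)
    next
      case 2
      have "f1 (d 1 x) = \<zero>\<^bsub>P 1\<^esub>"
        unfolding f1_def
        using x 2 p_closed by (intro P.M.add.finprod_one_eqI) (simp add: g1_d[simplified] numeral_2_eq_2)
      then show ?thesis using x 2 d.closed[of x 1] by (simp add: \<theta> a_minus_def P.M.a_inv_zero)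
    qed (simp add: \<theta>)
  qed
  have aug: "e (\<theta> 0 x) = \<zero>\<^bsub>env_left K A\<^esub>" if x: "x \<in> carrier (P 0)" for x
    using x e.closed[OF x]
    by (simp add: \<theta> e.diff e.smult e_p0 \<epsilon>_g0 e.N.M.a_minus_eq_zero_iff del: EA.env_simps)
  obtain h where h: "\<And>n. h n \<in> lin_maps E (P n) (P (Suc n))"
    "\<And>x. x \<in> carrier (P 0) \<Longrightarrow> d 0 (h 0 x) = \<theta> 0 x"
    "\<And>n x. x \<in> carrier (P (Suc n)) \<Longrightarrow> d (Suc n) (h (Suc n) x) = \<theta> (Suc n) x \<ominus>\<^bsub>P (Suc n)\<^esub> h n (d n x)"
    using null_homotopy[OF resolution EA.env_left_module \<theta>_lin chain aug] by blast
  show thesis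
  proof (rule that[OF h(1)])
    show "d 0 (h 0 x) = x \<ominus>\<^bsub>P 0\<^esub> g0 x \<odot>\<^bsub>P 0\<^esub> p0" if "x \<in> carrier (P 0)" for x
      using h(2)[OF that] by (simp add: \<theta>)
    show "d 1 (h 1 x) = (x \<ominus>\<^bsub>P 1\<^esub> f1 x) \<ominus>\<^bsub>P 1\<^esub> h 0 (d 0 x)" if "x \<in> carrier (P 1)" for x
      using h(3)[of x 0] that by (simp add: \<theta>)
    show "d (Suc (Suc n)) (h (Suc (Suc n)) x) = x \<ominus>\<^bsub>P (Suc (Suc n))\<^esub> h (Suc n) (d (Suc n) x)"
      if "x \<in> carrier (P (Suc (Suc n)))" for n x
      using h(3)[OF that] by (simp add: \<theta>)
  qed
qed

text \<open>
  In the other direction, \<open>g0 p0\<close> and \<open>1\<close> have the same image in \<open>A\<close>; their difference is a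
  combination of the \<open>w\<^sub>i\<close>, with coefficients \<open>\<kappa> i\<close>.
\<close>

definition \<kappa> where "\<kappa> i = coef i (g0 p0 \<ominus>\<^bsub>E\<^esub> \<one>\<^bsub>E\<^esub>)"

lemma g0_p0_in_J: "g0 p0 \<ominus>\<^bsub>E\<^esub> \<one>\<^bsub>E\<^esub> \<in> J"
proof (rule kernel_\<epsilon>)
  have "\<epsilon> (g0 p0 \<ominus>\<^bsub>E\<^esub> \<one>\<^bsub>E\<^esub>) = \<epsilon> (g0 p0) \<ominus>\<^bsub>A\<^esub> \<epsilon> \<one>\<^bsub>E\<^esub>"
    by (rule linear_map.diff[OF linear_mapI[OF E_mod A_mod EA.env_left_lin]])
      simp_all
  then show "\<epsilon> (g0 p0 \<ominus>\<^bsub>E\<^esub> \<one>\<^bsub>E\<^esub>) = \<zero>\<^bsub>A\<^esub>"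
    using e.N.smult_one[of "\<one>\<^bsub>A\<^esub>"] by (simp add: \<epsilon>_g0 e_p0 A.A.a_minus_eq_zero_iff)
qed simp

lemma \<kappa>_closed: "\<lbrakk>1 \<le> i; i \<le> m\<rbrakk> \<Longrightarrow> \<kappa> i \<in> carrier E"
  unfolding \<kappa>_def using lin_maps_closed[OF coef_lin] by simp

lemma g0_p0: "g0 p0 = \<one>\<^bsub>E\<^esub> \<oplus>\<^bsub>E\<^esub> (\<Oplus>\<^bsub>E\<^esub>i\<in>{1..m}. \<kappa> i \<otimes>\<^bsub>E\<^esub> w i)"
  unfolding \<kappa>_def J_expand[OF g0_p0_in_J] by (simp add: a_minus_def EA.E.A.a_lcomm EA.E.A.r_neg)

lemma g1_p:
  assumes i: "1 \<le> i" "i \<le> m" and j: "1 \<le> j" "j \<le> m"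
  shows "g1 i (p j) = (if i = j then \<one>\<^bsub>E\<^esub> else \<zero>\<^bsub>E\<^esub>) \<oplus>\<^bsub>E\<^esub> w j \<otimes>\<^bsub>E\<^esub> \<kappa> i"
proof -
  have "g0 (d 0 (p j)) = w j \<otimes>\<^bsub>E\<^esub> g0 p0"
    using j by (simp add: d_p g0.smult)
  also have "\<dots> = w j \<oplus>\<^bsub>E\<^esub> w j \<otimes>\<^bsub>E\<^esub> (g0 p0 \<ominus>\<^bsub>E\<^esub> \<one>\<^bsub>E\<^esub>)"
    using j EA.E.A.a_lcomm[of "w j" "w j \<otimes>\<^bsub>E\<^esub> g0 p0" "\<ominus>\<^bsub>E\<^esub> w j"]
    by (simp add: a_minus_def EA.E.A.r_distr EA.E.A.r_minus EA.E.A.r_neg)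
  finally have "g1 i (p j) = coef i (w j) \<oplus>\<^bsub>E\<^esub> coef i (w j \<otimes>\<^bsub>E\<^esub> (g0 p0 \<ominus>\<^bsub>E\<^esub> \<one>\<^bsub>E\<^esub>))"
    unfolding g1_def using j by (simp add: lin_maps_add[OF coef_lin[OF i]])
  then show ?thesis
    using coef_mult[OF g0_p0_in_J _ i, of "w j"] j by (simp add: coef_w[OF i j] \<kappa>_def)
qed

end

section \<open>The right action and commutators\<close>

context localization_env
begin

text \<open>
  The right action on \<open>A\<close>, written with the module element first: \<open>act x (a \<otimes> b) = b x a\<close>.
\<close>

definition act where "act x X = X \<odot>\<^bsub>env_right K A\<^esub> x"

lemma act_closed [simp]: "\<lbrakk>x \<in> carrier A; X \<in> carrier E\<rbrakk> \<Longrightarrow> act x X \<in> carrier A"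
  unfolding act_def using lin_maps_closed[OF EA.env_right_lin] .

lemma act_lin_r: "x \<in> carrier A \<Longrightarrow> act x \<in> lin_maps K E A"
  unfolding act_def by (rule EA.env_right_lin)

lemma act_one: "x \<in> carrier A \<Longrightarrow> act x \<one>\<^bsub>E\<^esub> = x"
  and act_mult: "\<lbrakk>x \<in> carrier A; X \<in> carrier E; Y \<in> carrier E\<rbrakk>
    \<Longrightarrow> act x (X \<otimes>\<^bsub>E\<^esub> Y) = act (act x X) Y"
  and act_add_l: "\<lbrakk>x \<in> carrier A; x' \<in> carrier A; X \<in> carrier E\<rbrakk>
    \<Longrightarrow> act (x \<oplus>\<^bsub>A\<^esub> x') X = act x X \<oplus>\<^bsub>A\<^esub> act x' X"
proof -
  interpret N: left_module "opposite E" "env_right K A" by (rule EA.env_right_module)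
  show "x \<in> carrier A \<Longrightarrow> act x \<one>\<^bsub>E\<^esub> = x"
    using N.smult_one[of x] by (simp add: act_def)
  show "\<lbrakk>x \<in> carrier A; X \<in> carrier E; Y \<in> carrier E\<rbrakk> \<Longrightarrow> act x (X \<otimes>\<^bsub>E\<^esub> Y) = act (act x X) Y"
    using N.smult_assoc[of Y X x] by (simp add: act_def)
  show "\<lbrakk>x \<in> carrier A; x' \<in> carrier A; X \<in> carrier E\<rbrakk> \<Longrightarrow> act (x \<oplus>\<^bsub>A\<^esub> x') X = act x X \<oplus>\<^bsub>A\<^esub> act x' X"
    using N.smult_r_distr[of X x x'] by (simp add: act_def)
qed

lemma act_k: "\<lbrakk>k \<in> carrier K; x \<in> carrier A\<rbrakk> \<Longrightarrow> act x (k \<odot>\<^bsub>E\<^esub> \<one>\<^bsub>E\<^esub>) = k \<odot>\<^bsub>A\<^esub> x"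
  using lin_maps_smult[OF act_lin_r] by (simp add: act_one)

lemma act_smult_l:
  assumes "k \<in> carrier K" "x \<in> carrier A" "X \<in> carrier E"
  shows "act (k \<odot>\<^bsub>A\<^esub> x) X = k \<odot>\<^bsub>A\<^esub> act x X"
proof -
  have "act (k \<odot>\<^bsub>A\<^esub> x) X = act x ((k \<odot>\<^bsub>E\<^esub> \<one>\<^bsub>E\<^esub>) \<otimes>\<^bsub>E\<^esub> X)"
    using assms by (simp add: act_mult act_k)
  also have "\<dots> = k \<odot>\<^bsub>A\<^esub> act x X"
    using assms lin_maps_smult[OF act_lin_r] by (simp add: EA.E.smult_mult_l)
  finally show ?thesis .
qed

lemma act_lin_l: "X \<in> carrier E \<Longrightarrow> (\<lambda>x. act x X) \<in> lin_maps K A A"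
  by (rule lin_mapsI) (simp_all add: act_add_l act_smult_l)

lemma act_finsum:
  "\<lbrakk>x \<in> carrier A; X \<in> S \<rightarrow> carrier E\<rbrakk> \<Longrightarrow> act x (\<Oplus>\<^bsub>E\<^esub>i\<in>S. X i) = (\<Oplus>\<^bsub>A\<^esub>i\<in>S. act x (X i))"
  by (rule linear_map.finsum[OF linear_mapI[OF E_mod A_mod act_lin_r]])

lemma act_lmul_rmul:
  assumes "x \<in> carrier A" "a \<in> carrier A"
  shows "act x (lmul a \<ominus>\<^bsub>E\<^esub> rmul a) = commutator A x a"
proof -
  interpret f: linear_map K E A "act x"
    using assms by (intro linear_mapI E_mod A_mod act_lin_r)
  show ?thesis
    using assms EA.env_right_\<tau> by (simp add: f.diff commutator_def) (simp add: act_def)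
qed

lemma act_w: "\<lbrakk>x \<in> carrier A; i \<le> m\<rbrakk> \<Longrightarrow> act x (w i) = commutator A x (z i)"
  unfolding w_def by (rule act_lmul_rmul) simp_all

abbreviation b where "b \<equiv> b_map A z m"

lemma b_eq: "a \<in> {1..m} \<rightarrow> carrier A \<Longrightarrow> b a = (\<Oplus>\<^bsub>A\<^esub>i\<in>{1..m}. act (a i) (w i))"
  unfolding b_map_def by (intro A.A.finsum_cong') (auto simp: act_w[symmetric] Pi_iff)

lemma b_closed: "a \<in> {1..m} \<rightarrow> carrier A \<Longrightarrow> b a \<in> carrier A"
  unfolding b_eq by (intro A.A.finsum_closed) (auto simp: Pi_iff)

lemma b_act:
  assumes "x \<in> carrier A" "r \<in> {1..m} \<rightarrow> carrier E"
  shows "b (\<lambda>i. act x (r i)) = act x (\<Oplus>\<^bsub>E\<^esub>i\<in>{1..m}. r i \<otimes>\<^bsub>E\<^esub> w i)"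
proof -
  have "act x (\<Oplus>\<^bsub>E\<^esub>i\<in>{1..m}. r i \<otimes>\<^bsub>E\<^esub> w i) = (\<Oplus>\<^bsub>A\<^esub>i\<in>{1..m}. act x (r i \<otimes>\<^bsub>E\<^esub> w i))"
    using assms by (intro act_finsum) (auto simp: Pi_iff)
  also have "\<dots> = (\<Oplus>\<^bsub>A\<^esub>i\<in>{1..m}. act (act x (r i)) (w i))"
    using assms by (intro A.A.finsum_cong') (auto simp: Pi_iff act_mult)
  also have "\<dots> = b (\<lambda>i. act x (r i))"
    using assms by (intro b_eq[symmetric]) (auto simp: Pi_iff)
  finally show ?thesis by simp
qed

lemma copower_A_module: "left_module K (copower A {1..m})"
  by (rule A.L.copower_left_module)

lemma copower_memD: "a \<in> carrier (copower A {1..m}) \<Longrightarrow> a \<in> {1..m} \<rightarrow> carrier A"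
  by (simp add: mem_copower_iff)

lemma copower_restrict:
  "(\<And>i. i \<in> {1..m} \<Longrightarrow> a i \<in> carrier A) \<Longrightarrow> (\<lambda>i. if i \<in> {1..m} then a i else \<zero>\<^bsub>A\<^esub>) \<in> carrier (copower A {1..m})"
  by (rule mem_copowerI[of _ _ "{1..m}"]) auto

lemma b_restrict: "a \<in> {1..m} \<rightarrow> carrier A \<Longrightarrow> b (\<lambda>i. if i \<in> {1..m} then a i else \<zero>\<^bsub>A\<^esub>) = b a"
  unfolding b_map_def by (intro A.A.finsum_cong') (auto simp: commutator_def Pi_iff)

lemma b_lin: "b \<in> lin_maps K (copower A {1..m}) A"
proof (rule lin_mapsI)
  fix a assume a: "a \<in> carrier (copower A {1..m})"
  have ai: "a i \<in> carrier A" for i using a by (simp add: mem_copower_iff)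
  show "b a \<in> carrier A" by (rule b_closed[OF copower_memD[OF a]])
  show "b (k \<odot>\<^bsub>copower A {1..m}\<^esub> a) = k \<odot>\<^bsub>A\<^esub> b a" if k: "k \<in> carrier K" for k
  proof -
    have "b (\<lambda>i. k \<odot>\<^bsub>A\<^esub> a i) = (\<Oplus>\<^bsub>A\<^esub>i\<in>{1..m}. act (k \<odot>\<^bsub>A\<^esub> a i) (w i))"
      using ai k by (intro b_eq) auto
    also have "\<dots> = (\<Oplus>\<^bsub>A\<^esub>i\<in>{1..m}. k \<odot>\<^bsub>A\<^esub> act (a i) (w i))"
      using ai k by (intro A.A.finsum_cong') (auto simp: act_smult_l)
    also have "\<dots> = k \<odot>\<^bsub>A\<^esub> (\<Oplus>\<^bsub>A\<^esub>i\<in>{1..m}. act (a i) (w i))"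
      using ai k by (intro A.L.smult_finsum[symmetric]) auto
    finally show ?thesis using ai by (simp add: b_eq)
  qed
  fix a' assume a': "a' \<in> carrier (copower A {1..m})"
  have ai': "a' i \<in> carrier A" for i using a' by (simp add: mem_copower_iff)
  have "b (\<lambda>i. a i \<oplus>\<^bsub>A\<^esub> a' i) = (\<Oplus>\<^bsub>A\<^esub>i\<in>{1..m}. act (a i \<oplus>\<^bsub>A\<^esub> a' i) (w i))"
    using ai ai' by (intro b_eq) auto
  also have "\<dots> = (\<Oplus>\<^bsub>A\<^esub>i\<in>{1..m}. act (a i) (w i) \<oplus>\<^bsub>A\<^esub> act (a' i) (w i))"
    using ai ai' by (intro A.A.finsum_cong') (auto simp: act_add_l)
  also have "\<dots> = (\<Oplus>\<^bsub>A\<^esub>i\<in>{1..m}. act (a i) (w i)) \<oplus>\<^bsub>A\<^esub> (\<Oplus>\<^bsub>A\<^esub>i\<in>{1..m}. act (a' i) (w i))"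
    using ai ai' by (intro A.A.finsum_addf) auto
  finally show "b (a \<oplus>\<^bsub>copower A {1..m}\<^esub> a') = b a \<oplus>\<^bsub>A\<^esub> b a'" using ai ai' by (simp add: b_eq)
qed

sublocale b: linear_map K "copower A {1..m}" A b
  by (rule linear_mapI[OF copower_A_module A_mod b_lin])

text \<open>
  Since \<open>x \<otimes> 1 - 1 \<otimes> x\<close> is a combination of the \<open>w\<^sub>i\<close>, every commutator \<open>[a, x]\<close> is a sum of
  commutators with the \<open>z\<^sub>i\<close>.
\<close>

lemma commutator_space_eq: "commutator_space K A = b ` carrier (copower A {1..m})"
proof
  let ?G = "{commutator A a a' | a a'. a \<in> carrier A \<and> a' \<in> carrier A}"
  have G: "?G \<subseteq> carrier A" by (auto simp: commutator_def)
  note span = A.L.lin_span_submodule[OF G]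
  show "commutator_space K A \<subseteq> b ` carrier (copower A {1..m})"
    unfolding commutator_space_def
  proof (rule A.L.lin_span_least[OF b.image_submodule], rule subsetI)
    fix x assume "x \<in> ?G"
    then obtain a a' where a: "a \<in> carrier A" "a' \<in> carrier A" "x = commutator A a a'" by blast
    have "lmul a' \<ominus>\<^bsub>E\<^esub> rmul a' \<in> J" by (rule universal_derivation_in_J[OF a(2)])
    then obtain r where r: "r \<in> {1..m} \<rightarrow> carrier E"
      "lmul a' \<ominus>\<^bsub>E\<^esub> rmul a' = (\<Oplus>\<^bsub>E\<^esub>i\<in>{1..m}. r i \<otimes>\<^bsub>E\<^esub> w i)"
      unfolding J_def by blast
    have ar: "(\<lambda>i. act a (r i)) \<in> {1..m} \<rightarrow> carrier A" using r(1) a(1) by (auto simp: Pi_iff)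
    have "x = b (\<lambda>i. act a (r i))"
      unfolding b_act[OF a(1) r(1)] r(2)[symmetric] using a act_lmul_rmul by simp
    then have "x = b (\<lambda>i. if i \<in> {1..m} then act a (r i) else \<zero>\<^bsub>A\<^esub>)"
      by (simp only: b_restrict[OF ar])
    then show "x \<in> b ` carrier (copower A {1..m})"
      using copower_restrict[of "\<lambda>i. act a (r i)"] ar by (auto simp: Pi_iff)
  qed
  show "b ` carrier (copower A {1..m}) \<subseteq> commutator_space K A"
  proof
    fix x assume "x \<in> b ` carrier (copower A {1..m})"
    then obtain a where "a \<in> carrier (copower A {1..m})" and x: "x = b a" by blast
    then have a: "a i \<in> carrier A" for i by (simp add: mem_copower_iff)
    have "b a \<in> lin_span K A ?G"
      unfolding b_map_def
    proof (rule A.L.submodule_finsum[OF span], rule Pi_I)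
      fix i assume "i \<in> {1..m}"
      then have "z i \<in> carrier A" by simp
      then have "commutator A (a i) (z i) \<in> ?G" using a[of i] by blast
      then show "commutator A (a i) (z i) \<in> lin_span K A ?G"
        using A.L.lin_span_superset[of ?G] by (rule subsetD[rotated])
    qed
    then show "x \<in> commutator_space K A" unfolding x commutator_space_def .
  qed
qed

lemma commutator_submodule: "submodule (commutator_space K A) K A"
  unfolding commutator_space_eq by (rule b.image_submodule)

lemma b_kernel_eq: "b_kernel A z m = (copower A {1..m})\<lparr>carrier := {a \<in> carrier (copower A {1..m}). b a = \<zero>\<^bsub>A\<^esub>}\<rparr>"
  by (simp add: b_kernel_def)

lemma b_kernel_module: "left_module K (b_kernel A z m)"
  unfolding b_kernel_eq by (rule b.M.restrict_left_module[OF b.kernel_submodule])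

end

section \<open>The tensored complex\<close>

context hochschild
begin

abbreviation C where "C n \<equiv> tensor K E (env_right K A) (P n)"
abbreviation tmap where "tmap n f \<equiv> tensor_map K E (env_right K A) (P n) f"

text \<open>
  The class of \<open>x \<otimes> p\<close> in degree \<open>n\<close> of \<open>A \<otimes>\<^sub>E P\<close>.
\<close>

definition ten where "ten n x p =
  tensor_rels K E (env_right K A) (P n) +>\<^bsub>free_module K (carrier (env_right K A) \<times> carrier (P n))\<^esub> basis_elt K (x, p)"

lemma tp: "tensor_product K E (env_right K A) (P n)"
  by (rule EA.env_right_tensor_product[OF P.left_module_axioms])

lemma ten_facts:
  shows ten_closed: "\<lbrakk>x \<in> carrier A; p \<in> carrier (P n)\<rbrakk> \<Longrightarrow> ten n x p \<in> carrier (C n)"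
    and ten_add_l: "\<lbrakk>x \<in> carrier A; x' \<in> carrier A; p \<in> carrier (P n)\<rbrakk>
      \<Longrightarrow> ten n (x \<oplus>\<^bsub>A\<^esub> x') p = ten n x p \<oplus>\<^bsub>C n\<^esub> ten n x' p"
    and ten_add_r: "\<lbrakk>x \<in> carrier A; p \<in> carrier (P n); p' \<in> carrier (P n)\<rbrakk>
      \<Longrightarrow> ten n x (p \<oplus>\<^bsub>P n\<^esub> p') = ten n x p \<oplus>\<^bsub>C n\<^esub> ten n x p'"
    and ten_act: "\<lbrakk>X \<in> carrier E; x \<in> carrier A; p \<in> carrier (P n)\<rbrakk>
      \<Longrightarrow> ten n (act x X) p = ten n x (X \<odot>\<^bsub>P n\<^esub> p)"
    and ten_smult_l: "\<lbrakk>k \<in> carrier K; x \<in> carrier A; p \<in> carrier (P n)\<rbrakk>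
      \<Longrightarrow> ten n (k \<odot>\<^bsub>A\<^esub> x) p = k \<odot>\<^bsub>C n\<^esub> ten n x p"
  using tensor_product.tens_closed[OF tp, of x p n] tensor_product.tens_add_l[OF tp, of x x' p n]
    tensor_product.tens_add_r[OF tp, of x p n p'] tensor_product.tens_mid[OF tp, of X x p n]
    tensor_product.tens_smult[OF tp, of k x p n] act_k[of k x]
  by (simp_all add: ten_def act_def)

lemma C_module: "left_module K (C n)"
  by (rule tensor_product.T_module[OF tp])

lemma C_eqI:
  assumes "left_module K V" "f \<in> lin_maps K (C n) V" "g \<in> lin_maps K (C n) V"
    and "\<And>x p. \<lbrakk>x \<in> carrier A; p \<in> carrier (P n)\<rbrakk> \<Longrightarrow> f (ten n x p) = g (ten n x p)"
    and "X \<in> carrier (C n)"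
  shows "f X = g X"
  using tensor_product.tensor_eqI[OF tp assms(1-3) _ assms(5)] assms(4) by (simp add: ten_def)

lemma C_lift:
  assumes V: "left_module K V"
    and "\<And>x p. \<lbrakk>x \<in> carrier A; p \<in> carrier (P n)\<rbrakk> \<Longrightarrow> \<phi> x p \<in> carrier V"
    and "\<And>x x' p. \<lbrakk>x \<in> carrier A; x' \<in> carrier A; p \<in> carrier (P n)\<rbrakk>
      \<Longrightarrow> \<phi> (x \<oplus>\<^bsub>A\<^esub> x') p = \<phi> x p \<oplus>\<^bsub>V\<^esub> \<phi> x' p"
    and "\<And>x p p'. \<lbrakk>x \<in> carrier A; p \<in> carrier (P n); p' \<in> carrier (P n)\<rbrakk>
      \<Longrightarrow> \<phi> x (p \<oplus>\<^bsub>P n\<^esub> p') = \<phi> x p \<oplus>\<^bsub>V\<^esub> \<phi> x p'"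
    and "\<And>X x p. \<lbrakk>X \<in> carrier E; x \<in> carrier A; p \<in> carrier (P n)\<rbrakk>
      \<Longrightarrow> \<phi> (act x X) p = \<phi> x (X \<odot>\<^bsub>P n\<^esub> p)"
    and smult: "\<And>k x p. \<lbrakk>k \<in> carrier K; x \<in> carrier A; p \<in> carrier (P n)\<rbrakk>
      \<Longrightarrow> \<phi> (k \<odot>\<^bsub>A\<^esub> x) p = k \<odot>\<^bsub>V\<^esub> \<phi> x p"
  shows C_lift_lin: "tensor_lift K V \<phi> \<in> lin_maps K (C n) V"
    and C_lift_ten: "\<And>x p. \<lbrakk>x \<in> carrier A; p \<in> carrier (P n)\<rbrakk> \<Longrightarrow> tensor_lift K V \<phi> (ten n x p) = \<phi> x p"
proof -
  have "balanced K E (env_right K A) (P n) V \<phi>"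
  proof (rule balancedI, unfold EA.env_simps, fold act_def)
    show "\<phi> (act x (k \<odot>\<^bsub>E\<^esub> \<one>\<^bsub>E\<^esub>)) p = k \<odot>\<^bsub>V\<^esub> \<phi> x p"
      if "k \<in> carrier K" "x \<in> carrier A" "p \<in> carrier (P n)" for k x p
      using smult[OF that] act_k[OF that(1,2)] by simp
  qed (fact assms)+
  note lift = tensor_product.tensor_lift[OF tp V this]
  show "tensor_lift K V \<phi> \<in> lin_maps K (C n) V" by (rule lift(1))
  show "\<And>x p. \<lbrakk>x \<in> carrier A; p \<in> carrier (P n)\<rbrakk> \<Longrightarrow> tensor_lift K V \<phi> (ten n x p) = \<phi> x p"
    using lift(2) by (simp add: ten_def)
qed

lemma tmap:
  assumes "f \<in> lin_maps E (P n) (P n')"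
  shows tmap_lin: "tmap n' f \<in> lin_maps K (C n) (C n')"
    and tmap_ten: "\<And>x p. \<lbrakk>x \<in> carrier A; p \<in> carrier (P n)\<rbrakk> \<Longrightarrow> tmap n' f (ten n x p) = ten n' x (f p)"
  using tensor_product.tensor_map[OF tp tp assms] by (simp_all add: ten_def)

abbreviation D where "D n \<equiv> tmap n (d n)"

sublocale C: left_module K "C n" for n by (rule C_module)

sublocale D: linear_map K "C (Suc n)" "C n" "D n" for n
  by (rule linear_mapI[OF C_module C_module tmap_lin[OF d_lin]])

lemma ten_lin_l: "p \<in> carrier (P n) \<Longrightarrow> (\<lambda>x. ten n x p) \<in> lin_maps K A (C n)"
  by (rule lin_mapsI) (simp_all add: ten_closed ten_add_l ten_smult_l)

lemma ten_zero_r: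
  assumes "x \<in> carrier A" shows "ten n x \<zero>\<^bsub>P n\<^esub> = \<zero>\<^bsub>C n\<^esub>"
  using ten_add_r[OF assms P.M.zero_closed P.M.zero_closed, of n] ten_closed[OF assms P.M.zero_closed, of n]
  by simp

lemma ten_neg_r:
  assumes "x \<in> carrier A" "p \<in> carrier (P n)" shows "ten n x (\<ominus>\<^bsub>P n\<^esub> p) = \<ominus>\<^bsub>C n\<^esub> ten n x p"
proof -
  have "ten n x (\<ominus>\<^bsub>P n\<^esub> p) \<oplus>\<^bsub>C n\<^esub> ten n x p = \<zero>\<^bsub>C n\<^esub>"
    using assms by (simp add: ten_zero_r P.M.l_neg flip: ten_add_r)
  then show ?thesis using assms by (intro C.M.minus_equality[symmetric]) (simp_all add: ten_closed)
qed

lemma ten_diff_r: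
  "\<lbrakk>x \<in> carrier A; p \<in> carrier (P n); p' \<in> carrier (P n)\<rbrakk>
    \<Longrightarrow> ten n x (p \<ominus>\<^bsub>P n\<^esub> p') = ten n x p \<ominus>\<^bsub>C n\<^esub> ten n x p'"
  by (simp add: a_minus_def ten_add_r ten_neg_r)

lemma ten_finsum_r:
  assumes "x \<in> carrier A" "p \<in> S \<rightarrow> carrier (P n)"
  shows "ten n x (\<Oplus>\<^bsub>P n\<^esub>i\<in>S. p i) = (\<Oplus>\<^bsub>C n\<^esub>i\<in>S. ten n x (p i))"
  using assms(2)
proof (induction S rule: infinite_finite_induct)
  case (insert i S)
  then show ?case using assms(1) by (simp add: Pi_iff ten_add_r ten_closed)
qed (use assms(1) in \<open>simp_all add: ten_zero_r\<close>)

lemma D_D: "X \<in> carrier (C (Suc (Suc n))) \<Longrightarrow> D n (D (Suc n) X) = \<zero>\<^bsub>C n\<^esub>"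
proof (rule C_eqI[OF C_module, of "\<lambda>X. D n (D (Suc n) X)" _ n "\<lambda>_. \<zero>\<^bsub>C n\<^esub>"])
  show "(\<lambda>X. D n (D (Suc n) X)) \<in> lin_maps K (C (Suc (Suc n))) (C n)"
    by (rule lin_maps_compose[OF D.lin D.lin])
  show "(\<lambda>_. \<zero>\<^bsub>C n\<^esub>) \<in> lin_maps K (C (Suc (Suc n))) (C n)" by (rule lin_mapsI) simp_all
  show "D n (D (Suc n) (ten (Suc (Suc n)) x p)) = \<zero>\<^bsub>C n\<^esub>"
    if "x \<in> carrier A" "p \<in> carrier (P (Suc (Suc n)))" for x p
    using that by (simp add: tmap_ten[OF d_lin] d_d ten_zero_r)
qed

lemma HH_eq: "HH K A P d q = homology C D q"
  by (simp add: HH_def Tor_def)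

end

section \<open>The homology groups\<close>

context hochschild
begin

lemma cycles_submodule: "submodule (cycles C D q) K (C q)"
  by (cases q) (simp_all add: cycles_def C.carrier_submodule D.kernel_submodule)

lemma boundaries_subset: "D q ` carrier (C (Suc q)) \<subseteq> cycles C D q"
  by (cases q) (auto simp: cycles_def D_D)

lemma homology_quotient:
  "quotient K ((C q)\<lparr>carrier := cycles C D q\<rparr>) (D q ` carrier (C (Suc q)))"
proof (rule quotientI)
  show M: "left_module K ((C q)\<lparr>carrier := cycles C D q\<rparr>)"
    by (rule C.restrict_left_module[OF cycles_submodule])
  interpret Z: left_module K "(C q)\<lparr>carrier := cycles C D q\<rparr>" by (rule M)
  note im = C.submoduleD[OF D.image_submodule[of q]]
  show "submodule (D q ` carrier (C (Suc q))) K ((C q)\<lparr>carrier := cycles C D q\<rparr>)"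
    by (rule Z.submoduleI) (use boundaries_subset im in simp_all)
qed

lemma HH_iso:
  assumes V: "left_module K V" and f: "f \<in> lin_maps K ((C q)\<lparr>carrier := cycles C D q\<rparr>) V"
    and surj: "\<And>v. v \<in> carrier V \<Longrightarrow> \<exists>X\<in>cycles C D q. f X = v"
    and boundary: "\<And>X. X \<in> carrier (C (Suc q)) \<Longrightarrow> f (D q X) = \<zero>\<^bsub>V\<^esub>"
    and ker: "\<And>X. \<lbrakk>X \<in> cycles C D q; f X = \<zero>\<^bsub>V\<^esub>\<rbrakk> \<Longrightarrow> X \<in> D q ` carrier (C (Suc q))"
  shows "lin_iso K (HH K A P d q) V"
proof -
  have img: "f ` carrier ((C q)\<lparr>carrier := cycles C D q\<rparr>) = carrier V"
    using surj lin_maps_closed[OF f] by (auto simp: image_iff)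
  show ?thesis
    unfolding HH_eq homology_def
    by (rule quotient.first_isomorphism[OF homology_quotient V f img]) (use boundary ker in auto)
qed

lemma HH_zero:
  assumes "cycles C D q \<subseteq> D q ` carrier (C (Suc q))"
  shows "carrier (HH K A P d q) = {\<zero>\<^bsub>HH K A P d q\<^esub>}"
proof -
  interpret Q: quotient K "(C q)\<lparr>carrier := cycles C D q\<rparr>" "D q ` carrier (C (Suc q))"
    by (rule homology_quotient)
  have "Q.proj X = D q ` carrier (C (Suc q))" if "X \<in> cycles C D q" for X
    using that assms Q.proj_eq_I_iff[of X] by auto
  then have "Q.proj ` cycles C D q = {D q ` carrier (C (Suc q))}"
    using C.submodule_zero[OF cycles_submodule] by blast
  then show ?thesis
    unfolding HH_eq homology_def by (simp add: Q.carrier_quot Q.zero_quot)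
qed

end

context compared
begin

text \<open>
  The tensored comparison maps: \<open>G0\<close> and the components \<open>G1 i\<close> lead from \<open>A \<otimes>\<^sub>E P\<close> to the complex
  \<open>A\<^sup>m \<longrightarrow> A\<close>, while \<open>a \<mapsto> a \<otimes> p0\<close> and \<open>F1\<close> below lead back.
\<close>

definition G0 where "G0 = tensor_lift K A (\<lambda>x p. act x (g0 p))"
definition G1 where "G1 i = tensor_lift K A (\<lambda>x p. act x (g1 i p))"

lemma act_g_lift:
  assumes g: "g \<in> lin_maps E (P n) (regular E)"
  shows "tensor_lift K A (\<lambda>x p. act x (g p)) \<in> lin_maps K (C n) A"
    and "\<And>x p. \<lbrakk>x \<in> carrier A; p \<in> carrier (P n)\<rbrakk> \<Longrightarrow> tensor_lift K A (\<lambda>x p. act x (g p)) (ten n x p) = act x (g p)"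
proof -
  note gD = lin_mapsD[OF g, unfolded regular_simps]
  have "act x (g (p \<oplus>\<^bsub>P n\<^esub> p')) = act x (g p) \<oplus>\<^bsub>A\<^esub> act x (g p')"
    if "x \<in> carrier A" "p \<in> carrier (P n)" "p' \<in> carrier (P n)" for x p p'
    using that gD lin_maps_add[OF act_lin_r] by simp
  moreover have "act (act x X) (g p) = act x (g (X \<odot>\<^bsub>P n\<^esub> p))"
    if "X \<in> carrier E" "x \<in> carrier A" "p \<in> carrier (P n)" for X x p
    using that gD by (simp add: act_mult)
  ultimately have lift: "tensor_lift K A (\<lambda>x p. act x (g p)) \<in> lin_maps K (C n) A"
    "\<And>x p. \<lbrakk>x \<in> carrier A; p \<in> carrier (P n)\<rbrakk> \<Longrightarrow> tensor_lift K A (\<lambda>x p. act x (g p)) (ten n x p) = act x (g p)"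
    using C_lift[OF A_mod, of n "\<lambda>x p. act x (g p)"] gD(1)
    by (simp_all add: act_add_l act_smult_l)
  show "tensor_lift K A (\<lambda>x p. act x (g p)) \<in> lin_maps K (C n) A"
    and "\<And>x p. \<lbrakk>x \<in> carrier A; p \<in> carrier (P n)\<rbrakk> \<Longrightarrow> tensor_lift K A (\<lambda>x p. act x (g p)) (ten n x p) = act x (g p)"
    using lift by simp_all
qed

lemma G0_lin: "G0 \<in> lin_maps K (C 0) A"
  and G0_ten: "\<lbrakk>x \<in> carrier A; q \<in> carrier (P 0)\<rbrakk> \<Longrightarrow> G0 (ten 0 x q) = act x (g0 q)"
  unfolding G0_def using act_g_lift[OF g0_lin] by simp_all

lemma G1_lin: "\<lbrakk>1 \<le> i; i \<le> m\<rbrakk> \<Longrightarrow> G1 i \<in> lin_maps K (C 1) A"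
  and G1_ten: "\<lbrakk>1 \<le> i; i \<le> m; x \<in> carrier A; q \<in> carrier (P 1)\<rbrakk> \<Longrightarrow> G1 i (ten 1 x q) = act x (g1 i q)"
  unfolding G1_def using act_g_lift[OF g1_lin] by simp_all

lemma G1_closed: "\<lbrakk>1 \<le> i; i \<le> m; X \<in> carrier (C 1)\<rbrakk> \<Longrightarrow> G1 i X \<in> carrier A"
  by (rule lin_maps_closed[OF G1_lin])

lemma G0_D: "X \<in> carrier (C 1) \<Longrightarrow> G0 (D 0 X) = b (\<lambda>i. G1 i X)"
proof -
  assume X: "X \<in> carrier (C 1)"
  have D0: "D 0 \<in> lin_maps K (C 1) (C 0)" using D.lin[of 0] by simp
  have aw: "(\<lambda>X. act (G1 i X) (w i)) \<in> lin_maps K (C 1) A" if "i \<in> {1..m}" for i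
    using that lin_maps_compose[OF G1_lin act_lin_l, of i "w i"] by simp
  have "G0 (D 0 X) = (\<Oplus>\<^bsub>A\<^esub>i\<in>{1..m}. act (G1 i X) (w i))"
  proof (rule C_eqI[OF A_mod lin_maps_compose[OF D0 G0_lin]
        A.L.lin_maps_finsum[OF C_module aw] _ X])
    fix x q assume xq: "x \<in> carrier A" "q \<in> carrier (P 1)"
    have "G0 (D 0 (ten 1 x q)) = act x (g0 (d 0 q))"
      using xq tmap_ten[OF d_lin[of 0], of x q] by (simp add: G0_ten)
    also have "\<dots> = b (\<lambda>i. act x (g1 i q))"
      using xq g1_closed[OF _ _ xq(2)] by (simp only: g1_sum[symmetric]) (rule b_act[symmetric], auto)
    also have "\<dots> = (\<Oplus>\<^bsub>A\<^esub>i\<in>{1..m}. act (act x (g1 i q)) (w i))"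
      using xq g1_closed[OF _ _ xq(2)] by (intro b_eq) auto
    also have "\<dots> = (\<Oplus>\<^bsub>A\<^esub>i\<in>{1..m}. act (G1 i (ten 1 x q)) (w i))"
      using xq g1_closed[OF _ _ xq(2)] by (intro A.A.finsum_cong') (auto simp: G1_ten[simplified])
    finally show "G0 (D 0 (ten 1 x q)) = (\<Oplus>\<^bsub>A\<^esub>i\<in>{1..m}. act (G1 i (ten 1 x q)) (w i))" .
  qed
  also have "\<dots> = b (\<lambda>i. G1 i X)" using G1_closed[OF _ _ X] by (intro b_eq[symmetric]) auto
  finally show ?thesis .
qed

lemma G1_D: "\<lbrakk>1 \<le> i; i \<le> m; X \<in> carrier (C 2)\<rbrakk> \<Longrightarrow> G1 i (D 1 X) = \<zero>\<^bsub>A\<^esub>"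
proof (rule C_eqI[OF A_mod, of "\<lambda>X. G1 i (D 1 X)" 2 "\<lambda>_. \<zero>\<^bsub>A\<^esub>"])
  assume i: "1 \<le> i" "i \<le> m"
  have D1: "D 1 \<in> lin_maps K (C 2) (C 1)" using D.lin[of 1] by (simp add: numeral_2_eq_2)
  show "(\<lambda>X. G1 i (D 1 X)) \<in> lin_maps K (C 2) A" by (rule lin_maps_compose[OF D1 G1_lin[OF i]])
  show "(\<lambda>_. \<zero>\<^bsub>A\<^esub>) \<in> lin_maps K (C 2) A" by (rule lin_mapsI) simp_all
  fix x q assume xq: "x \<in> carrier A" "q \<in> carrier (P 2)"
  have d1: "d 1 \<in> lin_maps E (P 2) (P 1)" using d_lin[of 1] by (simp add: numeral_2_eq_2)
  show "G1 i (D 1 (ten 2 x q)) = \<zero>\<^bsub>A\<^esub>"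
    using tmap_ten[OF d1 xq] G1_ten[OF i xq(1) lin_maps_closed[OF d1 xq(2)]] g1_d[OF i xq(2)]
      lin_maps_zero[OF E_mod A_mod act_lin_r[OF xq(1)]]
    by simp
qed

text \<open>
  Hence \<open>G0\<close> after \<open>a \<mapsto> a \<otimes> p0\<close> is the identity modulo the image of \<open>b\<close>.
\<close>

lemma G0_F0:
  assumes a: "a \<in> carrier A"
  shows "G0 (ten 0 a p0) = a \<oplus>\<^bsub>A\<^esub> b (\<lambda>i. act a (\<kappa> i))"
proof -
  have \<kappa>: "\<kappa> \<in> {1..m} \<rightarrow> carrier E" using \<kappa>_closed by auto
  have s: "(\<Oplus>\<^bsub>E\<^esub>i\<in>{1..m}. \<kappa> i \<otimes>\<^bsub>E\<^esub> w i) \<in> carrier E"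
    using \<kappa> by (intro EA.E.A.finsum_closed) (auto simp: Pi_iff)
  have "G0 (ten 0 a p0) = act a (g0 p0)" using a by (simp add: G0_ten)
  also have "\<dots> = act a \<one>\<^bsub>E\<^esub> \<oplus>\<^bsub>A\<^esub> act a (\<Oplus>\<^bsub>E\<^esub>i\<in>{1..m}. \<kappa> i \<otimes>\<^bsub>E\<^esub> w i)"
    unfolding g0_p0 using s lin_maps_add[OF act_lin_r[OF a]] by simp
  finally show ?thesis using a by (simp only: act_one b_act[OF a \<kappa>])
qed

definition F1 where "F1 a = (\<Oplus>\<^bsub>C 1\<^esub>i\<in>{1..m}. ten 1 (a i) (p i))"

lemma F1_closed: "a \<in> {1..m} \<rightarrow> carrier A \<Longrightarrow> F1 a \<in> carrier (C 1)"
  unfolding F1_def by (intro C.M.finsum_closed) (auto simp: Pi_iff intro!: ten_closed p_closed[simplified])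

lemma D_F1:
  assumes a: "a \<in> {1..m} \<rightarrow> carrier A"
  shows "D 0 (F1 a) = ten 0 (b a) p0"
proof -
  interpret t: linear_map K A "C 0" "\<lambda>x. ten 0 x p0"
    by (intro linear_mapI A_mod C_module ten_lin_l) simp
  have "D 0 (F1 a) = (\<Oplus>\<^bsub>C 0\<^esub>i\<in>{1..m}. D 0 (ten 1 (a i) (p i)))"
    unfolding F1_def using D.finsum[of "\<lambda>i. ten 1 (a i) (p i)" "{1..m}" 0] a p_closed
    by (simp add: Pi_iff ten_closed)
  also have "\<dots> = (\<Oplus>\<^bsub>C 0\<^esub>i\<in>{1..m}. ten 0 (act (a i) (w i)) p0)"
    using a p_closed tmap_ten[OF d_lin[of 0]]
    by (intro C.M.finsum_cong') (auto simp: Pi_iff d_p ten_act ten_closed)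
  also have "\<dots> = ten 0 (\<Oplus>\<^bsub>A\<^esub>i\<in>{1..m}. act (a i) (w i)) p0"
    using a by (intro t.finsum[symmetric]) (auto simp: Pi_iff)
  finally show ?thesis by (simp only: b_eq[OF a])
qed

text \<open>
  Hence \<open>G1\<close> after \<open>F1\<close> is the identity on the kernel of \<open>b\<close>.
\<close>

lemma G1_F1:
  assumes a: "a \<in> {1..m} \<rightarrow> carrier A" and i: "1 \<le> i" "i \<le> m"
  shows "G1 i (F1 a) = a i \<oplus>\<^bsub>A\<^esub> act (b a) (\<kappa> i)"
proof -
  interpret G: linear_map K "C 1" A "G1 i"
    by (rule linear_mapI[OF C_module A_mod G1_lin[OF i]])
  interpret r: linear_map K A A "\<lambda>x. act x (\<kappa> i)"
    by (rule linear_mapI[OF A_mod A_mod act_lin_l[OF \<kappa>_closed[OF i]]])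
  have ai: "a j \<in> carrier A" if "j \<in> {1..m}" for j using a that by auto
  have "G1 i (F1 a) = (\<Oplus>\<^bsub>A\<^esub>j\<in>{1..m}. G1 i (ten 1 (a j) (p j)))"
    unfolding F1_def using a p_closed by (intro G.finsum) (auto intro!: ten_closed)
  also have "\<dots> = (\<Oplus>\<^bsub>A\<^esub>j\<in>{1..m}. (if i = j then a j else \<zero>\<^bsub>A\<^esub>) \<oplus>\<^bsub>A\<^esub> act (act (a j) (w j)) (\<kappa> i))"
  proof (rule A.A.finsum_cong'[OF refl])
    show "(\<lambda>j. (if i = j then a j else \<zero>\<^bsub>A\<^esub>) \<oplus>\<^bsub>A\<^esub> act (act (a j) (w j)) (\<kappa> i)) \<in> {1..m} \<rightarrow> carrier A"
      using ai \<kappa>_closed[OF i] by auto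
    fix j assume j: "j \<in> {1..m}"
    let ?\<delta> = "if i = j then \<one>\<^bsub>E\<^esub> else \<zero>\<^bsub>E\<^esub>"
    have "G1 i (ten 1 (a j) (p j)) = act (a j) (?\<delta> \<oplus>\<^bsub>E\<^esub> w j \<otimes>\<^bsub>E\<^esub> \<kappa> i)"
      using j ai[OF j] G1_ten[OF i ai[OF j] p_closed] g1_p[OF i] by simp
    also have "\<dots> = act (a j) ?\<delta> \<oplus>\<^bsub>A\<^esub> act (a j) (w j \<otimes>\<^bsub>E\<^esub> \<kappa> i)"
      using j \<kappa>_closed[OF i] by (intro lin_maps_add[OF act_lin_r[OF ai[OF j]]]) simp_all
    also have "act (a j) ?\<delta> = (if i = j then a j else \<zero>\<^bsub>A\<^esub>)"
      using act_one[OF ai[OF j]]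
        lin_maps_zero[OF E_mod A_mod act_lin_r[OF ai[OF j]]]
      by simp
    also have "act (a j) (w j \<otimes>\<^bsub>E\<^esub> \<kappa> i) = act (act (a j) (w j)) (\<kappa> i)"
      using j ai[OF j] \<kappa>_closed[OF i] by (simp add: act_mult)
    finally show "G1 i (ten 1 (a j) (p j))
        = (if i = j then a j else \<zero>\<^bsub>A\<^esub>) \<oplus>\<^bsub>A\<^esub> act (act (a j) (w j)) (\<kappa> i)" .
  qed
  also have "\<dots> = (\<Oplus>\<^bsub>A\<^esub>j\<in>{1..m}. if i = j then a j else \<zero>\<^bsub>A\<^esub>)
      \<oplus>\<^bsub>A\<^esub> (\<Oplus>\<^bsub>A\<^esub>j\<in>{1..m}. act (act (a j) (w j)) (\<kappa> i))"
    using ai \<kappa>_closed[OF i] by (intro A.A.finsum_addf) auto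
  also have "(\<Oplus>\<^bsub>A\<^esub>j\<in>{1..m}. if i = j then a j else \<zero>\<^bsub>A\<^esub>) = a i"
    using ai i by (intro A.A.finsum_singleton) auto
  also have "(\<Oplus>\<^bsub>A\<^esub>j\<in>{1..m}. act (act (a j) (w j)) (\<kappa> i)) = act (b a) (\<kappa> i)"
    unfolding b_eq[OF a] using ai by (intro r.finsum[symmetric]) auto
  finally show ?thesis .
qed

text \<open>
  Both sides of each identity are linear in \<open>X\<close>, so that it suffices to know them for \<open>X = x \<otimes> q\<close>, where
  they express the homotopy on \<open>P\<close>.
\<close>

lemma tensored_homotopy:
  obtains H where "\<And>n. H n \<in> lin_maps K (C n) (C (Suc n))"
    "\<And>X. X \<in> carrier (C 0) \<Longrightarrow> X = D 0 (H 0 X) \<oplus>\<^bsub>C 0\<^esub> ten 0 (G0 X) p0"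
    "\<And>X. X \<in> carrier (C 1) \<Longrightarrow> X = (D 1 (H 1 X) \<oplus>\<^bsub>C 1\<^esub> H 0 (D 0 X)) \<oplus>\<^bsub>C 1\<^esub> F1 (\<lambda>i. G1 i X)"
    "\<And>n X. X \<in> carrier (C (Suc (Suc n))) \<Longrightarrow>
      X = D (Suc (Suc n)) (H (Suc (Suc n)) X) \<oplus>\<^bsub>C (Suc (Suc n))\<^esub> H (Suc n) (D (Suc n) X)"
proof -
  obtain h where h: "\<And>n. h n \<in> lin_maps E (P n) (P (Suc n))"
    and h0: "\<And>x. x \<in> carrier (P 0) \<Longrightarrow> d 0 (h 0 x) = x \<ominus>\<^bsub>P 0\<^esub> g0 x \<odot>\<^bsub>P 0\<^esub> p0"
    and h1: "\<And>x. x \<in> carrier (P 1) \<Longrightarrow> d 1 (h 1 x) = (x \<ominus>\<^bsub>P 1\<^esub> f1 x) \<ominus>\<^bsub>P 1\<^esub> h 0 (d 0 x)"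
    and h2: "\<And>n x. x \<in> carrier (P (Suc (Suc n))) \<Longrightarrow>
      d (Suc (Suc n)) (h (Suc (Suc n)) x) = x \<ominus>\<^bsub>P (Suc (Suc n))\<^esub> h (Suc n) (d (Suc n) x)"
    using homotopy_exists by blast
  have cancel: "u \<ominus>\<^bsub>C n\<^esub> v \<oplus>\<^bsub>C n\<^esub> v = u" if "u \<in> carrier (C n)" "v \<in> carrier (C n)" for n u v
    using that by (simp add: a_minus_def C.M.a_assoc C.M.l_neg)
  let ?H = "\<lambda>n. tmap (Suc n) (h n)"
  note Hl = tmap_lin[OF h] and Ht = tmap_ten[OF h]
  note hc = lin_maps_closed[OF h] and dc = lin_maps_closed[OF d_lin]
  have id: "(\<lambda>X. X) \<in> lin_maps K (C n) (C n)" for n by (rule lin_mapsI) simp_all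
  have DH: "(\<lambda>X. D n (?H n X)) \<in> lin_maps K (C n) (C n)" for n
    by (rule lin_maps_compose[OF Hl D.lin])
  have HD: "(\<lambda>X. ?H n (D n X)) \<in> lin_maps K (C (Suc n)) (C (Suc n))" for n
    by (rule lin_maps_compose[OF D.lin Hl])
  show thesis
  proof (rule that[of ?H, OF Hl])
    fix X assume X: "X \<in> carrier (C 0)"
    have F: "(\<lambda>X. ten 0 (G0 X) p0) \<in> lin_maps K (C 0) (C 0)"
      by (rule lin_maps_compose[OF G0_lin ten_lin_l]) simp
    show "X = D 0 (?H 0 X) \<oplus>\<^bsub>C 0\<^esub> ten 0 (G0 X) p0"
    proof (rule C_eqI[OF C_module id C.lin_maps_sum[OF C_module DH F] _ X])
      fix x q assume xq: "x \<in> carrier A" "q \<in> carrier (P 0)"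
      then show "ten 0 x q = D 0 (?H 0 (ten 0 x q)) \<oplus>\<^bsub>C 0\<^esub> ten 0 (G0 (ten 0 x q)) p0"
        using hc[of q 0]
        by (simp add: Ht tmap_ten[OF d_lin] h0 ten_diff_r G0_ten ten_act cancel ten_closed)
    qed
  next
    fix X assume X: "X \<in> carrier (C 1)"
    have F: "(\<lambda>X. F1 (\<lambda>i. G1 i X)) \<in> lin_maps K (C 1) (C 1)"
      unfolding F1_def
      by (intro C.lin_maps_finsum C_module lin_maps_compose[OF G1_lin ten_lin_l]) (use p_closed in auto)
    have DH1: "(\<lambda>X. D 1 (?H 1 X)) \<in> lin_maps K (C 1) (C 1)" by (rule DH)
    have HD0: "(\<lambda>X. ?H 0 (D 0 X)) \<in> lin_maps K (C 1) (C 1)" using HD[of 0] by simp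
    show "X = (D 1 (?H 1 X) \<oplus>\<^bsub>C 1\<^esub> ?H 0 (D 0 X)) \<oplus>\<^bsub>C 1\<^esub> F1 (\<lambda>i. G1 i X)"
    proof (rule C_eqI[OF C_module id C.lin_maps_sum[OF C_module C.lin_maps_sum[OF C_module DH1 HD0] F] _ X])
      fix x q assume xq: "x \<in> carrier A" "q \<in> carrier (P 1)"
      have f1c: "f1 q \<in> carrier (P 1)" by (rule lin_maps_closed[OF f1_lin xq(2)])
      have hd: "h 0 (d 0 q) \<in> carrier (P 1)" using hc[of "d 0 q" 0] dc[of q 0] xq(2) by simp
      have "F1 (\<lambda>i. G1 i (ten 1 x q)) = (\<Oplus>\<^bsub>C 1\<^esub>i\<in>{1..m}. ten 1 x (g1 i q \<odot>\<^bsub>P 1\<^esub> p i))"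
        unfolding F1_def
        using xq g1_closed[OF _ _ xq(2)] p_closed
        by (intro C.M.finsum_cong') (auto simp: G1_ten[simplified] ten_act ten_closed)
      also have "\<dots> = ten 1 x (f1 q)"
        unfolding f1_def using xq g1_closed[OF _ _ xq(2)] p_closed
        by (intro ten_finsum_r[symmetric]) auto
      finally have F1q: "F1 (\<lambda>i. G1 i (ten 1 x q)) = ten 1 x (f1 q)" .
      have HD0q: "?H 0 (D 0 (ten 1 x q)) = ten 1 x (h 0 (d 0 q))"
        using xq tmap_ten[OF d_lin[of 0]] Ht[of x "d 0 q" 0] dc[of q 0] by simp
      have "D 1 (?H 1 (ten 1 x q)) = ten 1 x (d 1 (h 1 q))"
        using xq tmap_ten[OF d_lin[of 1]] Ht[of x q 1] hc[of q 1] by simp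
      also have "\<dots> = ten 1 x q \<ominus>\<^bsub>C 1\<^esub> ten 1 x (f1 q) \<ominus>\<^bsub>C 1\<^esub> ten 1 x (h 0 (d 0 q))"
        using xq f1c hd h1[OF xq(2)] by (simp only: ten_diff_r P.M.minus_closed)
      finally show "ten 1 x q = (D 1 (?H 1 (ten 1 x q)) \<oplus>\<^bsub>C 1\<^esub> ?H 0 (D 0 (ten 1 x q)))
          \<oplus>\<^bsub>C 1\<^esub> F1 (\<lambda>i. G1 i (ten 1 x q))"
        using ten_closed[OF xq] ten_closed[OF xq(1) f1c] ten_closed[OF xq(1) hd]
        by (simp only: HD0q F1q cancel C.M.minus_closed)
    qed
  next
    fix n X assume X: "X \<in> carrier (C (Suc (Suc n)))"
    show "X = D (Suc (Suc n)) (?H (Suc (Suc n)) X) \<oplus>\<^bsub>C (Suc (Suc n))\<^esub> ?H (Suc n) (D (Suc n) X)"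
    proof (rule C_eqI[OF C_module id C.lin_maps_sum[OF C_module DH HD] _ X])
      fix x q assume xq: "x \<in> carrier A" "q \<in> carrier (P (Suc (Suc n)))"
      have hd: "h (Suc n) (d (Suc n) q) \<in> carrier (P (Suc (Suc n)))" by (rule hc[OF dc[OF xq(2)]])
      show "ten (Suc (Suc n)) x q = D (Suc (Suc n)) (?H (Suc (Suc n)) (ten (Suc (Suc n)) x q))
          \<oplus>\<^bsub>C (Suc (Suc n))\<^esub> ?H (Suc n) (D (Suc n) (ten (Suc (Suc n)) x q))"
        using xq hd
        by (simp add: Ht tmap_ten[OF d_lin] hc dc h2 ten_diff_r cancel ten_closed)
    qed
  qed
qed

text \<open>
  \<open>G0\<close> induces the isomorphism. If \<open>G0 X = b a\<close>, then the homotopy exhibits \<open>X\<close> as a boundary up to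
  \<open>b a \<otimes> p0\<close>, which is the boundary of \<open>F1 a\<close>.
\<close>

lemma HH_0: "lin_iso K (HH K A P d 0) (quot_module A (commutator_space K A))"
proof (rule tensored_homotopy)
  fix H assume H: "\<And>n. H n \<in> lin_maps K (C n) (C (Suc n))"
    and H0: "\<And>X. X \<in> carrier (C 0) \<Longrightarrow> X = D 0 (H 0 X) \<oplus>\<^bsub>C 0\<^esub> ten 0 (G0 X) p0"
  interpret AB: quotient K A "commutator_space K A"
    by (rule quotientI[OF A_mod commutator_submodule])
  let ?f = "\<lambda>X. AB.proj (G0 X)"
  have V: "left_module K (quot_module A (commutator_space K A))" by (rule AB.left_module_quot)
  have cyc: "cycles C D 0 = carrier (C 0)" by (simp add: cycles_def)
  have f: "?f \<in> lin_maps K (C 0) (quot_module A (commutator_space K A))"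
    by (rule lin_maps_compose[OF G0_lin AB.proj_lin])
  have bE: "\<exists>a\<in>{1..m} \<rightarrow> carrier A. x = b a" if "x \<in> commutator_space K A" for x
  proof -
    obtain a where "a \<in> carrier (copower A {1..m})" "x = b a"
      using \<open>x \<in> commutator_space K A\<close> unfolding commutator_space_eq by (rule imageE)
    then show ?thesis using copower_memD by (intro bexI[of _ a])
  qed
  have bI: "b a \<in> commutator_space K A" if a: "a \<in> {1..m} \<rightarrow> carrier A" for a
    unfolding commutator_space_eq b_restrict[OF a, symmetric]
    using a by (intro imageI copower_restrict) auto
  show ?thesis
  proof (rule HH_iso[OF V])
    show "?f \<in> lin_maps K ((C 0)\<lparr>carrier := cycles C D 0\<rparr>) (quot_module A (commutator_space K A))"
      using f by (simp add: cyc)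
  next
    fix v assume "v \<in> carrier (quot_module A (commutator_space K A))"
    then obtain a where a: "a \<in> carrier A" "v = AB.proj a" by (rule AB.carrier_quotE)
    have ak: "(\<lambda>i. act a (\<kappa> i)) \<in> {1..m} \<rightarrow> carrier A" using a \<kappa>_closed by auto
    have "G0 (ten 0 a p0) \<ominus>\<^bsub>A\<^esub> a = b (\<lambda>i. act a (\<kappa> i))"
      using a b_closed[OF ak] A.A.r_neg1[of a "b (\<lambda>i. act a (\<kappa> i))"]
      by (simp only: G0_F0 a_minus_def A.A.a_comm A.A.a_closed A.A.a_inv_closed)
    then have "?f (ten 0 a p0) = v"
      using a bI[OF ak] lin_maps_closed[OF G0_lin ten_closed[OF a(1) p0_closed]] by (simp add: AB.proj_eq_iff)
    then show "\<exists>X\<in>cycles C D 0. ?f X = v" unfolding cyc using ten_closed[OF a(1) p0_closed] by blast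
  next
    fix X assume X: "X \<in> carrier (C (Suc 0))"
    have "(\<lambda>i. G1 i X) \<in> {1..m} \<rightarrow> carrier A" using G1_closed X by auto
    from bI[OF this] have "G0 (D 0 X) \<in> commutator_space K A" using G0_D X by simp
    then show "?f (D 0 X) = \<zero>\<^bsub>quot_module A (commutator_space K A)\<^esub>"
      using lin_maps_closed[OF G0_lin D.closed[OF X]] by (simp add: AB.zero_quot AB.proj_eq_I_iff)
  next
    fix X assume "X \<in> cycles C D 0" and f0: "?f X = \<zero>\<^bsub>quot_module A (commutator_space K A)\<^esub>"
    then have X: "X \<in> carrier (C 0)" by (simp add: cyc)
    have "G0 X \<in> commutator_space K A"
      using f0 lin_maps_closed[OF G0_lin X] by (simp add: AB.zero_quot AB.proj_eq_I_iff)
    then obtain a where a: "a \<in> {1..m} \<rightarrow> carrier A" "G0 X = b a" using bE by blast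
    have "X = D 0 (H 0 X) \<oplus>\<^bsub>C 0\<^esub> D 0 (F1 a)"
      using H0[OF X] by (simp only: a(2) D_F1[OF a(1)])
    also have "\<dots> = D 0 (H 0 X \<oplus>\<^bsub>C (Suc 0)\<^esub> F1 a)"
      using lin_maps_closed[OF H X] F1_closed[OF a(1)] by (simp add: D.add)
    finally have "X = D 0 (H 0 X \<oplus>\<^bsub>C (Suc 0)\<^esub> F1 a)" .
    moreover have "H 0 X \<oplus>\<^bsub>C (Suc 0)\<^esub> F1 a \<in> carrier (C (Suc 0))"
      using lin_maps_closed[OF H X] F1_closed[OF a(1)] by simp
    ultimately show "X \<in> D 0 ` carrier (C (Suc 0))" by (rule image_eqI)
  qed
qed

text \<open>
  \<open>G1\<close> induces the isomorphism: a cycle is homologous to its image under \<open>F1 \<circ> G1\<close>.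
\<close>

lemma HH_1: "lin_iso K (HH K A P d 1) (b_kernel A z m)"
proof (rule tensored_homotopy)
  fix H assume H: "\<And>n. H n \<in> lin_maps K (C n) (C (Suc n))"
    and H1: "\<And>X. X \<in> carrier (C 1) \<Longrightarrow> X = (D 1 (H 1 X) \<oplus>\<^bsub>C 1\<^esub> H 0 (D 0 X)) \<oplus>\<^bsub>C 1\<^esub> F1 (\<lambda>i. G1 i X)"
  let ?r = "\<lambda>a i. if i \<in> {1..m} then a i else \<zero>\<^bsub>A\<^esub>"
  let ?f = "\<lambda>X. ?r (\<lambda>i. G1 i X)"
  have cyc: "X \<in> cycles C D 1 \<longleftrightarrow> X \<in> carrier (C 1) \<and> D 0 X = \<zero>\<^bsub>C 0\<^esub>" for X
    by (simp add: cycles_def)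
  have bk: "carrier (b_kernel A z m) = {a \<in> carrier (copower A {1..m}). b a = \<zero>\<^bsub>A\<^esub>}"
    "add (b_kernel A z m) = add (copower A {1..m})" "smult (b_kernel A z m) = smult (copower A {1..m})"
    "zero (b_kernel A z m) = zero (copower A {1..m})"
    unfolding b_kernel_eq by simp_all
  have G1A: "(\<lambda>i. G1 i X) \<in> {1..m} \<rightarrow> carrier A" if "X \<in> carrier (C 1)" for X
    using G1_closed that by auto
  have zero_r: "act \<zero>\<^bsub>A\<^esub> (\<kappa> i) = \<zero>\<^bsub>A\<^esub>" if "1 \<le> i" "i \<le> m" for i
    by (rule lin_maps_zero[OF A_mod A_mod
          act_lin_l[OF \<kappa>_closed[OF that]]])
  have F1_zero: "F1 (\<lambda>i. G1 i X) = \<zero>\<^bsub>C 1\<^esub>" if "\<And>i. i \<in> {1..m} \<Longrightarrow> G1 i X = \<zero>\<^bsub>A\<^esub>" for X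
    unfolding F1_def
  proof (rule C.M.add.finprod_one_eqI)
    fix i assume i: "i \<in> {1..m}"
    have "ten 1 \<zero>\<^bsub>A\<^esub> (p i) = \<zero>\<^bsub>C 1\<^esub>"
      using i p_closed
      by (intro lin_maps_zero[OF A_mod C_module ten_lin_l]) simp
    then show "ten 1 (G1 i X) (p i) = \<zero>\<^bsub>C 1\<^esub>" using that[OF i] by simp
  qed
  show ?thesis
  proof (rule HH_iso[OF b_kernel_module])
    show "?f \<in> lin_maps K ((C 1)\<lparr>carrier := cycles C D 1\<rparr>) (b_kernel A z m)"
    proof (rule lin_mapsI)
      fix X assume "X \<in> carrier ((C 1)\<lparr>carrier := cycles C D 1\<rparr>)"
      then have X: "X \<in> carrier (C 1)" "D 0 X = \<zero>\<^bsub>C 0\<^esub>" by (simp_all add: cyc[simplified])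
      have "b (?f X) = G0 (D 0 X)" using G0_D[OF X(1)] b_restrict[OF G1A[OF X(1)]] by simp
      also have "\<dots> = \<zero>\<^bsub>A\<^esub>"
        unfolding X(2) by (rule lin_maps_zero[OF C_module A_mod G0_lin])
      finally have "b (?f X) = \<zero>\<^bsub>A\<^esub>" .
      moreover have "?f X \<in> carrier (copower A {1..m})"
        using funcset_mem[OF G1A[OF X(1)]] by (rule copower_restrict)
      ultimately show "?f X \<in> carrier (b_kernel A z m)" unfolding bk(1) by blast
      show "?f (k \<odot>\<^bsub>(C 1)\<lparr>carrier := cycles C D 1\<rparr>\<^esub> X) = k \<odot>\<^bsub>b_kernel A z m\<^esub> ?f X" if k: "k \<in> carrier K" for k
        using k X(1) lin_maps_smult[OF G1_lin _ X(1)] by (auto simp: bk fun_eq_iff)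
      fix Y assume "Y \<in> carrier ((C 1)\<lparr>carrier := cycles C D 1\<rparr>)"
      then have Y: "Y \<in> carrier (C 1)" by (simp add: cyc[simplified])
      show "?f (X \<oplus>\<^bsub>(C 1)\<lparr>carrier := cycles C D 1\<rparr>\<^esub> Y) = ?f X \<oplus>\<^bsub>b_kernel A z m\<^esub> ?f Y"
        using lin_maps_add[OF G1_lin X(1) Y] by (auto simp: bk fun_eq_iff)
    qed
  next
    fix a assume "a \<in> carrier (b_kernel A z m)"
    then have a: "a \<in> carrier (copower A {1..m})" "b a = \<zero>\<^bsub>A\<^esub>" by (simp_all add: bk)
    note aA = copower_memD[OF a(1)]
    have "D 0 (F1 a) = \<zero>\<^bsub>C 0\<^esub>"
      unfolding D_F1[OF aA] a(2)
      by (rule lin_maps_zero[OF A_mod C_module ten_lin_l]) simp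
    then have "F1 a \<in> cycles C D 1" using F1_closed[OF aA] by (simp only: cyc)
    moreover have "?f (F1 a) = a"
    proof
      fix i show "?f (F1 a) i = a i"
        using a G1_F1[OF aA, of i] zero_r[of i] by (auto simp: mem_copower_iff)
    qed
    ultimately show "\<exists>X\<in>cycles C D 1. ?f X = a" by blast
  next
    fix X assume "X \<in> carrier (C (Suc 1))"
    then have "G1 i (D 1 X) = \<zero>\<^bsub>A\<^esub>" if "i \<in> {1..m}" for i
      using G1_D[of i X] that by (simp add: numeral_2_eq_2)
    then show "?f (D 1 X) = \<zero>\<^bsub>b_kernel A z m\<^esub>" by (auto simp: bk fun_eq_iff)
  next
    fix X assume "X \<in> cycles C D 1" and f0: "?f X = \<zero>\<^bsub>b_kernel A z m\<^esub>"
    then have X: "X \<in> carrier (C 1)" "D 0 X = \<zero>\<^bsub>C 0\<^esub>" by (simp_all add: cyc[simplified])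
    have "G1 i X = \<zero>\<^bsub>A\<^esub>" if "i \<in> {1..m}" for i
      using fun_cong[OF f0, of i] that by (simp add: bk)
    note F0 = F1_zero[OF this]
    have HD: "H 0 (D 0 X) = \<zero>\<^bsub>C 1\<^esub>"
      unfolding X(2) using lin_maps_zero[OF C_module C_module H[of 0]] by simp
    have HX: "H 1 X \<in> carrier (C (Suc 1))" by (rule lin_maps_closed[OF H X(1)])
    have DX: "D 1 (H 1 X) \<in> carrier (C 1)" by (rule D.closed[OF HX])
    have "X = D 1 (H 1 X)"
      using H1[OF X(1)] DX by (simp only: F0 HD C.M.r_zero)
    then show "X \<in> D 1 ` carrier (C (Suc 1))" using HX by (rule image_eqI)
  qed
qed

text \<open>
  The short complex is zero in these degrees, so that the homotopy contracts the tensored complex there.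
\<close>

lemma HH_ge_2:
  assumes "q \<ge> 2"
  shows "carrier (HH K A P d q) = {\<zero>\<^bsub>HH K A P d q\<^esub>}"
proof (rule HH_zero, rule subsetI)
  obtain n where n: "q = Suc (Suc n)" using assms by (metis add_2_eq_Suc le_Suc_ex)
  fix X assume "X \<in> cycles C D q"
  then have X: "X \<in> carrier (C q)" "D (Suc n) X = \<zero>\<^bsub>C (Suc n)\<^esub>" by (simp_all add: cycles_def n)
  show "X \<in> D q ` carrier (C (Suc q))"
  proof (rule tensored_homotopy)
    fix H assume H: "\<And>n. H n \<in> lin_maps K (C n) (C (Suc n))"
      and H2: "\<And>n X. X \<in> carrier (C (Suc (Suc n))) \<Longrightarrow>
        X = D (Suc (Suc n)) (H (Suc (Suc n)) X) \<oplus>\<^bsub>C (Suc (Suc n))\<^esub> H (Suc n) (D (Suc n) X)"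
    have HD: "H (Suc n) (D (Suc n) X) = \<zero>\<^bsub>C q\<^esub>"
      unfolding X(2) n by (rule lin_maps_zero[OF C_module C_module H])
    have HX: "H q X \<in> carrier (C (Suc q))" by (rule lin_maps_closed[OF H X(1)])
    have "X = D q (H q X) \<oplus>\<^bsub>C q\<^esub> H (Suc n) (D (Suc n) X)"
      using H2[of X n] X(1) unfolding n by blast
    also have "\<dots> = D q (H q X)"
      unfolding HD by (rule C.M.r_zero[OF D.closed[OF HX]])
    finally show "X \<in> D q ` carrier (C (Suc q))" using HX by (rule image_eqI)
  qed
qed

end

theorem proposition4p3:
  fixes K :: "'k ring" and m :: nat
    and A :: "('k, (nat list \<Rightarrow> 'k) set) module"
    and P :: "nat \<Rightarrow> (((nat list \<Rightarrow> 'k) set \<times> (nat list \<Rightarrow> 'k) set \<Rightarrow> 'k) set, 'p) module"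
    and d :: "nat \<Rightarrow> 'p \<Rightarrow> 'p"
    and e :: "'p \<Rightarrow> (nat list \<Rightarrow> 'k) set"
  assumes "field K" and "even m"
    and "A = loc_algebra K m"
    and "projective_resolution (enveloping K A) (env_left K A) P d e"
  shows "lin_iso K (HH K A P d 0) (quot_module A (commutator_space K A)) \<and>
         lin_iso K (HH K A P d 1) (b_kernel A (loc_gen K m) m) \<and>
         (\<forall>q\<ge>2. carrier (HH K A P d q) = {\<zero>\<^bsub>HH K A P d q\<^esub>})"
proof -
  have "cring K" using assms(1) by (rule fieldE(1))
  interpret hochschild K m P d e
    using \<open>cring K\<close> assms(4)
    by (intro hochschild.intro localization_env.intro localization.intro hochschild_axioms.intro)
      (simp_all add: assms(3))
  show ?thesis
  proof (rule comparison_exists)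
    fix g0 p0 p
    assume *: "g0 \<in> lin_maps E (P 0) (regular E)" "\<And>x. x \<in> carrier (P 0) \<Longrightarrow> \<epsilon> (g0 x) = e x"
      "p0 \<in> carrier (P 0)" "e p0 = \<one>\<^bsub>loc_algebra K m\<^esub>"
      "\<And>i. \<lbrakk>1 \<le> i; i \<le> m\<rbrakk> \<Longrightarrow> p i \<in> carrier (P 1)"
      "\<And>i. \<lbrakk>1 \<le> i; i \<le> m\<rbrakk> \<Longrightarrow> d 0 (p i) = w i \<odot>\<^bsub>P 0\<^esub> p0"
    interpret compared K m P d e g0 p0 p
      by (intro compared.intro hochschild_axioms compared_axioms.intro *)
    show ?thesis unfolding assms(3) using HH_0 HH_1 HH_ge_2 by simp
  qed
qed

end
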